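(* Let $r\ge1$ and let $\mathcal{L}$ be a homogeneous Lagrangian on $\mathrm{Imm}\,T^r_nX$. Then for every chart $(W^r,\Phi^r)$ on $\mathrm{Imm}\,T^r_nX$ there exists a smooth real function $L$ on $\rho^r_n(W^r)$ such that $$\mathcal{L}=\det(\mathbf{x})\;L\circ\rho^r_n\quad\text{on }W^r;$$ and conversely, if $\mathcal{L}$ is locally defined by this relation (in every such chart, for some smooth $L$), then it satisfies $\mathcal{L}(x\cdot a)=\det(a)\,\mathcal{L}(x)$ for all $a\in L^r_n$.
   Context: $X$ is a smooth manifold of dimension $N=n+m$, $n\ge 1$. $T^r_nX$ is the manifold of $(r,n)$-velocities, i.e. $r$-jets $j^r_0\gamma$ at $0$ of smooth maps $\gamma$ from a neighbourhood of $0\in\mathbb{R}^n$ to $X$; $\mathrm{Imm}\,T^r_nX$ is the open subset of regular velocities (jets of immersions). A chart $(V,(x^A))$ of $X$ induces coordinates $x^A_{j_1,\dots,j_k}(j^r_0\gamma)=\partial^k(x^A\circ\gamma)/\partial t^{j_1}\cdots\partial t^{j_k}|_0$, $0\le k\le r$, symmetric in the lower indices. $L^r_n$ is the group of $r$-jets at $0$ of local diffeomorphisms of $\mathbb{R}^n$ fixing $0$; it acts on the right on $T^r_nX$ by $j^r_0\gamma\cdot j^r_0\alpha=j^r_0(\gamma\circ\alpha)$; for $a=j^r_0\alpha$, $\det(a)$ is the Jacobian determinant of $\alpha$ at $0$. $P^r_nX=\mathrm{Imm}\,T^r_nX/L^r_n$, with projection $\rho^r_n$ (a smooth principal bundle).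 Charts: split the coordinates of a chart of $X$ (in any way) into $x^i$ ($i=1,\dots,n$) and $x^\sigma$ ($\sigma=1,\dots,m$). $W^r$ is the set of regular velocities over $V$ with $\det(\mathbf{x}):=\det(x^i_j)\ne0$; there $(z^i_j)$ is the inverse matrix of $(x^i_j)$ and $y^\sigma=x^\sigma$, $y^\sigma_{i_1,\dots,i_k}=z^j_{i_1}d_jy^\sigma_{i_2,\dots,i_k}$, where $d_j$ is the formal (total) derivative, $d_jx^A_J=x^A_{jJ}$. The chart on $W^r$ is $\Phi^r=(x^i_I,y^\sigma_I)_{|I|\le r}$; the $y^\sigma_I$ are $L^r_n$-invariant, and $(x^i,y^\sigma_I)_{|I|\le r}$ are coordinates on $\rho^r_n(W^r)$. Homogeneous Lagrangian: a smooth real function $\mathcal{L}$ on $\mathrm{Imm}\,T^r_nX$ with $\mathcal{L}(x\cdot a)=\det(a)\mathcal{L}(x)$ for all $a\in L^r_n$. *)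

theory Defs
  imports "HOL-Analysis.Analysis" "HOL-Library.Multiset"
begin

section \<open>Smooth maps between Euclidean spaces and smooth manifolds\<close>

text \<open>Both predicates are meant for open \<open>S\<close>.\<close>

primrec Ck_on :: "nat \<Rightarrow> 'a::real_normed_vector set \<Rightarrow> ('a \<Rightarrow> 'b::real_normed_vector) \<Rightarrow> bool" where
  "Ck_on 0 S f \<longleftrightarrow> continuous_on S f"
| "Ck_on (Suc k) S f \<longleftrightarrow>
     (\<forall>x\<in>S. f differentiable (at x)) \<and> (\<forall>v. Ck_on k S (\<lambda>x. frechet_derivative f (at x) v))"

definition smooth_on :: "'a::real_normed_vector set \<Rightarrow> ('a \<Rightarrow> 'b::real_normed_vector) \<Rightarrow> bool" where
  "smooth_on S f \<longleftrightarrow> (\<forall>k. Ck_on k S f)"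

text \<open>A chart is a pair of a domain and a coordinate map; the values of the coordinate map
  outside its domain are irrelevant.\<close>

type_synonym ('x, 'N) chart = "'x set \<times> ('x \<Rightarrow> real ^ 'N)"

definition is_chart :: "'x topology \<Rightarrow> ('x, 'N::finite) chart \<Rightarrow> bool" where
  "is_chart X c \<longleftrightarrow> (case c of (V, x) \<Rightarrow>
     openin X V \<and> open (x ` V) \<and> homeomorphic_map (subtopology X V) (top_of_set (x ` V)) x)"

definition compatible :: "('x, 'N::finite) chart \<Rightarrow> ('x, 'N) chart \<Rightarrow> bool" where
  "compatible c c' \<longleftrightarrow> (case c of (V, x) \<Rightarrow> case c' of (V', x') \<Rightarrow>
     smooth_on (x ` (V \<inter> V')) (x' \<circ> inv_into V x) \<and>
     smooth_on (x' ` (V \<inter> V')) (x \<circ> inv_into V' x'))"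

text \<open>\<open>A\<close> is the maximal atlas, that is, the set of all charts of the smooth structure.\<close>

definition smooth_manifold :: "'x topology \<Rightarrow> ('x, 'N::finite) chart set \<Rightarrow> bool" where
  "smooth_manifold X A \<longleftrightarrow>
     Hausdorff_space X \<and> second_countable X \<and>
     (\<forall>c\<in>A. is_chart X c) \<and> (\<Union>c\<in>A. fst c) = topspace X \<and>
     (\<forall>c\<in>A. \<forall>c'\<in>A. compatible c c') \<and>
     (\<forall>c. is_chart X c \<and> (\<forall>c'\<in>A. compatible c c') \<longrightarrow> c \<in> A)"

definition smooth_into ::
    "('x, 'N::finite) chart set \<Rightarrow> (real ^ 'n::finite) set \<Rightarrow> (real ^ 'n \<Rightarrow> 'x) \<Rightarrow> bool" where
  "smooth_into A U \<gamma> \<longleftrightarrow>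
     (\<forall>t\<in>U. \<exists>(V, x)\<in>A. \<exists>T. open T \<and> t \<in> T \<and> T \<subseteq> U \<and> \<gamma> ` T \<subseteq> V \<and> smooth_on T (x \<circ> \<gamma>))"

definition immersion_on ::
    "('x, 'N::finite) chart set \<Rightarrow> (real ^ 'n::finite) set \<Rightarrow> (real ^ 'n \<Rightarrow> 'x) \<Rightarrow> bool" where
  "immersion_on A U \<gamma> \<longleftrightarrow> smooth_into A U \<gamma> \<and>
     (\<forall>t\<in>U. \<forall>(V, x)\<in>A. \<gamma> t \<in> V \<longrightarrow> inj (frechet_derivative (x \<circ> \<gamma>) (at t)))"


section \<open>Velocities\<close>

definition partial :: "'n \<Rightarrow> (real ^ 'n::finite \<Rightarrow> real) \<Rightarrow> real ^ 'n \<Rightarrow> real" where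
  "partial j f = (\<lambda>t. frechet_derivative f (at t) (axis j 1))"

definition partials :: "'n list \<Rightarrow> (real ^ 'n::finite \<Rightarrow> real) \<Rightarrow> real ^ 'n \<Rightarrow> real" where
  "partials js f = foldr partial js f"

definition smooth_at_0 :: "('x, 'N::finite) chart set \<Rightarrow> (real ^ 'n::finite \<Rightarrow> 'x) \<Rightarrow> bool" where
  "smooth_at_0 A \<gamma> \<longleftrightarrow> (\<exists>U. open U \<and> 0 \<in> U \<and> smooth_into A U \<gamma>)"

text \<open>Maps defined near \<open>0\<close> are represented by total functions with arbitrary values elsewhere.
  The jet of \<open>\<gamma>\<close> is its class modulo equality of all partial derivatives at \<open>0\<close> up to
  order \<open>r\<close>.\<close>

type_synonym ('x, 'n) velocity = "(real ^ 'n \<Rightarrow> 'x) set"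

definition jet :: "('x, 'N::finite) chart set \<Rightarrow> nat \<Rightarrow> (real ^ 'n::finite \<Rightarrow> 'x) \<Rightarrow> ('x, 'n) velocity" where
  "jet A r \<gamma> = {\<delta>. smooth_at_0 A \<delta> \<and> \<delta> 0 = \<gamma> 0 \<and>
     (\<forall>(V, x)\<in>A. \<gamma> 0 \<in> V \<longrightarrow> (\<forall>k js. length js \<le> r \<longrightarrow>
        partials js (\<lambda>t. x (\<delta> t) $ k) 0 = partials js (\<lambda>t. x (\<gamma> t) $ k) 0))}"

definition Imm :: "('x, 'N::finite) chart set \<Rightarrow> nat \<Rightarrow> ('x, 'n::finite) velocity set" where
  "Imm A r = jet A r ` {\<gamma>. \<exists>U. open U \<and> 0 \<in> U \<and> immersion_on A U \<gamma>}"

definition rep :: "'b set \<Rightarrow> 'b" where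
  "rep c = (SOME b. b \<in> c)"

text \<open>The symmetric lower indices of jet coordinates are multisets, so that the coordinates
  indexed by \<open>jet_index r\<close> are independent. Coordinate tuples are functions that are undefined
  outside the relevant finite index set \<open>I\<close>, which is how \<open>\<real>\<^sup>I\<close> is rendered below. The order of
  differentiation chosen for a multiset does not matter.\<close>

type_synonym ('N, 'n) jet_tuple = "'N \<times> 'n multiset \<Rightarrow> real"

definition jet_index :: "nat \<Rightarrow> ('N \<times> 'n multiset) set" where
  "jet_index r = {(k, J). size J \<le> r}"

definition jet_coords ::
    "nat \<Rightarrow> ('x \<Rightarrow> real ^ 'N::finite) \<Rightarrow> ('x, 'n::finite) velocity \<Rightarrow> ('N, 'n) jet_tuple" where
  "jet_coords r x p = restrict
     (\<lambda>(k, J). partials (SOME js. mset js = J) (\<lambda>t. x (rep p t) $ k) 0) (jet_index r)"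


section \<open>The differential group and its action\<close>

definition local_diffeo_0 :: "(real ^ 'n::finite \<Rightarrow> real ^ 'n) \<Rightarrow> bool" where
  "local_diffeo_0 \<alpha> \<longleftrightarrow> \<alpha> 0 = 0 \<and>
     (\<exists>U. open U \<and> 0 \<in> U \<and> smooth_on U \<alpha> \<and> inj_on \<alpha> U \<and>
          open (\<alpha> ` U) \<and> smooth_on (\<alpha> ` U) (inv_into U \<alpha>))"

definition diffeo_jet :: "nat \<Rightarrow> (real ^ 'n::finite \<Rightarrow> real ^ 'n) \<Rightarrow> (real ^ 'n \<Rightarrow> real ^ 'n) set" where
  "diffeo_jet r \<alpha> = {\<beta>. local_diffeo_0 \<beta> \<and>
     (\<forall>k js. length js \<le> r \<longrightarrow> partials js (\<lambda>t. \<beta> t $ k) 0 = partials js (\<lambda>t. \<alpha> t $ k) 0)}"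

definition diff_group :: "nat \<Rightarrow> (real ^ 'n::finite \<Rightarrow> real ^ 'n) set set" where
  "diff_group r = diffeo_jet r ` {\<alpha>. local_diffeo_0 \<alpha>}"

text \<open>For elements of the domains in question (with \<open>r \<ge> 1\<close> in the case of \<open>jet_det\<close>),
  the following do not depend on the chosen representatives.\<close>

definition jet_act :: "('x, 'N::finite) chart set \<Rightarrow> nat \<Rightarrow> ('x, 'n::finite) velocity \<Rightarrow>
    (real ^ 'n \<Rightarrow> real ^ 'n) set \<Rightarrow> ('x, 'n) velocity" where
  "jet_act A r p a = jet A r (rep p \<circ> rep a)"

definition jet_det :: "(real ^ 'n::finite \<Rightarrow> real ^ 'n) set \<Rightarrow> real" where
  "jet_det a = det (jacobian (rep a) (at 0))"

text \<open>Points of the quotient of \<open>Imm\<close> by the differential group are orbits.\<close>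

definition orbit_proj ::
    "('x, 'N::finite) chart set \<Rightarrow> nat \<Rightarrow> ('x, 'n::finite) velocity \<Rightarrow> ('x, 'n) velocity set" where
  "orbit_proj A r p = jet_act A r p ` diff_group r"


section \<open>Smooth functions in coordinates\<close>

text \<open>Smoothness on an open subset \<open>U\<close> of \<open>\<real>\<^sup>I\<close>, \<open>I\<close> finite: all iterated partial derivatives
  exist and are continuous.\<close>

definition coord_partial :: "'i \<Rightarrow> (('i \<Rightarrow> real) \<Rightarrow> real) \<Rightarrow> ('i \<Rightarrow> real) \<Rightarrow> real" where
  "coord_partial i f = (\<lambda>p. deriv (\<lambda>s. f (p(i := s))) (p i))"

definition coord_smooth_on :: "'i set \<Rightarrow> ('i \<Rightarrow> real) set \<Rightarrow> (('i \<Rightarrow> real) \<Rightarrow> real) \<Rightarrow> bool" where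
  "coord_smooth_on I U f \<longleftrightarrow> (\<forall>is\<in>lists I.
     continuous_on U (foldr coord_partial is f) \<and>
     (\<forall>i\<in>I. \<forall>p\<in>U. (\<lambda>s. foldr coord_partial is f (p(i := s))) differentiable (at (p i))))"

text \<open>Smoothness on the domain \<open>\<Omega>\<close> of coordinates \<open>\<phi>\<close>.\<close>

definition smooth_wrt :: "'i set \<Rightarrow> 'p set \<Rightarrow> ('p \<Rightarrow> 'i \<Rightarrow> real) \<Rightarrow> ('p \<Rightarrow> real) \<Rightarrow> bool" where
  "smooth_wrt I \<Omega> \<phi> f \<longleftrightarrow> coord_smooth_on I (\<phi> ` \<Omega>) (f \<circ> inv_into \<Omega> \<phi>)"

definition smooth_on_Imm ::
    "('x, 'N::finite) chart set \<Rightarrow> nat \<Rightarrow> (('x, 'n::finite) velocity \<Rightarrow> real) \<Rightarrow> bool" where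
  "smooth_on_Imm A r F \<longleftrightarrow>
     (\<forall>(V, x)\<in>A. smooth_wrt (jet_index r) {p \<in> Imm A r. rep p 0 \<in> V} (jet_coords r x) F)"

definition homogeneous ::
    "('x, 'N::finite) chart set \<Rightarrow> nat \<Rightarrow> (('x, 'n::finite) velocity \<Rightarrow> real) \<Rightarrow> bool" where
  "homogeneous A r F \<longleftrightarrow>
     (\<forall>p\<in>Imm A r. \<forall>a\<in>diff_group r. F (jet_act A r p a) = jet_det a * F p)"

definition homogeneous_Lagrangian ::
    "('x, 'N::finite) chart set \<Rightarrow> nat \<Rightarrow> (('x, 'n::finite) velocity \<Rightarrow> real) \<Rightarrow> bool" where
  "homogeneous_Lagrangian A r F \<longleftrightarrow> smooth_on_Imm A r F \<and> homogeneous A r F"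


section \<open>Charts adapted to a splitting of the coordinates\<close>

text \<open>A splitting of the coordinates of a chart into \<open>x\<^sup>i\<close> and \<open>x\<^sup>\<sigma>\<close> is an injection \<open>e\<close> of the
  index type \<open>'n\<close> into \<open>'N\<close>: \<open>x\<^sup>i\<close> is the coordinate with index \<open>e i\<close>, and \<open>\<sigma>\<close> runs through
  the complement of the range of \<open>e\<close>.\<close>

definition base_matrix :: "('n \<Rightarrow> 'N) \<Rightarrow> ('N, 'n::finite) jet_tuple \<Rightarrow> real ^ 'n ^ 'n" where
  "base_matrix e p = (\<chi> i j. p (e i, {#j#}))"

definition W_dom :: "('x, 'N::finite) chart set \<Rightarrow> nat \<Rightarrow> 'x set \<Rightarrow> ('x \<Rightarrow> real ^ 'N) \<Rightarrow> ('n \<Rightarrow> 'N) \<Rightarrow>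
    ('x, 'n::finite) velocity set" where
  "W_dom A r V x e =
     {p \<in> Imm A r. rep p 0 \<in> V \<and> det (base_matrix e (jet_coords r x p)) \<noteq> 0}"

text \<open>The formal derivative of a function of the coordinates of order at most \<open>k\<close>.\<close>

definition formal_deriv ::
    "nat \<Rightarrow> 'n \<Rightarrow> (('N, 'n) jet_tuple \<Rightarrow> real) \<Rightarrow> ('N, 'n) jet_tuple \<Rightarrow> real" where
  "formal_deriv k j f p =
     (\<Sum>(K, J)\<in>jet_index k. coord_partial (K, J) f p * p (K, add_mset j J))"

primrec y_fun ::
    "('n \<Rightarrow> 'N) \<Rightarrow> 'N \<Rightarrow> 'n list \<Rightarrow> ('N, 'n::finite) jet_tuple \<Rightarrow> real" where
  "y_fun e \<sigma> [] = (\<lambda>p. p (\<sigma>, {#}))"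
| "y_fun e \<sigma> (i # is) = (\<lambda>p. \<Sum>j\<in>UNIV.
     matrix_inv (base_matrix e p) $ j $ i * formal_deriv (length is) j (y_fun e \<sigma> is) p)"

text \<open>The coordinates \<open>(x\<^sup>i\<^sub>I, y\<^sup>\<sigma>\<^sub>I)\<close> on \<open>W_dom\<close>. The functions \<open>y\<^sup>\<sigma>\<^sub>I\<close> are symmetric in \<open>I\<close>,
  so the ordering chosen for a multiset does not matter.\<close>

definition W_coords :: "nat \<Rightarrow> ('x \<Rightarrow> real ^ 'N::finite) \<Rightarrow> ('n \<Rightarrow> 'N) \<Rightarrow>
    ('x, 'n::finite) velocity \<Rightarrow> ('N, 'n) jet_tuple" where
  "W_coords r x e p = restrict
     (\<lambda>(K, J). if K \<in> range e then jet_coords r x p (K, J)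
               else y_fun e K (SOME is. mset is = J) (jet_coords r x p)) (jet_index r)"

text \<open>The coordinates \<open>(x\<^sup>i, y\<^sup>\<sigma>\<^sub>I)\<close> on the image of \<open>W_dom\<close> in the quotient; they are constant on
  orbits.\<close>

definition quot_index :: "nat \<Rightarrow> ('n \<Rightarrow> 'N) \<Rightarrow> ('N \<times> 'n multiset) set" where
  "quot_index r e = {(K, J) \<in> jet_index r. K \<in> range e \<longrightarrow> J = {#}}"

definition quot_coords :: "nat \<Rightarrow> ('x \<Rightarrow> real ^ 'N::finite) \<Rightarrow> ('n \<Rightarrow> 'N) \<Rightarrow>
    ('x, 'n::finite) velocity set \<Rightarrow> ('N, 'n) jet_tuple" where
  "quot_coords r x e c = restrict (W_coords r x e (rep c)) (quot_index r e)"

definition smooth_on_quot :: "('x, 'N::finite) chart set \<Rightarrow> nat \<Rightarrow> 'x set \<Rightarrow> ('x \<Rightarrow> real ^ 'N) \<Rightarrow>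
    ('n \<Rightarrow> 'N) \<Rightarrow> (('x, 'n::finite) velocity set \<Rightarrow> real) \<Rightarrow> bool" where
  "smooth_on_quot A r V x e L \<longleftrightarrow>
     smooth_wrt (quot_index r e) (orbit_proj A r ` W_dom A r V x e) (quot_coords r x e) L"

end

theory Submission
  imports Defs
begin

text \<open>Near \<open>0\<close>, a map whose velocity lies in \<open>W_dom\<close> has base components \<open>x\<^sup>i \<circ> \<gamma>\<close> that form, up to a
  translation, a local diffeomorphism \<open>\<alpha>\<close>. So \<open>\<gamma> = \<gamma>' \<circ> \<alpha>\<close>, where \<open>\<gamma>'\<close> is the graph of a map \<open>g\<close>
  over the base coordinates, and \<open>det (x\<^sup>i\<^sub>j)\<close> is the Jacobian determinant of \<open>\<alpha>\<close>. The chain rule gives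
  \<open>y\<^sup>\<sigma>\<^sub>I = \<partial>\<^sub>I g\<^sup>\<sigma>\<close>; hence the coordinates of an orbit are the jet coordinates of the graph, and the graphs
  form a section of the quotient projection, affine in coordinates. A homogeneous Lagrangian is
  therefore \<open>det (x\<^sup>i\<^sub>j)\<close> times the pullback of its restriction to this section. Conversely, some minor
  of the derivative of an immersion does not vanish, so every regular velocity lies in some \<open>W_dom\<close>, where the
  factor \<open>L\<close> is constant on orbits and the determinant is multiplicative.\<close>

subsection \<open>Smooth maps on open sets\<close>

text \<open>Two kinds of derivative have to be reconciled. Maps into \<open>X\<close> are germs with
  Frechet derivatives, while \<open>y_fun\<close> and the smoothness of \<open>L\<close> are built
  from one-variable derivatives of functions of coordinate tuples. For \<open>y_fun\<close> the link
  is a class of rational functions of tuples that obey the chain rule along smooth families of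
  tuples; the invariant coordinates are then only evaluated on jets of maps and never expanded as
  formulas. For \<open>L\<close> the link is that, read in coordinates, it is the Lagrangian
  composed with an embedding that adjoins constants, so its partial derivatives are those of the
  Lagrangian. Velocities, group elements and orbits are sets read off through an arbitrary
  \<open>rep\<close>; each quantity is therefore computed on the jet of an explicitly given map, and
  jets of composites are shown to depend on jets only. The condition \<open>r \<ge> 1\<close> makes
  regularity, the base matrix and \<open>jet_det\<close> properties of the jet.\<close>

lemma frechet_derivative_cong_on:
  assumes "open S" "x \<in> S" "\<And>y. y \<in> S \<Longrightarrow> f y = g y"
  shows "frechet_derivative f (at x) = frechet_derivative g (at x)"
proof -
  have "(f has_derivative D) (at x) \<longleftrightarrow> (g has_derivative D) (at x)" for D
    using has_derivative_transform_within_open assms by metis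
  then show ?thesis by (simp add: frechet_derivative_def)
qed

lemma differentiable_cong_on:
  assumes "open S" "x \<in> S" "\<And>y. y \<in> S \<Longrightarrow> f y = g y"
  shows "f differentiable (at x) \<longleftrightarrow> g differentiable (at x)"
  using has_derivative_transform_within_open assms unfolding differentiable_def by metis

lemma Ck_on_cong:
  assumes "open S" "\<And>x. x \<in> S \<Longrightarrow> f x = g x"
  shows "Ck_on k S f \<longleftrightarrow> Ck_on k S g"
  using assms(2)
proof (induction k arbitrary: f g)
  case 0
  then show ?case by (auto intro: continuous_on_cong)
next
  case (Suc k)
  have "Ck_on k S (\<lambda>x. frechet_derivative f (at x) v) \<longleftrightarrow>
      Ck_on k S (\<lambda>x. frechet_derivative g (at x) v)" for v
  proof (rule Suc.IH)
    fix x assume "x \<in> S"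
    then have "frechet_derivative f (at x) = frechet_derivative g (at x)"
      using frechet_derivative_cong_on[OF assms(1)] Suc.prems by blast
    then show "frechet_derivative f (at x) v = frechet_derivative g (at x) v" by simp
  qed
  moreover have "f differentiable (at x) \<longleftrightarrow> g differentiable (at x)" if "x \<in> S" for x
    using differentiable_cong_on[OF assms(1)] Suc.prems that by blast
  ultimately show ?case by auto
qed

lemma Ck_on_subset: "Ck_on k S f \<Longrightarrow> T \<subseteq> S \<Longrightarrow> Ck_on k T f"
  by (induction k arbitrary: f) (auto intro: continuous_on_subset)

lemma Ck_on_SucD: "Ck_on (Suc k) S f \<Longrightarrow> Ck_on k S f"
proof (induction k arbitrary: f)
  case 0
  then show ?case
    by (auto intro!: continuous_at_imp_continuous_on differentiable_imp_continuous_within)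
next
  case (Suc k)
  then show ?case by (subst Ck_on.simps(2)) (use Suc in auto)
qed

text \<open>Trades the chosen \<open>frechet_derivative\<close> for any explicit formula
  \<open>f'\<close>. The closure rules below exhibit such a formula by the usual differentiation
  rules and are left with order \<open>k\<close>.\<close>

lemma Ck_on_SucI:
  assumes "open S" "\<And>x. x \<in> S \<Longrightarrow> (f has_derivative f' x) (at x)"
    and "\<And>v. Ck_on k S (\<lambda>x. f' x v)"
  shows "Ck_on (Suc k) S f"
proof -
  have "frechet_derivative f (at x) = f' x" if "x \<in> S" for x
    using frechet_derivative_at[OF assms(2)[OF that]] by simp
  then have "Ck_on k S (\<lambda>x. frechet_derivative f (at x) v)" for v
    using Ck_on_cong[OF assms(1), of "\<lambda>x. frechet_derivative f (at x) v" "\<lambda>x. f' x v"] assms(3) by simp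
  then show ?thesis using assms(2) by (auto simp: differentiable_def)
qed

lemma Ck_on_Suc_has_derivative:
  "Ck_on (Suc k) S f \<Longrightarrow> x \<in> S \<Longrightarrow> (f has_derivative frechet_derivative f (at x)) (at x)"
  using frechet_derivative_works by auto

lemma Ck_on_const: "open S \<Longrightarrow> Ck_on k S (\<lambda>x. c)"
proof (induction k arbitrary: c)
  case (Suc k)
  then show ?case
    by (intro Ck_on_SucI[where f' = "\<lambda>x v. 0"]) (auto intro: derivative_eq_intros)
qed simp

lemma Ck_on_bounded_linear:
  assumes "open S" "bounded_linear f"
  shows "Ck_on k S f"
proof (cases k)
  case 0
  then show ?thesis using assms(2) by (simp add: linear_continuous_on)
next
  case (Suc l)
  have "(f has_derivative f) (at x)" for x
    using assms(2) by (rule bounded_linear_imp_has_derivative)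
  then show ?thesis unfolding Suc
    by (intro Ck_on_SucI[where f' = "\<lambda>x. f"] assms Ck_on_const)
qed

lemma Ck_on_add:
  assumes "open S"
  shows "Ck_on k S f \<Longrightarrow> Ck_on k S g \<Longrightarrow> Ck_on k S (\<lambda>x. f x + g x)"
proof (induction k arbitrary: f g)
  case 0
  then show ?case by (simp add: continuous_on_add)
next
  case (Suc k)
  show ?case
  proof (rule Ck_on_SucI[OF assms(1)])
    show "((\<lambda>x. f x + g x) has_derivative
        (\<lambda>v. frechet_derivative f (at x) v + frechet_derivative g (at x) v)) (at x)" if "x \<in> S" for x
      using Suc.prems that by (intro has_derivative_add Ck_on_Suc_has_derivative)
  qed (use Suc in auto)
qed

text \<open>One product rule serves both multiplication and scaling. The factors also occur
  undifferentiated in the derivative, hence the descent by \<open>Ck_on_SucD\<close>.\<close>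

lemma Ck_on_bilinear:
  assumes "open S" and bl: "bounded_bilinear B"
  shows "Ck_on k S f \<Longrightarrow> Ck_on k S g \<Longrightarrow> Ck_on k S (\<lambda>x. B (f x) (g x))"
proof (induction k arbitrary: f g)
  case 0
  then show ?case using bounded_bilinear.continuous_on[OF bl] by simp
next
  case (Suc k)
  show ?case
  proof (rule Ck_on_SucI[OF assms(1)])
    show "((\<lambda>x. B (f x) (g x)) has_derivative
        (\<lambda>v. B (f x) (frechet_derivative g (at x) v) + B (frechet_derivative f (at x) v) (g x))) (at x)"
      if "x \<in> S" for x
      using Suc.prems that
      by (intro bounded_bilinear.FDERIV[OF bl] Ck_on_Suc_has_derivative)
    show "Ck_on k S (\<lambda>x. B (f x) (frechet_derivative g (at x) v) + B (frechet_derivative f (at x) v) (g x))" for v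
      using Suc.prems Suc.IH Ck_on_SucD[OF Suc.prems(1)] Ck_on_SucD[OF Suc.prems(2)]
      by (intro Ck_on_add[OF assms(1)]) simp_all
  qed
qed

lemma Ck_on_sum:
  assumes "open S" "\<And>i. i \<in> I \<Longrightarrow> Ck_on k S (f i)"
  shows "Ck_on k S (\<lambda>x. \<Sum>i\<in>I. f i x)"
  using assms(2)
proof (induction I rule: infinite_finite_induct)
  case (insert i I)
  then show ?case using Ck_on_add[OF assms(1), of k "f i" "\<lambda>x. \<Sum>i\<in>I. f i x"] by simp
qed (simp_all add: Ck_on_const assms(1))

lemma Ck_on_prod:
  fixes f :: "'i \<Rightarrow> 'a::real_normed_vector \<Rightarrow> real"
  assumes "open S" "\<And>i. i \<in> I \<Longrightarrow> Ck_on k S (f i)"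
  shows "Ck_on k S (\<lambda>x. \<Prod>i\<in>I. f i x)"
  using assms(2)
proof (induction I rule: infinite_finite_induct)
  case (insert i I)
  then show ?case
    using Ck_on_bilinear[OF assms(1) bounded_bilinear_mult, of k "f i" "\<lambda>x. \<Prod>i\<in>I. f i x"] by simp
qed (simp_all add: Ck_on_const assms(1))

lemma Ck_on_linear_compose:
  assumes "open S" "bounded_linear h"
  shows "Ck_on k S f \<Longrightarrow> Ck_on k S (\<lambda>x. h (f x))"
proof (induction k arbitrary: f)
  case 0
  then show ?case using bounded_linear.continuous_on[OF assms(2)] by simp
next
  case (Suc k)
  show ?case
  proof (rule Ck_on_SucI[OF assms(1)])
    show "((\<lambda>x. h (f x)) has_derivative (\<lambda>v. h (frechet_derivative f (at x) v))) (at x)" if "x \<in> S" for x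
      using Suc.prems that by (intro bounded_linear.has_derivative[OF assms(2)] Ck_on_Suc_has_derivative)
  qed (use Suc in auto)
qed

text \<open>The chain rule differentiates \<open>g\<close> in the direction
  \<open>frechet_derivative f (at x) v\<close>, which moves with \<open>x\<close>, whereas
  \<open>Ck_on\<close> controls fixed directions. Expanding that direction in \<open>Basis\<close>
  leaves products to which the induction hypothesis applies.\<close>

lemma Ck_on_compose:
  fixes g :: "'b::euclidean_space \<Rightarrow> 'c::real_normed_vector"
  assumes "open S" "open T" "f ` S \<subseteq> T"
  shows "Ck_on k S f \<Longrightarrow> Ck_on k T g \<Longrightarrow> Ck_on k S (\<lambda>x. g (f x))"
proof (induction k arbitrary: g)
  case 0
  then show ?case using assms(3) continuous_on_compose2 by auto
next
  case (Suc k)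
  have f: "(f has_derivative frechet_derivative f (at x)) (at x)" if "x \<in> S" for x
    using Suc.prems(1) that by (rule Ck_on_Suc_has_derivative)
  have g: "(g has_derivative frechet_derivative g (at (f x))) (at (f x))" if "x \<in> S" for x
    using Suc.prems(2) that assms(3) by (intro Ck_on_Suc_has_derivative) auto
  show ?case
  proof (rule Ck_on_SucI[OF assms(1)])
    fix x assume x: "x \<in> S"
    have lin: "linear (frechet_derivative g (at (f x)))"
      using g[OF x] has_derivative_linear by blast
    have eq: "frechet_derivative g (at (f x)) w = (\<Sum>b\<in>Basis. (w \<bullet> b) *\<^sub>R frechet_derivative g (at (f x)) b)" for w
      using linear_sum[OF lin, of "\<lambda>b. (w \<bullet> b) *\<^sub>R b" Basis] linear_scale[OF lin]
      by (simp add: euclidean_representation)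
    show "((\<lambda>x. g (f x)) has_derivative (\<lambda>v. \<Sum>b\<in>Basis. (frechet_derivative f (at x) v \<bullet> b) *\<^sub>R frechet_derivative g (at (f x)) b)) (at x)"
      using has_derivative_compose[OF f[OF x] g[OF x]] by (subst eq[symmetric]) (simp add: o_def)
  next
    fix v
    have "Ck_on k S (\<lambda>x. frechet_derivative g (at (f x)) b)" for b
      using Suc.IH[of "\<lambda>y. frechet_derivative g (at y) b"] Suc.prems Ck_on_SucD by auto
    moreover have "Ck_on k S (\<lambda>x. frechet_derivative f (at x) v \<bullet> b)" for b
      using Suc.prems(1) by (intro Ck_on_linear_compose[OF assms(1) bounded_linear_inner_left]) auto
    ultimately show "Ck_on k S (\<lambda>x. \<Sum>b\<in>Basis. (frechet_derivative f (at x) v \<bullet> b) *\<^sub>R frechet_derivative g (at (f x)) b)"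
      by (intro Ck_on_sum assms(1) Ck_on_bilinear[OF assms(1) bounded_bilinear_scaleR])
  qed
qed

text \<open>The derivative is a product of the reciprocal itself and the derivative of
  \<open>f\<close>, so the induction runs over \<open>k\<close> with \<open>f\<close> fixed.\<close>

lemma Ck_on_inverse:
  fixes f :: "'a::real_normed_vector \<Rightarrow> real"
  assumes "open S" "\<And>x. x \<in> S \<Longrightarrow> f x \<noteq> 0"
  shows "Ck_on k S f \<Longrightarrow> Ck_on k S (\<lambda>x. inverse (f x))"
proof (induction k)
  case 0
  then show ?case using assms(2) by (auto intro: continuous_on_inverse)
next
  case (Suc k)
  have inv: "Ck_on k S (\<lambda>x. inverse (f x))" using Suc Ck_on_SucD by blast
  show ?case
  proof (rule Ck_on_SucI[OF assms(1)])
    show "((\<lambda>x. inverse (f x)) has_derivative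
       (\<lambda>v. - (inverse (f x) * frechet_derivative f (at x) v * inverse (f x)))) (at x)" if "x \<in> S" for x
      using Deriv.has_derivative_inverse[OF assms(2)[OF that] Ck_on_Suc_has_derivative[OF Suc.prems that]] by simp
    show "Ck_on k S (\<lambda>x. - (inverse (f x) * frechet_derivative f (at x) v * inverse (f x)))" for v
      using Suc.prems inv
      by (intro Ck_on_linear_compose[OF assms(1) bounded_linear_minus[OF bounded_linear_ident]]
          Ck_on_bilinear[OF assms(1) bounded_bilinear_mult]) auto
  qed
qed

lemma Ck_on_vec:
  fixes f :: "'a::real_normed_vector \<Rightarrow> real ^ 'm::finite"
  assumes "open S" "\<And>i. Ck_on k S (\<lambda>x. f x $ i)"
  shows "Ck_on k S f"
proof -
  have "f x = (\<Sum>i\<in>UNIV. f x $ i *\<^sub>R axis i 1)" for x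
    using basis_expansion[of "f x"] unfolding scalar_mult_eq_scaleR by (rule sym)
  then have eq: "f = (\<lambda>x. \<Sum>i\<in>UNIV. f x $ i *\<^sub>R axis i 1)" by (rule ext)
  show ?thesis
    by (subst eq) (intro Ck_on_sum Ck_on_bilinear[OF _ bounded_bilinear_scaleR] assms Ck_on_const)
qed

lemma Ck_on_det:
  fixes M :: "'a::real_normed_vector \<Rightarrow> real ^ 'm ^ 'm::finite"
  assumes "open S" "\<And>i j. Ck_on k S (\<lambda>x. M x $ i $ j)"
  shows "Ck_on k S (\<lambda>x. det (M x))"
  unfolding det_def
  by (intro Ck_on_sum Ck_on_prod Ck_on_bilinear[OF _ bounded_bilinear_mult] Ck_on_const assms)

lemma matrix_inv_mult:
  fixes M :: "real ^ 'm ^ 'm::finite"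
  assumes "det M \<noteq> 0"
  shows "M ** matrix_inv M = mat 1" "matrix_inv M ** M = mat 1"
proof -
  have "\<exists>B. M ** B = mat 1 \<and> B ** M = mat 1"
    using assms invertible_det_nz[of M] unfolding invertible_def by blast
  then have "M ** matrix_inv M = mat 1 \<and> matrix_inv M ** M = mat 1"
    unfolding matrix_inv_def by (rule someI_ex)
  then show "M ** matrix_inv M = mat 1" "matrix_inv M ** M = mat 1" by auto
qed

text \<open>Cramer's rule, with column \<open>i\<close> of \<open>M\<close> replaced by the
  \<open>j\<close>-th unit vector. It makes the entries of the inverse polynomials in the entries of
  \<open>M\<close> times \<open>inverse (det M)\<close>; both their smoothness and their rationality
  in the jet coordinates come from this.\<close>

lemma matrix_inv_cramer:
  fixes M :: "real ^ 'm ^ 'm::finite"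
  assumes "det M \<noteq> 0"
  shows "matrix_inv M $ i $ j =
    det (\<chi> k l. if l = i then axis j 1 $ k else M $ k $ l) * inverse (det M)"
proof -
  have "M *v (matrix_inv M *v axis j 1) = axis j 1"
    using assms by (simp add: matrix_vector_mul_assoc matrix_inv_mult)
  then have "matrix_inv M *v axis j 1 =
      (\<chi> k. det (\<chi> i l. if l = k then axis j 1 $ i else M $ i $ l) / det M)"
    using cramer[OF assms] by blast
  moreover have "(matrix_inv M *v axis j 1) $ i = matrix_inv M $ i $ j"
    by (metis column_def matrix_vector_mul_component matrix_vector_mult_basis vec_lambda_beta)
  ultimately show ?thesis by (simp add: divide_inverse)
qed

lemma Ck_on_matrix_inv:
  fixes M :: "'a::real_normed_vector \<Rightarrow> real ^ 'm ^ 'm::finite"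
  assumes "open S" "\<And>i j. Ck_on k S (\<lambda>x. M x $ i $ j)" "\<And>x. x \<in> S \<Longrightarrow> det (M x) \<noteq> 0"
  shows "Ck_on k S (\<lambda>x. matrix_inv (M x) $ i $ j)"
proof -
  have "Ck_on k S (\<lambda>x. if b then (c::real) else M x $ i $ j)" for b c i j
    using assms by (cases b) (auto intro: Ck_on_const)
  then have "Ck_on k S (\<lambda>x. det (\<chi> k l. if l = i then axis j 1 $ k else M x $ k $ l) * inverse (det (M x)))"
    by (intro Ck_on_bilinear[OF _ bounded_bilinear_mult] Ck_on_inverse Ck_on_det assms) simp_all
  then show ?thesis
    by (rule iffD1[OF Ck_on_cong[OF assms(1)], rotated]) (simp add: matrix_inv_cramer assms(3))
qed

section \<open>Germs of smooth maps\<close>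

text \<open>Smoothness is asked on a neighbourhood and thus holds at all nearby points as well.
  Identities of derivatives proved from it pointwise are therefore valid near \<open>t\<close> and
  can be differentiated again.\<close>

definition smooth_at :: "'a::real_normed_vector \<Rightarrow> ('a \<Rightarrow> 'b::real_normed_vector) \<Rightarrow> bool" where
  "smooth_at t f \<longleftrightarrow> (\<exists>U. open U \<and> t \<in> U \<and> smooth_on U f)"

lemma smooth_on_imp_smooth_at: "smooth_on U f \<Longrightarrow> open U \<Longrightarrow> t \<in> U \<Longrightarrow> smooth_at t f"
  unfolding smooth_at_def by blast

lemma smooth_on_subset: "smooth_on S f \<Longrightarrow> T \<subseteq> S \<Longrightarrow> smooth_on T f"
  unfolding smooth_on_def using Ck_on_subset by blast

lemma smooth_on_cong:
  "open S \<Longrightarrow> (\<And>x. x \<in> S \<Longrightarrow> f x = g x) \<Longrightarrow> smooth_on S f \<longleftrightarrow> smooth_on S g"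
  unfolding smooth_on_def using Ck_on_cong by blast

text \<open>\<open>frechet_derivative f (at x)\<close> does not refer to the neighbourhood, so the
  local hypotheses pass to the derivatives and the induction can proceed.\<close>

lemma Ck_on_local:
  assumes "\<And>t. t \<in> S \<Longrightarrow> \<exists>U. open U \<and> t \<in> U \<and> Ck_on k U f"
  shows "Ck_on k S f"
  using assms
proof (induction k arbitrary: f)
  case 0
  then have "\<forall>t\<in>S. \<exists>U. open U \<and> t \<in> U \<and> continuous_on U f" by simp
  then show ?case
    by (auto intro!: continuous_at_imp_continuous_on simp: continuous_on_eq_continuous_at)
next
  case (Suc k)
  show ?case
  proof (subst Ck_on.simps(2), intro conjI allI ballI)
    show "f differentiable (at x)" if "x \<in> S" for x
      using Suc.prems[OF that] by auto
    show "Ck_on k S (\<lambda>x. frechet_derivative f (at x) v)" for v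
      using Suc.prems by (intro Suc.IH) force
  qed
qed

lemma smooth_on_if_smooth_at:
  assumes "\<And>t. t \<in> S \<Longrightarrow> smooth_at t f"
  shows "smooth_on S f"
  unfolding smooth_on_def
proof
  fix k
  show "Ck_on k S f"
  proof (rule Ck_on_local)
    fix t assume "t \<in> S"
    then obtain U where "open U" "t \<in> U" "\<forall>k. Ck_on k U f"
      using assms unfolding smooth_at_def smooth_on_def by blast
    then show "\<exists>U. open U \<and> t \<in> U \<and> Ck_on k U f" by blast
  qed
qed

lemma eventually_smooth_at: "smooth_at t f \<Longrightarrow> \<forall>\<^sub>F s in nhds t. smooth_at s f"
  unfolding smooth_at_def eventually_nhds by blast

lemma smooth_at_cong_ev:
  assumes "smooth_at t f" "\<forall>\<^sub>F s in nhds t. f s = g s"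
  shows "smooth_at t g"
proof -
  obtain U V where U: "open U" "t \<in> U" "smooth_on U f" and V: "open V" "t \<in> V" "\<And>s. s \<in> V \<Longrightarrow> f s = g s"
    using assms unfolding smooth_at_def eventually_nhds by blast
  then have "smooth_on (U \<inter> V) g"
    using smooth_on_cong[of "U \<inter> V" f g] smooth_on_subset by blast
  then show ?thesis using U V smooth_at_def by blast
qed

lemma smooth_at_2:
  assumes "smooth_at t f" "smooth_at t g"
  obtains U where "open U" "t \<in> U" "smooth_on U f" "smooth_on U g"
proof -
  obtain V W where "open V" "t \<in> V" "smooth_on V f" "open W" "t \<in> W" "smooth_on W g"
    using assms unfolding smooth_at_def by blast
  then show ?thesis
    by (intro that[of "V \<inter> W"]) (auto elim: smooth_on_subset)
qed

lemma smooth_at_differentiable: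
  assumes "smooth_at t f"
  shows "f differentiable (at t)"
proof -
  obtain U where "t \<in> U" "\<And>k. Ck_on k U f"
    using assms unfolding smooth_at_def smooth_on_def by blast
  then show ?thesis using Ck_on.simps(2)[of 0 U f] by blast
qed

lemma smooth_at_continuous: "smooth_at t f \<Longrightarrow> isCont f t"
  using smooth_at_differentiable differentiable_imp_continuous_within by blast

lemma smooth_on_derivative: "smooth_on S f \<Longrightarrow> smooth_on S (\<lambda>s. frechet_derivative f (at s) v)"
  unfolding smooth_on_def using Ck_on.simps(2)[of _ S f] by blast

lemma smooth_at_derivative: "smooth_at t f \<Longrightarrow> smooth_at t (\<lambda>s. frechet_derivative f (at s) v)"
  unfolding smooth_at_def using smooth_on_derivative by blast

lemma smooth_at_const: "smooth_at t (\<lambda>x. c)"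
  unfolding smooth_at_def smooth_on_def using Ck_on_const open_UNIV by blast

lemma smooth_at_bounded_linear: "bounded_linear f \<Longrightarrow> smooth_at t f"
  unfolding smooth_at_def smooth_on_def using Ck_on_bounded_linear open_UNIV by blast

lemma smooth_at_ident: "smooth_at t (\<lambda>x. x)"
  by (rule smooth_at_bounded_linear[OF bounded_linear_ident])

lemma smooth_at_add: "smooth_at t f \<Longrightarrow> smooth_at t g \<Longrightarrow> smooth_at t (\<lambda>x. f x + g x)"
  by (erule (1) smooth_at_2) (auto simp: smooth_at_def smooth_on_def intro: Ck_on_add)

lemma smooth_at_bilinear:
  "bounded_bilinear B \<Longrightarrow> smooth_at t f \<Longrightarrow> smooth_at t g \<Longrightarrow> smooth_at t (\<lambda>x. B (f x) (g x))"
  by (erule (1) smooth_at_2) (auto simp: smooth_at_def smooth_on_def intro: Ck_on_bilinear)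

lemma smooth_at_mult:
  fixes f g :: "'a::real_normed_vector \<Rightarrow> real"
  shows "smooth_at t f \<Longrightarrow> smooth_at t g \<Longrightarrow> smooth_at t (\<lambda>x. f x * g x)"
  by (rule smooth_at_bilinear[OF bounded_bilinear_mult])

lemma smooth_at_linear_compose:
  "bounded_linear h \<Longrightarrow> smooth_at t f \<Longrightarrow> smooth_at t (\<lambda>x. h (f x))"
  unfolding smooth_at_def smooth_on_def using Ck_on_linear_compose[of _ h _ f] by blast

lemma smooth_at_diff: "smooth_at t f \<Longrightarrow> smooth_at t g \<Longrightarrow> smooth_at t (\<lambda>x. f x - g x)"
  using smooth_at_add[of t f "\<lambda>x. - g x"]
    smooth_at_linear_compose[OF bounded_linear_minus[OF bounded_linear_ident], of t g] by simp

lemma smooth_at_sum: "(\<And>i. i \<in> I \<Longrightarrow> smooth_at t (f i)) \<Longrightarrow> smooth_at t (\<lambda>x. \<Sum>i\<in>I. f i x)"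
  by (induction I rule: infinite_finite_induct) (auto intro: smooth_at_const smooth_at_add)

lemma smooth_at_prod:
  fixes f :: "'i \<Rightarrow> 'a::real_normed_vector \<Rightarrow> real"
  shows "(\<And>i. i \<in> I \<Longrightarrow> smooth_at t (f i)) \<Longrightarrow> smooth_at t (\<lambda>x. \<Prod>i\<in>I. f i x)"
  by (induction I rule: infinite_finite_induct) (auto intro: smooth_at_const smooth_at_mult)

lemma smooth_at_compose:
  fixes g :: "'b::euclidean_space \<Rightarrow> 'c::real_normed_vector"
  assumes "smooth_at t f" "smooth_at (f t) g"
  shows "smooth_at t (\<lambda>s. g (f s))"
proof -
  obtain U V where U: "open U" "t \<in> U" "smooth_on U f" and V: "open V" "f t \<in> V" "smooth_on V g"
    using assms unfolding smooth_at_def by blast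
  have "continuous_on U f" using U(3) Ck_on.simps(1) unfolding smooth_on_def by blast
  then have op: "open (f -` V \<inter> U)" using U V continuous_on_open_vimage by blast
  have "Ck_on k (f -` V \<inter> U) (\<lambda>s. g (f s))" for k
    using Ck_on_compose[OF op V(1), of f k g] Ck_on_subset[of k U f "f -` V \<inter> U"] U(3) V(3)
    by (auto simp: smooth_on_def)
  then have "smooth_on (f -` V \<inter> U) (\<lambda>s. g (f s))"
    by (simp add: smooth_on_def)
  then show ?thesis using op U(2) V(2) smooth_at_def by blast
qed

lemma smooth_at_component:
  fixes f :: "'a::real_normed_vector \<Rightarrow> real ^ 'm::finite"
  shows "smooth_at t f \<Longrightarrow> smooth_at t (\<lambda>x. f x $ i)"
  by (rule smooth_at_linear_compose[OF bounded_linear_vec_nth])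

lemma smooth_at_vec:
  fixes f :: "'a::real_normed_vector \<Rightarrow> real ^ 'm::finite"
  assumes "\<And>i. smooth_at t (\<lambda>x. f x $ i)"
  shows "smooth_at t f"
proof -
  have "f x = (\<Sum>i\<in>UNIV. f x $ i *\<^sub>R axis i 1)" for x
    using basis_expansion[of "f x"] unfolding scalar_mult_eq_scaleR by (rule sym)
  then have eq: "f = (\<lambda>x. \<Sum>i\<in>UNIV. f x $ i *\<^sub>R axis i 1)" by (rule ext)
  show ?thesis
    by (subst eq) (intro smooth_at_sum smooth_at_bilinear[OF bounded_bilinear_scaleR] assms smooth_at_const)
qed

subsection \<open>Partial derivatives and the inverse function theorem\<close>

lemma smooth_at_partial: "smooth_at t f \<Longrightarrow> smooth_at t (partial j f)"
  unfolding partial_def by (rule smooth_at_derivative)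

lemma smooth_at_partials: "smooth_at t f \<Longrightarrow> smooth_at t (partials js f)"
  by (induction js) (auto simp: partials_def intro: smooth_at_partial)

lemma partials_simps [simp]:
  "partials [] f = f"
  "partials (j # js) f = partial j (partials js f)"
  "partials (js @ [j]) f = partials js (partial j f)"
  by (simp_all add: partials_def)

lemma frechet_derivative_cong_ev:
  assumes "\<forall>\<^sub>F s in nhds t. f s = g s"
  shows "frechet_derivative f (at t) = frechet_derivative g (at t)"
  using assms frechet_derivative_cong_on unfolding eventually_nhds by metis

lemma partial_cong_ev: "\<forall>\<^sub>F s in nhds t. f s = g s \<Longrightarrow> partial j f t = partial j g t"
  unfolding partial_def using frechet_derivative_cong_ev by metis

text \<open>Equality at \<open>t\<close> alone would not survive another differentiation; the
  conclusion near \<open>t\<close>, together with \<open>eventually_eventually\<close>, carries the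
  induction.\<close>

lemma eventually_partials_cong:
  "\<forall>\<^sub>F s in nhds t. f s = g s \<Longrightarrow> \<forall>\<^sub>F s in nhds t. partials js f s = partials js g s"
proof (induction js)
  case (Cons j js)
  then have "\<forall>\<^sub>F s in nhds t. \<forall>\<^sub>F u in nhds s. partials js f u = partials js g u"
    by (simp add: eventually_eventually)
  then show ?case
    by (rule eventually_mono) (simp add: partial_cong_ev)
qed simp

lemma partials_cong_ev: "\<forall>\<^sub>F s in nhds t. f s = g s \<Longrightarrow> partials js f t = partials js g t"
  using eventually_partials_cong eventually_nhds_x_imp_x by fastforce

lemma smooth_at_has_derivative:
  "smooth_at t f \<Longrightarrow> (f has_derivative frechet_derivative f (at t)) (at t)"
  using smooth_at_differentiable frechet_derivative_works by blast

lemma partial_eqI: "(f has_derivative D) (at t) \<Longrightarrow> partial j f t = D (axis j 1)"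
  unfolding partial_def using frechet_derivative_at by metis

lemma frechet_derivative_eq_sum:
  fixes f :: "real ^ 'n::finite \<Rightarrow> 'b::real_normed_vector"
  assumes "smooth_at t f"
  shows "frechet_derivative f (at t) v = (\<Sum>j\<in>UNIV. v $ j *\<^sub>R frechet_derivative f (at t) (axis j 1))"
proof -
  have lin: "linear (frechet_derivative f (at t))"
    using assms linear_frechet_derivative smooth_at_differentiable by blast
  have "v = (\<Sum>j\<in>UNIV. v $ j *\<^sub>R axis j 1)"
    using basis_expansion[of v] unfolding scalar_mult_eq_scaleR by (rule sym)
  then have "frechet_derivative f (at t) v = frechet_derivative f (at t) (\<Sum>j\<in>UNIV. v $ j *\<^sub>R axis j 1)"
    by (rule arg_cong)
  then show ?thesis
    using linear_sum[OF lin, of "\<lambda>j. v $ j *\<^sub>R axis j 1" UNIV] linear_scale[OF lin] by simp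
qed

lemma frechet_derivative_component:
  fixes f :: "real ^ 'n::finite \<Rightarrow> real ^ 'm::finite"
  assumes "smooth_at t f"
  shows "frechet_derivative f (at t) v $ i = frechet_derivative (\<lambda>s. f s $ i) (at t) v"
  using frechet_derivative_at[OF bounded_linear.has_derivative
      [OF bounded_linear_vec_nth smooth_at_has_derivative[OF assms]], of i] by metis

lemma jacobian_component:
  fixes f :: "real ^ 'n::finite \<Rightarrow> real ^ 'm::finite"
  assumes "smooth_at t f"
  shows "jacobian f (at t) $ i $ j = partial j (\<lambda>s. f s $ i) t"
  by (simp add: jacobian_def matrix_def partial_def frechet_derivative_component[OF assms])

lemma partial_const [simp]: "partial j (\<lambda>x. c) = (\<lambda>x. 0)"
  by (simp add: partial_def)

lemma partial_add:
  assumes "smooth_at t f" "smooth_at t g"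
  shows "partial j (\<lambda>s. f s + g s) t = partial j f t + partial j g t"
  using partial_eqI[OF has_derivative_add[OF assms[THEN smooth_at_has_derivative]]]
  by (simp add: partial_def)

lemma partial_mult:
  assumes "smooth_at t f" "smooth_at t g"
  shows "partial j (\<lambda>s. f s * g s) t = f t * partial j g t + partial j f t * g t"
  using partial_eqI[OF has_derivative_mult[OF assms[THEN smooth_at_has_derivative]]]
  by (simp add: partial_def)

lemma partial_compose:
  fixes f :: "real ^ 'n::finite \<Rightarrow> real ^ 'm::finite"
  assumes f: "smooth_at t f" and g: "smooth_at (f t) g"
  shows "partial j (\<lambda>s. g (f s)) t = (\<Sum>k\<in>UNIV. partial k g (f t) * partial j (\<lambda>s. f s $ k) t)"
  using partial_eqI[OF has_derivative_compose[OF smooth_at_has_derivative[OF f] smooth_at_has_derivative[OF g]], of j]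
  by (simp add: frechet_derivative_eq_sum[OF g, of "frechet_derivative f (at t) _"]
      frechet_derivative_component[OF f] partial_def mult.commute)

section \<open>Symmetry of mixed partial derivatives\<close>

text \<open>On a line parallel to an axis a partial derivative becomes a one-variable derivative, to
  which the mean value theorem and the uniqueness of derivatives apply.\<close>

lemma has_real_derivative_along_axis:
  assumes "smooth_at (p + u *\<^sub>R axis i 1) f"
  shows "((\<lambda>u. f (p + u *\<^sub>R axis i 1)) has_real_derivative partial i f (p + u *\<^sub>R axis i 1)) (at u)"
proof -
  have lin: "linear (frechet_derivative f (at (p + u *\<^sub>R axis i 1)))"
    using assms linear_frechet_derivative smooth_at_differentiable by blast
  have "((\<lambda>u. p + u *\<^sub>R axis i 1) has_derivative (\<lambda>s. s *\<^sub>R axis i 1)) (at u)"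
    by (auto intro!: derivative_eq_intros)
  from has_derivative_compose[OF this smooth_at_has_derivative[OF assms]]
  show ?thesis
    unfolding has_field_derivative_def partial_def
    by (simp add: linear_scale[OF lin] mult.commute[of _ "frechet_derivative f _ _"])
qed

text \<open>The second difference quotient is symmetric in the two directions; the mean value theorem,
  applied in one direction and then in the other, evaluates it as a mixed second derivative.\<close>

lemma second_difference_mean_value:
  fixes f :: "real ^ 'n::finite \<Rightarrow> real"
  assumes "0 < s" and sm: "\<And>x y. 0 \<le> x \<Longrightarrow> x \<le> s \<Longrightarrow> 0 \<le> y \<Longrightarrow> y \<le> s \<Longrightarrow>
      smooth_at (t + x *\<^sub>R axis i 1 + y *\<^sub>R axis j 1) f"
  shows "\<exists>x y. 0 < x \<and> x < s \<and> 0 < y \<and> y < s \<and>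
    f (t + s *\<^sub>R axis i 1 + s *\<^sub>R axis j 1) - f (t + s *\<^sub>R axis i 1) - f (t + s *\<^sub>R axis j 1) + f t =
    s * s * partial j (partial i f) (t + x *\<^sub>R axis i 1 + y *\<^sub>R axis j 1)"
proof -
  let ?a = "axis i 1 :: real ^ 'n" and ?b = "axis j 1 :: real ^ 'n"
  \<comment> \<open>The increment in direction \<open>j\<close> as a function of the displacement in
    direction \<open>i\<close>; then \<open>g s - g 0\<close> is the second difference.\<close>
  define g where "g = (\<lambda>u. f (t + u *\<^sub>R ?a + s *\<^sub>R ?b) - f (t + u *\<^sub>R ?a))"
  have "(g has_real_derivative partial i f (t + u *\<^sub>R ?a + s *\<^sub>R ?b) - partial i f (t + u *\<^sub>R ?a)) (at u)"
    if "0 \<le> u" "u \<le> s" for u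
  proof -
    have "((\<lambda>u. f (t + s *\<^sub>R ?b + u *\<^sub>R ?a) - f (t + u *\<^sub>R ?a)) has_real_derivative
        partial i f (t + s *\<^sub>R ?b + u *\<^sub>R ?a) - partial i f (t + u *\<^sub>R ?a)) (at u)"
      using sm[of u s] sm[of u 0] that \<open>0 < s\<close>
      by (intro DERIV_diff has_real_derivative_along_axis) (auto simp: add_ac)
    then show ?thesis by (simp add: g_def add_ac)
  qed
  then obtain x where x: "0 < x" "x < s"
    and gx: "g s - g 0 = (s - 0) * (partial i f (t + x *\<^sub>R ?a + s *\<^sub>R ?b) - partial i f (t + x *\<^sub>R ?a))"
    using MVT2[OF \<open>0 < s\<close>, of g "\<lambda>u. partial i f (t + u *\<^sub>R ?a + s *\<^sub>R ?b) - partial i f (t + u *\<^sub>R ?a)"] by blast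
  have "((\<lambda>y. partial i f (t + x *\<^sub>R ?a + y *\<^sub>R ?b)) has_real_derivative
      partial j (partial i f) (t + x *\<^sub>R ?a + y *\<^sub>R ?b)) (at y)" if "0 \<le> y" "y \<le> s" for y
    using sm[of x y] that x by (intro has_real_derivative_along_axis smooth_at_partial) auto
  then obtain y where y: "0 < y" "y < s"
    and gy: "partial i f (t + x *\<^sub>R ?a + s *\<^sub>R ?b) - partial i f (t + x *\<^sub>R ?a + 0 *\<^sub>R ?b) =
      (s - 0) * partial j (partial i f) (t + x *\<^sub>R ?a + y *\<^sub>R ?b)"
    using MVT2[OF \<open>0 < s\<close>, of "\<lambda>y. partial i f (t + x *\<^sub>R ?a + y *\<^sub>R ?b)"
        "\<lambda>y. partial j (partial i f) (t + x *\<^sub>R ?a + y *\<^sub>R ?b)"] by blast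
  show ?thesis
    using x y gx gy by (intro exI[of _ x] exI[of _ y]) (simp add: g_def algebra_simps)
qed

text \<open>Both orders of differentiation compute the same second difference, at two points of a
  small square. If they differed at \<open>t\<close>, continuity would keep each within half the gap
  of its value at \<open>t\<close>, and the two could not coincide.\<close>

lemma partial_commute:
  fixes f :: "real ^ 'n::finite \<Rightarrow> real"
  assumes "smooth_at t f"
  shows "partial i (partial j f) t = partial j (partial i f) t"
proof (rule ccontr)
  let ?a = "axis i 1 :: real ^ 'n" and ?b = "axis j 1 :: real ^ 'n"
  let ?P = "partial i (partial j f)" and ?Q = "partial j (partial i f)"
  assume "?P t \<noteq> ?Q t"
  then have e: "0 < \<bar>?P t - ?Q t\<bar> / 2" (is "0 < ?e") by simp
  have "isCont ?P t" "isCont ?Q t"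
    using assms by (auto intro!: smooth_at_continuous smooth_at_partial)
  then have "(?P \<longlongrightarrow> ?P t) (nhds t)" "(?Q \<longlongrightarrow> ?Q t) (nhds t)"
    by (simp_all add: isCont_def tendsto_at_iff_tendsto_nhds)
  then have "\<forall>\<^sub>F s in nhds t. dist (?P s) (?P t) < ?e" "\<forall>\<^sub>F s in nhds t. dist (?Q s) (?Q t) < ?e"
    using tendstoD[OF _ e] by blast+
  with eventually_smooth_at[OF assms]
  have "\<forall>\<^sub>F s in nhds t. smooth_at s f \<and> dist (?P s) (?P t) < ?e \<and> dist (?Q s) (?Q t) < ?e"
    by eventually_elim simp
  then obtain d where d: "d > 0" and
    D: "\<And>s. dist s t < d \<Longrightarrow> smooth_at s f \<and> dist (?P s) (?P t) < ?e \<and> dist (?Q s) (?Q t) < ?e"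
    unfolding eventually_nhds_metric by blast
  \<comment> \<open>Points of the square with side \<open>s\<close> have distance at most
    \<open>2 * s < d\<close> from \<open>t\<close>.\<close>
  define s where "s = d / 3"
  have s: "0 < s" using d s_def by simp
  have near: "dist (t + x *\<^sub>R ?a + y *\<^sub>R ?b) t < d" "dist (t + y *\<^sub>R ?b + x *\<^sub>R ?a) t < d"
    if "0 \<le> x" "x \<le> s" "0 \<le> y" "y \<le> s" for x y
  proof -
    have "norm (x *\<^sub>R ?a + y *\<^sub>R ?b) \<le> x + y"
      using norm_triangle_ineq[of "x *\<^sub>R ?a" "y *\<^sub>R ?b"] that by simp
    also have "\<dots> < d" using that d s_def by linarith
    finally show "dist (t + x *\<^sub>R ?a + y *\<^sub>R ?b) t < d" by (simp add: dist_norm add.assoc)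
    then show "dist (t + y *\<^sub>R ?b + x *\<^sub>R ?a) t < d" by (simp add: add_ac)
  qed
  obtain x y where xy: "0 < x" "x < s" "0 < y" "y < s" and
    1: "f (t + s *\<^sub>R ?a + s *\<^sub>R ?b) - f (t + s *\<^sub>R ?a) - f (t + s *\<^sub>R ?b) + f t =
    s * s * ?Q (t + x *\<^sub>R ?a + y *\<^sub>R ?b)"
    using second_difference_mean_value[OF s, of t i j f] near D by blast
  obtain x' y' where xy': "0 < x'" "x' < s" "0 < y'" "y' < s" and
    2: "f (t + s *\<^sub>R ?b + s *\<^sub>R ?a) - f (t + s *\<^sub>R ?b) - f (t + s *\<^sub>R ?a) + f t =
    s * s * ?P (t + x' *\<^sub>R ?b + y' *\<^sub>R ?a)"
    using second_difference_mean_value[OF s, of t j i f] near D by blast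
  have "s * s * ?Q (t + x *\<^sub>R ?a + y *\<^sub>R ?b) = s * s * ?P (t + x' *\<^sub>R ?b + y' *\<^sub>R ?a)"
    using 1 2[unfolded add.commute[of "t + s *\<^sub>R ?b"] add.assoc[symmetric] add.commute[of "s *\<^sub>R ?a" t]]
    by linarith
  then have "?Q (t + x *\<^sub>R ?a + y *\<^sub>R ?b) = ?P (t + x' *\<^sub>R ?b + y' *\<^sub>R ?a)" using s by simp
  moreover have "dist (?Q (t + x *\<^sub>R ?a + y *\<^sub>R ?b)) (?Q t) < ?e"
    using D[OF near(1)[of x y]] xy by simp
  moreover have "dist (?P (t + x' *\<^sub>R ?b + y' *\<^sub>R ?a)) (?P t) < ?e"
    using D[OF near(2)[of y' x']] xy' by simp
  ultimately have "dist (?P t) (?Q t) < ?e + ?e"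
    by (intro dist_triangle_less_add[of _ "?P (t + x' *\<^sub>R ?b + y' *\<^sub>R ?a)"])
      (simp_all only: dist_commute)
  then show False by (simp add: dist_real_def)
qed

lemma partials_move_front:
  fixes f :: "real ^ 'n::finite \<Rightarrow> real"
  shows "smooth_at t f \<Longrightarrow> partials (js @ j # ks) f t = partial j (partials (js @ ks) f) t"
proof (induction js arbitrary: t)
  case (Cons i js)
  have "\<forall>\<^sub>F s in nhds t. partials (js @ j # ks) f s = partial j (partials (js @ ks) f) s"
    using eventually_smooth_at[OF Cons.prems] by (rule eventually_mono) (rule Cons.IH)
  then have "partials ((i # js) @ j # ks) f t = partial i (partial j (partials (js @ ks) f)) t"
    using partial_cong_ev by fastforce
  also have "\<dots> = partial j (partial i (partials (js @ ks) f)) t"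
    by (intro partial_commute smooth_at_partials Cons.prems)
  finally show ?case by simp
qed simp

text \<open>The head of \<open>js\<close> is located in \<open>ks\<close> and pulled to the front
  there. This makes the ordering picked by \<open>SOME js. mset js = J\<close> in
  \<open>jet_coords\<close> immaterial. The point \<open>t\<close> is arbitrary in the induction
  because the equality must hold near \<open>t\<close> before it is differentiated.\<close>

lemma partials_mset_cong:
  fixes f :: "real ^ 'n::finite \<Rightarrow> real"
  shows "smooth_at t f \<Longrightarrow> mset js = mset ks \<Longrightarrow> partials js f t = partials ks f t"
proof (induction js arbitrary: t ks)
  case (Cons j js)
  have "j \<in> set ks" using mset_eq_setD[OF Cons.prems(2)] by auto
  then obtain as bs where ks: "ks = as @ j # bs" by (blast dest: split_list)
  have m: "mset js = mset (as @ bs)" using Cons.prems(2) by (simp add: ks)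
  have "\<forall>\<^sub>F s in nhds t. partials js f s = partials (as @ bs) f s"
    using eventually_smooth_at[OF Cons.prems(1)] by (rule eventually_mono) (rule Cons.IH[OF _ m])
  then have "partials (j # js) f t = partial j (partials (as @ bs) f) t"
    using partial_cong_ev by fastforce
  then show ?case using ks partials_move_front[OF Cons.prems(1)] by simp
qed simp

section \<open>Smooth local inverses\<close>

lemma eventually_det_nonzero:
  fixes M :: "'a::t2_space \<Rightarrow> real ^ 'n ^ 'n::finite"
  assumes "\<And>i j. isCont (\<lambda>s. M s $ i $ j) t" "det (M t) \<noteq> 0"
  shows "\<forall>\<^sub>F s in nhds t. det (M s) \<noteq> 0"
proof -
  have "isCont (\<lambda>s. det (M s)) t"
    unfolding det_def by (intro continuous_sum continuous_mult continuous_const continuous_prod assms)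
  then have "((\<lambda>s. det (M s)) \<longlongrightarrow> det (M t)) (nhds t)"
    using tendsto_at_iff_tendsto_nhds[of "\<lambda>s. det (M s)" t] by (simp add: isCont_def)
  from tendsto_imp_eventually_ne[OF this assms(2)] show ?thesis .
qed

text \<open>The inverse function theorem gives a local inverse \<open>k\<close> whose derivative is
  the inverse of the Jacobian of \<open>h\<close> at \<open>k y\<close>. Smoothness is bootstrapped
  from this formula: if \<open>k\<close> is of class \<open>l\<close>, so are the entries of the
  inverse Jacobian along \<open>k\<close>, by Cramer's rule, and hence \<open>k\<close> is of class
  \<open>Suc l\<close>.\<close>

theorem smooth_inverse_function:
  fixes h :: "real ^ 'n::finite \<Rightarrow> real ^ 'n"
  assumes "smooth_at t h" "det (jacobian h (at t)) \<noteq> 0"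
  obtains k where "smooth_at (h t) k" "k (h t) = t"
    "\<forall>\<^sub>F s in nhds t. k (h s) = s" "\<forall>\<^sub>F u in nhds (h t). h (k u) = u"
proof -
  obtain U where U: "open U" "t \<in> U" "smooth_on U h"
    using assms(1) smooth_at_def by blast
  have sm: "smooth_at x h" if "x \<in> U" for x
    using that U smooth_on_imp_smooth_at by blast
  have bl: "bounded_linear (frechet_derivative h (at x))" if "x \<in> U" for x
    using smooth_at_has_derivative[OF sm[OF that]] has_derivative_bounded_linear by blast
  \<comment> \<open>The theorem invoked below takes a continuous derivative with values in bounded
    linear maps; in finite dimension its continuity is tested on one vector at a time.\<close>
  define h' where "h' x = Blinfun (frechet_derivative h (at x))" for x
  have h': "blinfun_apply (h' x) = frechet_derivative h (at x)" if "x \<in> U" for x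
    using bounded_linear_Blinfun_apply[OF bl[OF that]] by (simp add: h'_def)
  have jac: "frechet_derivative h (at x) = (*v) (jacobian h (at x))" if "x \<in> U" for x
    unfolding jacobian_def by (rule matrix_vector_mul(3)[OF bl[OF that], symmetric])
  have "continuous_on U h'"
  proof (rule continuous_on_blinfun_componentwise)
    fix b :: "real ^ 'n"
    have "continuous_on U (\<lambda>x. frechet_derivative h (at x) b)"
      by (intro continuous_at_imp_continuous_on ballI smooth_at_continuous smooth_at_derivative sm)
    then show "continuous_on U (\<lambda>x. blinfun_apply (h' x) b)"
      by (rule continuous_on_eq) (simp add: h')
  qed
  moreover have "(h has_derivative blinfun_apply (h' x)) (at x)" if "x \<in> U" for x
    using smooth_at_has_derivative[OF sm[OF that]] h'[OF that] by simp
  moreover have "Blinfun ((*v) (matrix_inv (jacobian h (at t)))) o\<^sub>L h' t = id_blinfun"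
    by (rule blinfun_eqI)
      (simp add: bounded_linear_Blinfun_apply h' U(2) jac matrix_vector_mul_assoc matrix_inv_mult(2)[OF assms(2)])
  ultimately obtain U' V k k' where U': "open U'" "U' \<subseteq> U" "t \<in> U'" "open V" "h t \<in> V"
    and hom: "homeomorphism U' V h k"
    and k': "\<And>y. y \<in> V \<Longrightarrow> (k has_derivative k' y) (at y)"
      "\<And>y. y \<in> V \<Longrightarrow> k' y = inv (blinfun_apply (h' (k y)))"
      "\<And>y. y \<in> V \<Longrightarrow> bij (blinfun_apply (h' (k y)))"
    using inverse_function_theorem[OF U(1) _ _ U(2)] by metis
  have kV: "k y \<in> U" if "y \<in> V" for y
    using hom that U'(2) unfolding homeomorphism_def by blast
  let ?J = "\<lambda>y. jacobian h (at (k y))"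
  have k'_eq: "k' y = (*v) (matrix_inv (?J y))" and det: "det (?J y) \<noteq> 0" if "y \<in> V" for y
  proof -
    have bij: "bij ((*v) (?J y))"
      using k'(3)[OF that] h' jac kV[OF that] by simp
    then show det: "det (?J y) \<noteq> 0"
      using invertible_det_nz invertible_left_inverse matrix_left_invertible_injective
        bij_is_inj by metis
    have "inv ((*v) (?J y)) = (*v) (matrix_inv (?J y))"
      by (intro inv_unique_comp ext)
        (simp_all add: matrix_vector_mul_assoc matrix_inv_mult[OF det])
    then show "k' y = (*v) (matrix_inv (?J y))"
      using k'(2)[OF that] h' jac kV[OF that] by simp
  qed
  have "Ck_on l V k" for l
  proof (induction l)
    case 0
    then show ?case using hom by (simp add: homeomorphism_def)
  next
    case (Suc l)
    have "Ck_on l U (\<lambda>x. partial j (\<lambda>s. h s $ i) x)" for i j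
      using smooth_on_if_smooth_at[of U "partial j (\<lambda>s. h s $ i)"] sm
      by (simp add: smooth_on_def smooth_at_partial smooth_at_component)
    then have "Ck_on l V (\<lambda>y. partial j (\<lambda>s. h s $ i) (k y))" for i j
      using kV by (intro Ck_on_compose[OF U'(4) U(1) _ Suc]) blast+
    then have "Ck_on l V (\<lambda>y. ?J y $ i $ j)" for i j
      by (rule iffD1[OF Ck_on_cong[OF U'(4)], rotated]) (simp add: jacobian_component sm kV)
    then have inv: "Ck_on l V (\<lambda>y. matrix_inv (?J y) $ i $ j)" for i j
      using det by (intro Ck_on_matrix_inv U'(4)) auto
    show ?case
    proof (rule Ck_on_SucI[OF U'(4)])
      show "(k has_derivative (\<lambda>v. matrix_inv (?J y) *v v)) (at y)" if "y \<in> V" for y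
        using k'(1)[OF that] k'_eq[OF that] by simp
      show "Ck_on l V (\<lambda>y. matrix_inv (?J y) *v v)" for v
      proof (rule Ck_on_vec[OF U'(4)])
        show "Ck_on l V (\<lambda>y. (matrix_inv (?J y) *v v) $ i)" for i
          unfolding matrix_vector_mult_def vec_lambda_beta
          by (intro Ck_on_sum[OF U'(4)] Ck_on_bilinear[OF U'(4) bounded_bilinear_mult] inv Ck_on_const[OF U'(4)])
      qed
    qed
  qed
  then have "smooth_at (h t) k"
    using U'(4,5) by (auto simp: smooth_at_def smooth_on_def)
  moreover have "k (h s) = s" if "s \<in> U'" for s
    using hom that by (simp add: homeomorphism_def)
  moreover have "h (k y) = y" if "y \<in> V" for y
    using hom that by (simp add: homeomorphism_def)
  ultimately show thesis
    using U' by (intro that[of k]) (auto simp: eventually_nhds)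
qed

subsection \<open>Agreement up to finite order and local diffeomorphisms\<close>

text \<open>The relation of having the same \<open>r\<close>-jet at \<open>t\<close>. Jets of maps
  into \<open>X\<close> are compared through it, one chart component at a time.\<close>

definition agree :: "nat \<Rightarrow> real ^ 'n \<Rightarrow> (real ^ 'n::finite \<Rightarrow> real) \<Rightarrow> (real ^ 'n \<Rightarrow> real) \<Rightarrow> bool" where
  "agree r t f g \<longleftrightarrow> (\<forall>js. length js \<le> r \<longrightarrow> partials js f t = partials js g t)"

lemma agree_refl: "agree r t f f"
  by (simp add: agree_def)

lemma agree_imp_eq: "agree r t f g \<Longrightarrow> f t = g t"
  using agree_def[of r t f g] partials_simps(1) by (metis le0 list.size(3))

lemma agree_imp_partial_eq: "agree r t f g \<Longrightarrow> r \<ge> 1 \<Longrightarrow> partial j f t = partial j g t"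
  using agree_def[of r t f g] by (auto dest!: spec[of _ "[j]"])

lemma agree_cong_ev:
  assumes "\<forall>\<^sub>F s in nhds t. f s = f' s" "\<forall>\<^sub>F s in nhds t. g s = g' s" "agree r t f g"
  shows "agree r t f' g'"
  using assms(3) partials_cong_ev[OF assms(1)] partials_cong_ev[OF assms(2)] by (simp add: agree_def)

text \<open>The last entry of a list is the derivative applied first, so splitting it off turns
  agreement of functions into agreement of their partial derivatives. The inductions below use this
  form, since the sum, product and chain rules describe exactly these derivatives.\<close>

lemma agree_Suc:
  "agree (Suc r) t f g \<longleftrightarrow> f t = g t \<and> (\<forall>j. agree r t (partial j f) (partial j g))"
proof
  assume a: "agree (Suc r) t f g"
  show "f t = g t \<and> (\<forall>j. agree r t (partial j f) (partial j g))"
  proof (intro conjI allI)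
    show "agree r t (partial j f) (partial j g)" for j
      unfolding agree_def
    proof (intro allI impI)
      fix js :: "'a list" assume "length js \<le> r"
      then show "partials js (partial j f) t = partials js (partial j g) t"
        using a agree_def[of "Suc r" t f g] partials_simps(3)
        by (metis length_append_singleton Suc_le_mono)
    qed
  qed (use a agree_imp_eq in blast)
next
  assume a: "f t = g t \<and> (\<forall>j. agree r t (partial j f) (partial j g))"
  show "agree (Suc r) t f g"
    unfolding agree_def
  proof (intro allI impI)
    fix js :: "'a list" assume js: "length js \<le> Suc r"
    show "partials js f t = partials js g t"
    proof (cases js rule: rev_cases)
      case (snoc ks j)
      then show ?thesis using a js by (simp add: agree_def)
    qed (use a in simp)
  qed
qed

lemma agree_mono: "agree r t f g \<Longrightarrow> r' \<le> r \<Longrightarrow> agree r' t f g"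
  by (auto simp: agree_def)

lemma agree_add:
  "smooth_at t f \<Longrightarrow> smooth_at t f' \<Longrightarrow> smooth_at t g \<Longrightarrow> smooth_at t g' \<Longrightarrow>
   agree r t f f' \<Longrightarrow> agree r t g g' \<Longrightarrow> agree r t (\<lambda>s. f s + g s) (\<lambda>s. f' s + g' s)"
proof (induction r arbitrary: f f' g g')
  case 0
  then show ?case by (simp add: agree_def)
next
  case (Suc r)
  have ev: "\<forall>\<^sub>F s in nhds t. partial j f s + partial j g s = partial j (\<lambda>s. f s + g s) s"
    if "smooth_at t f" "smooth_at t g" for f g :: "real ^ 'a \<Rightarrow> real" and j
    using eventually_smooth_at[OF that(1)] eventually_smooth_at[OF that(2)]
    by eventually_elim (simp add: partial_add)
  have "agree r t (partial j (\<lambda>s. f s + g s)) (partial j (\<lambda>s. f' s + g' s))" for j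
  proof (rule agree_cong_ev[OF ev[OF Suc.prems(1,3)] ev[OF Suc.prems(2,4)]])
    show "agree r t (\<lambda>s. partial j f s + partial j g s) (\<lambda>s. partial j f' s + partial j g' s)"
      using Suc.prems by (intro Suc.IH smooth_at_partial) (auto simp: agree_Suc)
  qed
  then show ?case using Suc.prems by (simp add: agree_Suc)
qed

lemma agree_mult:
  "smooth_at t f \<Longrightarrow> smooth_at t f' \<Longrightarrow> smooth_at t g \<Longrightarrow> smooth_at t g' \<Longrightarrow>
   agree r t f f' \<Longrightarrow> agree r t g g' \<Longrightarrow> agree r t (\<lambda>s. f s * g s) (\<lambda>s. f' s * g' s)"
proof (induction r arbitrary: f f' g g')
  case 0
  then show ?case by (simp add: agree_def)
next
  case (Suc r)
  have ev: "\<forall>\<^sub>F s in nhds t. f s * partial j g s + partial j f s * g s = partial j (\<lambda>s. f s * g s) s"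
    if "smooth_at t f" "smooth_at t g" for f g :: "real ^ 'a \<Rightarrow> real" and j
    using eventually_smooth_at[OF that(1)] eventually_smooth_at[OF that(2)]
    by eventually_elim (simp add: partial_mult)
  have "agree r t (partial j (\<lambda>s. f s * g s)) (partial j (\<lambda>s. f' s * g' s))" for j
  proof (rule agree_cong_ev[OF ev[OF Suc.prems(1,3)] ev[OF Suc.prems(2,4)]])
    have "agree r t f f'" "agree r t g g'" using Suc.prems agree_mono by (metis le_SucI order_refl)+
    then show "agree r t (\<lambda>s. f s * partial j g s + partial j f s * g s)
        (\<lambda>s. f' s * partial j g' s + partial j f' s * g' s)"
      using Suc.prems
      by (intro agree_add smooth_at_mult Suc.IH smooth_at_partial) (auto simp: agree_Suc)
  qed
  then show ?case using Suc.prems by (simp add: agree_Suc)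
qed

lemma agree_sum:
  assumes "\<And>i. i \<in> I \<Longrightarrow> smooth_at t (f i)" "\<And>i. i \<in> I \<Longrightarrow> smooth_at t (g i)"
    and "\<And>i. i \<in> I \<Longrightarrow> agree r t (f i) (g i)"
  shows "agree r t (\<lambda>s. \<Sum>i\<in>I. f i s) (\<lambda>s. \<Sum>i\<in>I. g i s)"
  using assms
proof (induction I rule: infinite_finite_induct)
  case (insert i I)
  then have "agree r t (\<lambda>s. f i s + (\<Sum>i\<in>I. f i s)) (\<lambda>s. g i s + (\<Sum>i\<in>I. g i s))"
    by (intro agree_add smooth_at_sum) auto
  then show ?case using insert.hyps by simp
qed (simp_all add: agree_refl)

text \<open>By the chain rule a derivative of the composite is a sum of products of
  \<open>partial k \<phi>\<close> along \<open>f\<close> with derivatives of \<open>f\<close>, all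
  needed to one order less. This is the common source of the chart independence of jets and of the
  well-definedness of the group action.\<close>

lemma agree_compose:
  fixes f f' :: "real ^ 'n::finite \<Rightarrow> real ^ 'm::finite"
  assumes f: "smooth_at t f" "smooth_at t f'"
  shows "smooth_at (f t) \<phi> \<Longrightarrow> smooth_at (f t) \<phi>' \<Longrightarrow>
    (\<And>k. agree r t (\<lambda>s. f s $ k) (\<lambda>s. f' s $ k)) \<Longrightarrow> agree r (f t) \<phi> \<phi>' \<Longrightarrow>
    agree r t (\<lambda>s. \<phi> (f s)) (\<lambda>s. \<phi>' (f' s))"
proof (induction r arbitrary: \<phi> \<phi>')
  case 0
  then have "f t = f' t" using agree_imp_eq by (metis vec_eq_iff)
  then show ?case using 0 by (simp add: agree_def)
next
  case (Suc r)
  have eq: "f t = f' t" using Suc.prems(3) agree_imp_eq by (metis vec_eq_iff)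
  have agr: "agree r t (\<lambda>s. f s $ k) (\<lambda>s. f' s $ k)" for k
    using Suc.prems(3) agree_mono le_SucI by blast
  have sm: "smooth_at (f' t) \<phi>'" using Suc.prems(2) eq by simp
  have ev: "\<forall>\<^sub>F s in nhds t. (\<Sum>k\<in>UNIV. partial k \<phi> (f s) * partial j (\<lambda>s. f s $ k) s) = partial j (\<lambda>s. \<phi> (f s)) s"
    if "smooth_at t f" "smooth_at (f t) \<phi>" for f :: "real ^ 'n::finite \<Rightarrow> real ^ 'm::finite" and \<phi> j
  proof -
    have "filterlim f (nhds (f t)) (nhds t)"
      using smooth_at_continuous[OF that(1)] by (simp add: isCont_def tendsto_at_iff_tendsto_nhds)
    then have "\<forall>\<^sub>F s in nhds t. smooth_at (f s) \<phi>"
      using eventually_smooth_at[OF that(2)] by (rule eventually_compose_filterlim[rotated])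
    with eventually_smooth_at[OF that(1)] show ?thesis
      by eventually_elim (simp add: partial_compose)
  qed
  have "agree r t (partial j (\<lambda>s. \<phi> (f s))) (partial j (\<lambda>s. \<phi>' (f' s)))" for j
  proof (rule agree_cong_ev[OF ev[OF f(1) Suc.prems(1)] ev[OF f(2) sm]])
    have sf: "smooth_at t (partial j (\<lambda>s. f s $ k))" "smooth_at t (partial j (\<lambda>s. f' s $ k))" for k
      using f by (auto intro: smooth_at_partial smooth_at_component)
    have sp: "smooth_at t (\<lambda>s. partial k \<phi> (f s))" "smooth_at t (\<lambda>s. partial k \<phi>' (f' s))" for k
      using f Suc.prems(1) sm by (auto intro: smooth_at_compose smooth_at_partial)
    have "agree r t (\<lambda>s. partial k \<phi> (f s)) (\<lambda>s. partial k \<phi>' (f' s))" for k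
    proof (rule Suc.IH[OF _ _ agr])
      show "smooth_at (f t) (partial k \<phi>)" "smooth_at (f t) (partial k \<phi>')"
        using Suc.prems(1,2) by (auto intro: smooth_at_partial)
      show "agree r (f t) (partial k \<phi>) (partial k \<phi>')"
        using Suc.prems(4) by (simp add: agree_Suc)
    qed
    moreover have "agree r t (partial j (\<lambda>s. f s $ k)) (partial j (\<lambda>s. f' s $ k))" for k
      using Suc.prems(3) by (auto simp: agree_Suc)
    ultimately show "agree r t (\<lambda>s. \<Sum>k\<in>UNIV. partial k \<phi> (f s) * partial j (\<lambda>s. f s $ k) s)
        (\<lambda>s. \<Sum>k\<in>UNIV. partial k \<phi>' (f' s) * partial j (\<lambda>s. f' s $ k) s)"
      by (intro agree_sum smooth_at_mult agree_mult sf sp)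
  qed
  then show ?case using Suc.prems agree_imp_eq[OF Suc.prems(4)] eq by (simp add: agree_Suc)
qed

section \<open>Germs of local diffeomorphisms and their jets\<close>

lemma eventually_nhds_smooth_compose:
  assumes "smooth_at t f" "\<forall>\<^sub>F u in nhds (f t). P u"
  shows "\<forall>\<^sub>F s in nhds t. P (f s)"
proof -
  have "filterlim f (nhds (f t)) (nhds t)"
    using smooth_at_continuous[OF assms(1)] by (simp add: isCont_def tendsto_at_iff_tendsto_nhds)
  then show ?thesis using assms(2) by (rule eventually_compose_filterlim[rotated])
qed

text \<open>A two-sided inverse germ replaces the domain on which \<alpha> is injective with open
  image. In this form composition and inversion need no bookkeeping of domains.\<close>

lemma local_diffeo_0_iff:
  "local_diffeo_0 \<alpha> \<longleftrightarrow> \<alpha> 0 = 0 \<and> smooth_at 0 \<alpha> \<and> (\<exists>\<beta>. \<beta> 0 = 0 \<and> smooth_at 0 \<beta> \<and>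
    (\<forall>\<^sub>F u in nhds 0. \<beta> (\<alpha> u) = u) \<and> (\<forall>\<^sub>F w in nhds 0. \<alpha> (\<beta> w) = w))" (is "?L \<longleftrightarrow> ?R")
proof
  assume ?L
  then obtain U where 0: "\<alpha> 0 = 0" and U: "open U" "0 \<in> U" "smooth_on U \<alpha>" "inj_on \<alpha> U"
    "open (\<alpha> ` U)" "smooth_on (\<alpha> ` U) (inv_into U \<alpha>)"
    unfolding local_diffeo_0_def by blast
  have im: "0 \<in> \<alpha> ` U" using 0 U(2) by (metis imageI)
  show ?R
  proof (intro conjI exI[of _ "inv_into U \<alpha>"])
    show "inv_into U \<alpha> 0 = 0" using 0 U by (metis inv_into_f_f)
    show "smooth_at 0 \<alpha>" "smooth_at 0 (inv_into U \<alpha>)"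
      using U im by (auto intro: smooth_on_imp_smooth_at)
    show "\<forall>\<^sub>F u in nhds 0. inv_into U \<alpha> (\<alpha> u) = u"
      using U unfolding eventually_nhds by (intro exI[of _ U]) auto
    show "\<forall>\<^sub>F w in nhds 0. \<alpha> (inv_into U \<alpha> w) = w"
      using U im unfolding eventually_nhds by (intro exI[of _ "\<alpha> ` U"]) (auto simp: f_inv_into_f)
  qed (use 0 in simp)
next
  assume ?R
  then obtain \<beta> where 0: "\<alpha> 0 = 0" "\<beta> 0 = 0" and sm: "smooth_at 0 \<alpha>" "smooth_at 0 \<beta>"
    and inv: "\<forall>\<^sub>F u in nhds 0. \<beta> (\<alpha> u) = u" "\<forall>\<^sub>F w in nhds 0. \<alpha> (\<beta> w) = w" by blast
  obtain U1 where U1: "open U1" "0 \<in> U1" "\<And>u. u \<in> U1 \<Longrightarrow> smooth_at u \<alpha> \<and> \<beta> (\<alpha> u) = u"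
    using eventually_conj[OF eventually_smooth_at[OF sm(1)] inv(1)] unfolding eventually_nhds by blast
  obtain W1 where W1: "open W1" "0 \<in> W1" "\<And>u. u \<in> W1 \<Longrightarrow> smooth_at u \<beta> \<and> \<alpha> (\<beta> u) = u"
    using eventually_conj[OF eventually_smooth_at[OF sm(2)] inv(2)] unfolding eventually_nhds by blast
  \<comment> \<open>The two neighbourhoods are cut down by each other's preimages so that \<alpha>
    and \<beta> become mutually inverse bijections between \<open>U\<close> and
    \<open>W\<close>.\<close>
  define U where "U = \<alpha> -` W1 \<inter> U1"
  define W where "W = \<beta> -` U1 \<inter> W1"
  have "continuous_on U1 \<alpha>" "continuous_on W1 \<beta>"
    using U1(3) W1(3) by (auto intro!: continuous_at_imp_continuous_on smooth_at_continuous)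
  then have op: "open U" "open W"
    using U1(1) W1(1) by (auto simp: U_def W_def continuous_on_open_vimage)
  have inj: "inj_on \<alpha> U" by (rule inj_on_inverseI[of _ \<beta>]) (use U1(3) U_def in auto)
  have im: "\<alpha> ` U = W"
  proof
    show "\<alpha> ` U \<subseteq> W" using U1(3) by (auto simp: U_def W_def)
    show "W \<subseteq> \<alpha> ` U"
    proof
      fix w assume "w \<in> W"
      then have "w = \<alpha> (\<beta> w)" "\<beta> w \<in> U" using W1(3) by (auto simp: U_def W_def)
      then show "w \<in> \<alpha> ` U" by blast
    qed
  qed
  have "inv_into U \<alpha> w = \<beta> w" if "w \<in> W" for w
    using that W1(3) U1(3) inj by (intro inv_into_f_eq) (auto simp: U_def W_def)
  moreover have "smooth_on W \<beta>" using W1(3) by (intro smooth_on_if_smooth_at) (auto simp: W_def)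
  ultimately have "smooth_on W (inv_into U \<alpha>)" using smooth_on_cong[OF op(2)] by metis
  moreover have "smooth_on U \<alpha>" using U1(3) by (intro smooth_on_if_smooth_at) (auto simp: U_def)
  ultimately show ?L
    unfolding local_diffeo_0_def using 0 op inj im U1(2) W1(2)
    by (intro conjI exI[of _ U]) (auto simp: U_def)
qed

lemma local_diffeo_0_smooth: "local_diffeo_0 \<alpha> \<Longrightarrow> \<alpha> 0 = 0" "local_diffeo_0 \<alpha> \<Longrightarrow> smooth_at 0 \<alpha>"
  by (auto simp: local_diffeo_0_iff)

lemma local_diffeo_0_ident: "local_diffeo_0 (\<lambda>u. u)"
  unfolding local_diffeo_0_iff by (intro conjI exI[of _ "\<lambda>u. u"]) (auto intro: smooth_at_ident)

lemma local_diffeo_0_inverse: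
  assumes "local_diffeo_0 \<alpha>"
  obtains \<beta> where "local_diffeo_0 \<beta>" "\<forall>\<^sub>F u in nhds 0. \<beta> (\<alpha> u) = u" "\<forall>\<^sub>F w in nhds 0. \<alpha> (\<beta> w) = w"
  using assms unfolding local_diffeo_0_iff by blast

lemma local_diffeo_0_compose:
  assumes "local_diffeo_0 \<alpha>" "local_diffeo_0 \<beta>"
  shows "local_diffeo_0 (\<lambda>u. \<alpha> (\<beta> u))"
proof -
  obtain \<alpha>' where \<alpha>': "local_diffeo_0 \<alpha>'" "\<forall>\<^sub>F u in nhds 0. \<alpha>' (\<alpha> u) = u" "\<forall>\<^sub>F w in nhds 0. \<alpha> (\<alpha>' w) = w"
    using local_diffeo_0_inverse assms by blast
  obtain \<beta>' where \<beta>': "local_diffeo_0 \<beta>'" "\<forall>\<^sub>F u in nhds 0. \<beta>' (\<beta> u) = u" "\<forall>\<^sub>F w in nhds 0. \<beta> (\<beta>' w) = w"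
    using local_diffeo_0_inverse assms by blast
  note sm = assms[THEN local_diffeo_0_smooth(2)] \<alpha>'(1)[THEN local_diffeo_0_smooth(2)] \<beta>'(1)[THEN local_diffeo_0_smooth(2)]
  note z = assms[THEN local_diffeo_0_smooth(1)] \<alpha>'(1)[THEN local_diffeo_0_smooth(1)] \<beta>'(1)[THEN local_diffeo_0_smooth(1)]
  show ?thesis
    unfolding local_diffeo_0_iff
  proof (intro conjI exI[of _ "\<lambda>u. \<beta>' (\<alpha>' u)"])
    show "smooth_at 0 (\<lambda>u. \<alpha> (\<beta> u))" "smooth_at 0 (\<lambda>u. \<beta>' (\<alpha>' u))"
      using sm z smooth_at_compose[of 0 \<beta> \<alpha>] smooth_at_compose[of 0 \<alpha>' \<beta>'] by simp_all
    have "\<forall>\<^sub>F u in nhds 0. \<alpha>' (\<alpha> (\<beta> u)) = \<beta> u"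
      using eventually_nhds_smooth_compose[OF sm(2), of "\<lambda>u. \<alpha>' (\<alpha> u) = u"] \<alpha>'(2) z by simp
    with \<beta>'(2) show "\<forall>\<^sub>F u in nhds 0. \<beta>' (\<alpha>' (\<alpha> (\<beta> u))) = u"
      by eventually_elim simp
    have "\<forall>\<^sub>F u in nhds 0. \<beta> (\<beta>' (\<alpha>' u)) = \<alpha>' u"
      using eventually_nhds_smooth_compose[OF sm(3), of "\<lambda>u. \<beta> (\<beta>' u) = u"] \<beta>'(3) z by simp
    with \<alpha>'(3) show "\<forall>\<^sub>F w in nhds 0. \<alpha> (\<beta> (\<beta>' (\<alpha>' w))) = w"
      by eventually_elim simp
  qed (use z in simp_all)
qed

lemma local_diffeo_0_if_det:
  assumes "h 0 = 0" "smooth_at 0 h" "det (jacobian h (at 0)) \<noteq> 0"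
  shows "local_diffeo_0 h"
proof -
  obtain k where "smooth_at 0 k" "k 0 = 0" "\<forall>\<^sub>F s in nhds 0. k (h s) = s" "\<forall>\<^sub>F u in nhds 0. h (k u) = u"
    by (rule smooth_inverse_function[OF assms(2,3)]) (simp add: assms(1))
  then show ?thesis using assms(1,2) local_diffeo_0_iff by blast
qed

lemma jacobian_compose:
  fixes f :: "real ^ 'm::finite \<Rightarrow> real ^ 'k::finite" and g :: "real ^ 'n::finite \<Rightarrow> real ^ 'm"
  assumes "smooth_at t g" "smooth_at (g t) f"
  shows "jacobian (\<lambda>s. f (g s)) (at t) = jacobian f (at (g t)) ** jacobian g (at t)"
proof -
  have "partial j (\<lambda>s. f (g s) $ i) t =
      (\<Sum>k\<in>UNIV. partial k (\<lambda>s. f s $ i) (g t) * partial j (\<lambda>s. g s $ k) t)" for i j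
    using partial_compose[OF assms(1) smooth_at_component[OF assms(2)]] by blast
  then show ?thesis
    using assms smooth_at_compose[OF assms]
    by (simp add: vec_eq_iff matrix_matrix_mult_def jacobian_component)
qed

lemma jacobian_cong_ev:
  "\<forall>\<^sub>F s in nhds t. f s = g s \<Longrightarrow> jacobian f (at t) = jacobian g (at t)"
  unfolding jacobian_def using frechet_derivative_cong_ev by metis

lemma local_diffeo_0_det:
  fixes \<alpha> :: "real ^ 'n::finite \<Rightarrow> real ^ 'n"
  assumes "local_diffeo_0 \<alpha>"
  shows "det (jacobian \<alpha> (at 0)) \<noteq> 0"
proof -
  obtain \<beta> where \<beta>: "local_diffeo_0 \<beta>" "\<forall>\<^sub>F u in nhds 0. \<beta> (\<alpha> u) = u"
    using local_diffeo_0_inverse assms by blast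
  have "jacobian \<beta> (at 0) ** jacobian \<alpha> (at 0) = jacobian (\<lambda>u. \<beta> (\<alpha> u)) (at 0)"
    using jacobian_compose[of 0 \<alpha> \<beta>] assms \<beta>(1) local_diffeo_0_smooth by metis
  also have "\<dots> = jacobian (\<lambda>u. u) (at 0)"
    using \<beta>(2) by (rule jacobian_cong_ev)
  also have "\<dots> = mat 1"
    by (simp add: jacobian_def matrix_id_mat_1[unfolded id_def])
  finally show ?thesis by (metis det_I det_mul mult_zero_right zero_neq_one)
qed

lemma diffeo_jet_eq:
  "\<beta> \<in> diffeo_jet r \<alpha> \<Longrightarrow> diffeo_jet r \<beta> = diffeo_jet r \<alpha>"
  unfolding diffeo_jet_def by auto

lemma rep_in: "b \<in> c \<Longrightarrow> rep c \<in> c"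
  unfolding rep_def by (rule someI)

lemma diff_group_rep:
  assumes "a \<in> diff_group r"
  shows "local_diffeo_0 (rep a)" "diffeo_jet r (rep a) = a" "rep a \<in> a"
proof -
  obtain \<alpha> where \<alpha>: "local_diffeo_0 \<alpha>" "a = diffeo_jet r \<alpha>"
    using assms unfolding diff_group_def by blast
  then have "\<alpha> \<in> a" by (simp add: diffeo_jet_def)
  then show "rep a \<in> a" by (rule rep_in)
  then show "local_diffeo_0 (rep a)" "diffeo_jet r (rep a) = a"
    using diffeo_jet_eq \<alpha>(2) by (auto simp: diffeo_jet_def)
qed

lemma diffeo_jet_agree:
  "\<beta> \<in> diffeo_jet r \<alpha> \<longleftrightarrow> local_diffeo_0 \<beta> \<and> (\<forall>k. agree r 0 (\<lambda>t. \<beta> t $ k) (\<lambda>t. \<alpha> t $ k))"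
  by (auto simp: diffeo_jet_def agree_def)

text \<open>An injective matrix has a left inverse, so its rows span the whole space and contain a
  basis, which has as many elements as \<open>'n\<close>. Enumerating the basis by \<open>'n\<close>
  and choosing a row index for each element gives \<open>e\<close>; it is injective because the
  enumeration is.\<close>

lemma injective_matrix_minor:
  fixes M :: "real ^ 'n::finite ^ 'N::finite"
  assumes "inj ((*v) M)"
  obtains e :: "'n \<Rightarrow> 'N" where "inj e" "det (\<chi> i. M $ e i) \<noteq> 0"
proof -
  have "span (rows M) = UNIV"
    using assms matrix_left_invertible_injective[of M] matrix_left_invertible_span_rows[of M] by blast
  moreover obtain B where B: "B \<subseteq> rows M" "independent B" "rows M \<subseteq> span B" "card B = dim (rows M)"
    using basis_exists by blast
  ultimately have span: "span B = UNIV"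
    by (metis span_span span_mono top.extremum_uniqueI)
  then have "card B = CARD('n)"
    using B by (metis dim_UNIV dim_span DIM_cart DIM_real mult.right_neutral dim_eq_card_independent)
  moreover have "finite B" using B(2) independent_imp_finite by blast
  ultimately obtain b where b: "bij_betw b (UNIV :: 'n set) B"
    using finite_same_card_bij[of "UNIV :: 'n set" B] by auto
  have "\<exists>k. b i = M $ k" for i
    using b B(1) unfolding bij_betw_def rows_def row_def by (auto simp: vec_nth_inverse)
  then obtain e where e: "\<And>i. b i = M $ e i" by metis
  have "inj e" using b e by (metis bij_betw_def inj_on_def)
  moreover have "rows (\<chi> i. M $ e i) = B"
    using b e unfolding bij_betw_def rows_def row_def by (auto simp: vec_nth_inverse)
  then have "det (\<chi> i. M $ e i) \<noteq> 0"
    using span matrix_left_invertible_span_rows[of "\<chi> i. M $ e i"]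
    by (metis invertible_det_nz invertible_left_inverse)
  ultimately show thesis using that by blast
qed

subsection \<open>Velocities on a smooth manifold\<close>

text \<open>Staying in \<open>V\<close> is demanded separately, since \<open>x\<close> has arbitrary
  values outside \<open>V\<close> and smoothness of \<open>x\<close> along \<gamma> would say
  nothing there.\<close>

definition chart_smooth ::
    "'x set \<Rightarrow> ('x \<Rightarrow> real ^ 'N::finite) \<Rightarrow> (real ^ 'n::finite \<Rightarrow> 'x) \<Rightarrow> real ^ 'n \<Rightarrow> bool" where
  "chart_smooth V x \<gamma> t \<longleftrightarrow> (\<forall>\<^sub>F s in nhds t. \<gamma> s \<in> V) \<and> smooth_at t (\<lambda>s. x (\<gamma> s))"

lemma chart_smooth_in: "chart_smooth V x \<gamma> t \<Longrightarrow> \<gamma> t \<in> V"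
  unfolding chart_smooth_def using eventually_nhds_x_imp_x by fast

lemma eventually_chart_smooth:
  "chart_smooth V x \<gamma> t \<Longrightarrow> \<forall>\<^sub>F s in nhds t. chart_smooth V x \<gamma> s"
  unfolding chart_smooth_def
  by (intro eventually_conj) (auto simp: eventually_eventually dest: eventually_smooth_at)

lemma chart_smooth_nhd:
  assumes "chart_smooth V x \<gamma> t"
  obtains T where "open T" "t \<in> T" "\<gamma> ` T \<subseteq> V" "smooth_on T (\<lambda>s. x (\<gamma> s))"
proof -
  obtain T where T: "open T" "t \<in> T" "\<And>s. s \<in> T \<Longrightarrow> chart_smooth V x \<gamma> s"
    using eventually_chart_smooth[OF assms] unfolding eventually_nhds by blast
  have "\<gamma> ` T \<subseteq> V" using T(3) chart_smooth_in by fast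
  moreover have "smooth_on T (\<lambda>s. x (\<gamma> s))"
    using T(3) by (intro smooth_on_if_smooth_at) (simp add: chart_smooth_def)
  ultimately show thesis using that T by blast
qed

lemma chart_smoothI:
  "open T \<Longrightarrow> t \<in> T \<Longrightarrow> \<gamma> ` T \<subseteq> V \<Longrightarrow> smooth_on T (\<lambda>s. x (\<gamma> s)) \<Longrightarrow> chart_smooth V x \<gamma> t"
  unfolding chart_smooth_def using smooth_on_imp_smooth_at by (auto simp: eventually_nhds)

lemma chart_smooth_compose:
  assumes "chart_smooth V x \<gamma> (\<alpha> t)" "smooth_at t \<alpha>"
  shows "chart_smooth V x (\<lambda>s. \<gamma> (\<alpha> s)) t"
  unfolding chart_smooth_def
proof
  show "\<forall>\<^sub>F s in nhds t. \<gamma> (\<alpha> s) \<in> V"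
    using eventually_nhds_smooth_compose[OF assms(2)] assms(1) by (auto simp: chart_smooth_def)
  show "smooth_at t (\<lambda>s. x (\<gamma> (\<alpha> s)))"
    using smooth_at_compose[OF assms(2), of "\<lambda>s. x (\<gamma> s)"] assms(1) by (auto simp: chart_smooth_def)
qed

section \<open>Charts, smooth germs and jets in a smooth structure\<close>

locale smooth_structure =
  fixes X :: "'x topology" and A :: "('x, 'N::finite) chart set"
  assumes manifold: "smooth_manifold X A"
begin

lemma chart:
  assumes "(V, x) \<in> A"
  shows "openin X V" "open (x ` V)" "inj_on x V"
    "openin X W \<Longrightarrow> W \<subseteq> V \<Longrightarrow> open (x ` W)"
proof -
  have "is_chart X (V, x)" using manifold assms unfolding smooth_manifold_def by blast
  then show V: "openin X V" and o: "open (x ` V)"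
    and inj: "inj_on x V"
    using homeomorphic_imp_injective_map[of "subtopology X V" "top_of_set (x ` V)" x] openin_subset[of X V]
    unfolding is_chart_def by (simp_all add: Int_absorb1)
  have c: "homeomorphic_map (subtopology X V) (top_of_set (x ` V)) x"
    using \<open>is_chart X (V, x)\<close> by (simp add: is_chart_def)
  have "open_map (subtopology X V) (top_of_set (x ` V)) x"
    using c by (rule homeomorphic_imp_open_map)
  moreover assume "openin X W" "W \<subseteq> V"
  ultimately have "openin (top_of_set (x ` V)) (x ` W)"
    unfolding open_map_def by (metis V openin_open_subtopology)
  then show "open (x ` W)" using o openin_open_trans by blast
qed

lemma transition:
  assumes "(V, x) \<in> A" "(V', x') \<in> A"
  obtains \<tau> where "\<And>q. q \<in> V \<inter> V' \<Longrightarrow> smooth_at (x q) \<tau>" "\<And>q. q \<in> V \<inter> V' \<Longrightarrow> \<tau> (x q) = x' q"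
proof -
  have sm: "smooth_on (x ` (V \<inter> V')) (x' \<circ> inv_into V x)"
    using manifold assms unfolding smooth_manifold_def compatible_def by fast
  have op: "open (x ` (V \<inter> V'))"
    using chart(1)[OF assms(1)] chart(1)[OF assms(2)] by (intro chart(4)[OF assms(1)]) auto
  show thesis
  proof (rule that[of "x' \<circ> inv_into V x"])
    fix q assume q: "q \<in> V \<inter> V'"
    then show "smooth_at (x q) (x' \<circ> inv_into V x)"
      using smooth_on_imp_smooth_at[OF sm op] by blast
    show "(x' \<circ> inv_into V x) (x q) = x' q"
      using q chart(3)[OF assms(1)] by simp
  qed
qed

text \<open>The continuity used is that of the coordinate expression: \<open>x\<close> maps the
  overlap onto an open set, and by injectivity of \<open>x\<close> on \<open>V\<close> a point of
  \<open>V\<close> whose coordinates lie in that set lies in the overlap.\<close>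

lemma chart_overlap:
  assumes "(V, x) \<in> A" "(V', x') \<in> A" "chart_smooth V x \<gamma> t" "\<gamma> t \<in> V'"
  shows "\<forall>\<^sub>F s in nhds t. \<gamma> s \<in> V \<inter> V'"
proof -
  have op: "open (x ` (V \<inter> V'))"
    using chart(1)[OF assms(1)] chart(1)[OF assms(2)] by (intro chart(4)[OF assms(1)]) auto
  have "x (\<gamma> t) \<in> x ` (V \<inter> V')" using chart_smooth_in[OF assms(3)] assms(4) by blast
  then have "\<forall>\<^sub>F u in nhds (x (\<gamma> t)). u \<in> x ` (V \<inter> V')"
    using op by (rule eventually_nhds_in_open[rotated])
  then have "\<forall>\<^sub>F s in nhds t. x (\<gamma> s) \<in> x ` (V \<inter> V')"
    using eventually_nhds_smooth_compose[of t "\<lambda>s. x (\<gamma> s)"] assms(3) by (auto simp: chart_smooth_def)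
  moreover have "\<forall>\<^sub>F s in nhds t. \<gamma> s \<in> V" using assms(3) by (simp add: chart_smooth_def)
  ultimately show ?thesis
    by eventually_elim (use chart(3)[OF assms(1)] in \<open>auto dest: inj_onD\<close>)
qed

lemma chart_smooth_change:
  assumes "(V, x) \<in> A" "(V', x') \<in> A" "chart_smooth V x \<gamma> t" "\<gamma> t \<in> V'"
  shows "chart_smooth V' x' \<gamma> t"
proof -
  obtain \<tau> where \<tau>: "\<And>q. q \<in> V \<inter> V' \<Longrightarrow> smooth_at (x q) \<tau>" "\<And>q. q \<in> V \<inter> V' \<Longrightarrow> \<tau> (x q) = x' q"
    using transition[OF assms(1,2)] by blast
  note ov = chart_overlap[OF assms]
  have "smooth_at t (\<lambda>s. \<tau> (x (\<gamma> s)))"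
    using smooth_at_compose[of t "\<lambda>s. x (\<gamma> s)" \<tau>] assms(3,4) \<tau>(1) chart_smooth_in[OF assms(3)]
    by (auto simp: chart_smooth_def)
  moreover have "\<forall>\<^sub>F s in nhds t. \<tau> (x (\<gamma> s)) = x' (\<gamma> s)"
    using ov by eventually_elim (use \<tau>(2) in auto)
  ultimately have "smooth_at t (\<lambda>s. x' (\<gamma> s))" by (rule smooth_at_cong_ev)
  moreover have "\<forall>\<^sub>F s in nhds t. \<gamma> s \<in> V'" using ov by eventually_elim auto
  ultimately show ?thesis by (simp add: chart_smooth_def)
qed

lemma smooth_into_chart:
  assumes "smooth_into A U \<gamma>" "t \<in> U" "(V, x) \<in> A" "\<gamma> t \<in> V"
  shows "chart_smooth V x \<gamma> t"
proof -
  obtain V' x' T where c: "(V', x') \<in> A" and T: "open T" "t \<in> T" "\<gamma> ` T \<subseteq> V'" "smooth_on T (x' \<circ> \<gamma>)"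
    using assms(1,2) unfolding smooth_into_def by blast
  then have "chart_smooth V' x' \<gamma> t" by (intro chart_smoothI[of T]) (simp_all add: o_def)
  then show ?thesis using chart_smooth_change[OF c assms(3)] assms(4) by blast
qed

lemma smooth_at_0_if_chart_smooth:
  assumes "(V, x) \<in> A" "chart_smooth V x \<gamma> 0"
  obtains U where "open U" "0 \<in> U" "smooth_into A U \<gamma>" "\<gamma> ` U \<subseteq> V" "smooth_on U (\<lambda>s. x (\<gamma> s))"
proof -
  obtain U where U: "open U" "0 \<in> U" "\<gamma> ` U \<subseteq> V" "smooth_on U (\<lambda>s. x (\<gamma> s))"
    using chart_smooth_nhd[OF assms(2)] by blast
  then have "smooth_into A U \<gamma>"
    using assms(1) unfolding smooth_into_def o_def by blast
  then show thesis using that U by blast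
qed

lemma smooth_at_0_chart:
  assumes "smooth_at_0 A \<gamma>" "(V, x) \<in> A" "\<gamma> 0 \<in> V"
  shows "chart_smooth V x \<gamma> 0"
  using assms smooth_into_chart unfolding smooth_at_0_def by blast

lemma smooth_at_0_iff:
  "(V, x) \<in> A \<Longrightarrow> \<gamma> 0 \<in> V \<Longrightarrow> smooth_at_0 A \<gamma> \<longleftrightarrow> chart_smooth V x \<gamma> 0"
  using smooth_at_0_chart smooth_at_0_if_chart_smooth unfolding smooth_at_0_def by metis

lemma smooth_at_0_obtain:
  assumes "smooth_at_0 A \<gamma>"
  obtains V x where "(V, x) \<in> A" "\<gamma> 0 \<in> V"
  using assms unfolding smooth_at_0_def smooth_into_def by fast

text \<open>One chart around the base point decides membership, although \<open>jet\<close>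
  quantifies over all of them: another chart is reached by a smooth transition map, and
  \<open>agree_compose\<close> transports the agreement.\<close>

lemma mem_jet_iff:
  assumes "(V, x) \<in> A" "\<gamma> 0 \<in> V" "smooth_at_0 A \<gamma>"
  shows "\<delta> \<in> jet A r \<gamma> \<longleftrightarrow> smooth_at_0 A \<delta> \<and> \<delta> 0 = \<gamma> 0 \<and>
    (\<forall>k. agree r 0 (\<lambda>t. x (\<delta> t) $ k) (\<lambda>t. x (\<gamma> t) $ k))" (is "?L \<longleftrightarrow> ?R")
proof
  assume ?L
  then show ?R using assms unfolding jet_def agree_def by fast
next
  assume R: ?R
  have "agree r 0 (\<lambda>t. x' (\<delta> t) $ k) (\<lambda>t. x' (\<gamma> t) $ k)" if c': "(V', x') \<in> A" "\<gamma> 0 \<in> V'" for V' x' k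
  proof -
    have sm: "chart_smooth V x \<gamma> 0" "chart_smooth V x \<delta> 0"
      using smooth_at_0_chart[OF assms(3,1,2)] smooth_at_0_chart[of \<delta>, OF _ assms(1)] R assms(2) by simp_all
    obtain \<tau> where \<tau>: "\<And>q. q \<in> V \<inter> V' \<Longrightarrow> smooth_at (x q) \<tau>" "\<And>q. q \<in> V \<inter> V' \<Longrightarrow> \<tau> (x q) = x' q"
      using transition[OF assms(1) c'(1)] by blast
    have eq: "\<forall>\<^sub>F s in nhds 0. \<tau> (x (\<gamma> s)) $ k = x' (\<gamma> s) $ k"
      using chart_overlap[OF assms(1) c'(1) sm(1) c'(2)] by eventually_elim (use \<tau>(2) in auto)
    have eq': "\<forall>\<^sub>F s in nhds 0. \<tau> (x (\<delta> s)) $ k = x' (\<delta> s) $ k"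
      using chart_overlap[OF assms(1) c'(1) sm(2)] R c'(2) by (auto elim: eventually_mono simp: \<tau>(2))
    have "smooth_at (x (\<gamma> 0)) (\<lambda>q. \<tau> q $ k)" "smooth_at (x (\<delta> 0)) (\<lambda>q. \<tau> q $ k)"
      using \<tau>(1) assms(2) c'(2) R by (auto intro: smooth_at_component)
    then have "agree r 0 (\<lambda>s. \<tau> (x (\<delta> s)) $ k) (\<lambda>s. \<tau> (x (\<gamma> s)) $ k)"
      using sm R agree_compose[of 0 "\<lambda>s. x (\<delta> s)" "\<lambda>s. x (\<gamma> s)" "\<lambda>q. \<tau> q $ k" "\<lambda>q. \<tau> q $ k" r]
      by (simp add: chart_smooth_def agree_refl)
    then show ?thesis by (rule agree_cong_ev[OF eq' eq])
  qed
  then show ?L using R unfolding jet_def agree_def by auto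
qed

lemma jet_eqI:
  assumes "(V, x) \<in> A" "\<gamma> 0 \<in> V" "smooth_at_0 A \<gamma>" "smooth_at_0 A \<delta>" "\<delta> 0 = \<gamma> 0"
    and "\<And>k. agree r 0 (\<lambda>t. x (\<delta> t) $ k) (\<lambda>t. x (\<gamma> t) $ k)"
  shows "jet A r \<delta> = jet A r \<gamma>"
proof -
  have "\<epsilon> \<in> jet A r \<delta> \<longleftrightarrow> \<epsilon> \<in> jet A r \<gamma>" for \<epsilon>
    unfolding mem_jet_iff[OF assms(1,2,3)] mem_jet_iff[OF assms(1) _ assms(4), unfolded assms(5), OF assms(2)]
    using assms(5,6) by (simp add: agree_def)
  then show ?thesis by blast
qed

lemma jet_self: "smooth_at_0 A \<gamma> \<Longrightarrow> \<gamma> \<in> jet A r \<gamma>"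
  unfolding jet_def by auto

lemma jet_eq_if_mem:
  assumes "smooth_at_0 A \<gamma>" "\<delta> \<in> jet A r \<gamma>"
  shows "jet A r \<delta> = jet A r \<gamma>"
proof -
  obtain V x where c: "(V, x) \<in> A" "\<gamma> 0 \<in> V" using smooth_at_0_obtain assms by blast
  show ?thesis using mem_jet_iff[OF c assms(1)] assms(2) by (intro jet_eqI[OF c assms(1)]) auto
qed

lemma jet_cong_ev:
  assumes "(V, x) \<in> A" "\<gamma> 0 \<in> V" "smooth_at_0 A \<gamma>" "smooth_at_0 A \<delta>"
    and "\<forall>\<^sub>F s in nhds 0. x (\<delta> s) = x (\<gamma> s)" "\<delta> 0 = \<gamma> 0"
  shows "jet A r \<delta> = jet A r \<gamma>"
proof (rule jet_eqI[OF assms(1-4,6)])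
  fix k
  have "\<forall>\<^sub>F s in nhds 0. x (\<gamma> s) $ k = x (\<delta> s) $ k" using assms(5) by eventually_elim simp
  then show "agree r 0 (\<lambda>t. x (\<delta> t) $ k) (\<lambda>t. x (\<gamma> t) $ k)"
    by (rule agree_cong_ev[OF _ _ agree_refl]) simp
qed

section \<open>Regular velocities and nonvanishing minors\<close>

definition immersive :: "(real ^ 'n::finite \<Rightarrow> 'x) \<Rightarrow> bool" where
  "immersive \<gamma> \<longleftrightarrow> (\<exists>U. open U \<and> 0 \<in> U \<and> immersion_on A U \<gamma>)"

lemma immersive_smooth: "immersive \<gamma> \<Longrightarrow> smooth_at_0 A \<gamma>"
  unfolding immersive_def immersion_on_def smooth_at_0_def by blast

lemma Imm_eq: "Imm A r = {jet A r \<gamma> |\<gamma>. immersive \<gamma>}"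
  unfolding Imm_def immersive_def by blast

text \<open>The matrix (x^i_j) of the germ translated to the time \<open>t\<close>. Unlike the
  velocity at 0 it can be followed in \<open>t\<close>, which is how its nonvanishing determinant is
  spread to a neighbourhood.\<close>

definition minor :: "('x \<Rightarrow> real ^ 'N) \<Rightarrow> ('n \<Rightarrow> 'N) \<Rightarrow> (real ^ 'n::finite \<Rightarrow> 'x) \<Rightarrow> real ^ 'n \<Rightarrow> real ^ 'n ^ 'n" where
  "minor x e \<gamma> t = (\<chi> i j. partial j (\<lambda>s. x (\<gamma> s) $ e i) t)"

lemma minor_eq_jacobian:
  "smooth_at t (\<lambda>s. x (\<gamma> s)) \<Longrightarrow> minor x e \<gamma> t = (\<chi> i. jacobian (\<lambda>s. x (\<gamma> s)) (at t) $ e i)"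
  by (simp add: minor_def vec_eq_iff jacobian_component)

lemma derivative_eq_jacobian:
  fixes f :: "real ^ 'n::finite \<Rightarrow> real ^ 'm::finite"
  assumes "smooth_at t f"
  shows "frechet_derivative f (at t) = (*v) (jacobian f (at t))"
  unfolding jacobian_def
  using matrix_vector_mul(2)[OF linear_frechet_derivative[OF smooth_at_differentiable[OF assms]]] by simp

lemma inj_if_minor:
  assumes "smooth_at t (\<lambda>s. x (\<gamma> s))" "det (minor x e \<gamma> t) \<noteq> 0"
  shows "inj (frechet_derivative (\<lambda>s. x (\<gamma> s)) (at t))"
proof (rule injI)
  fix v w assume "frechet_derivative (\<lambda>s. x (\<gamma> s)) (at t) v = frechet_derivative (\<lambda>s. x (\<gamma> s)) (at t) w"
  then have "jacobian (\<lambda>s. x (\<gamma> s)) (at t) *v v = jacobian (\<lambda>s. x (\<gamma> s)) (at t) *v w"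
    by (simp add: derivative_eq_jacobian[OF assms(1)])
  then have "minor x e \<gamma> t *v v = minor x e \<gamma> t *v w"
    by (simp add: minor_eq_jacobian[OF assms(1)] vec_eq_iff matrix_vector_mult_def)
  then show "v = w"
    using assms(2) by (metis invertible_det_nz invertible_left_inverse matrix_left_invertible_injective injD)
qed

lemma eventually_minor:
  assumes "smooth_at t (\<lambda>s. x (\<gamma> s))" "det (minor x e \<gamma> t) \<noteq> 0"
  shows "\<forall>\<^sub>F s in nhds t. det (minor x e \<gamma> s) \<noteq> 0"
proof -
  have "isCont (\<lambda>s. minor x e \<gamma> s $ i $ j) t" for i j
    unfolding minor_def using assms(1)
    by (auto intro!: smooth_at_continuous smooth_at_partial smooth_at_component)
  then show ?thesis using assms(2) by (rule eventually_det_nonzero)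
qed

text \<open>A nonzero minor at 0 persists nearby by continuity and makes the derivative injective in
  the chart \<open>x\<close>. For another chart \<open>x'\<close>, the expression in
  \<open>x\<close> is that in \<open>x'\<close> followed by a transition map, and injectivity of a
  composite passes to the map applied first.\<close>

lemma immersive_if_minor:
  assumes c: "(V, x) \<in> A" and sm: "chart_smooth V x \<gamma> 0" and det: "det (minor x e \<gamma> 0) \<noteq> 0"
  shows "immersive \<gamma>"
proof -
  have "\<forall>\<^sub>F s in nhds 0. chart_smooth V x \<gamma> s \<and> det (minor x e \<gamma> s) \<noteq> 0"
    using sm by (intro eventually_conj eventually_chart_smooth eventually_minor[OF _ det])
      (simp_all add: chart_smooth_def)
  then obtain U where U: "open U" "0 \<in> U" "\<And>s. s \<in> U \<Longrightarrow> chart_smooth V x \<gamma> s \<and> det (minor x e \<gamma> s) \<noteq> 0"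
    unfolding eventually_nhds by blast
  have "smooth_on U (x \<circ> \<gamma>)" using U(3) by (intro smooth_on_if_smooth_at) (auto simp: chart_smooth_def o_def)
  moreover have "\<gamma> ` U \<subseteq> V" using U(3) chart_smooth_in by blast
  ultimately have "smooth_into A U \<gamma>"
    using c U(1) unfolding smooth_into_def by blast
  moreover have "inj (frechet_derivative (x' \<circ> \<gamma>) (at t))" if t: "t \<in> U" and c': "(V', x') \<in> A" "\<gamma> t \<in> V'" for t V' x'
  proof -
    have sm: "chart_smooth V x \<gamma> t" using U(3) t by blast
    have sm': "chart_smooth V' x' \<gamma> t" using chart_smooth_change[OF c c'(1) sm c'(2)] .
    obtain \<tau> where \<tau>: "\<And>q. q \<in> V' \<inter> V \<Longrightarrow> smooth_at (x' q) \<tau>" "\<And>q. q \<in> V' \<inter> V \<Longrightarrow> \<tau> (x' q) = x q"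
      using transition[OF c'(1) c] by blast
    have "\<forall>\<^sub>F s in nhds t. x (\<gamma> s) = \<tau> (x' (\<gamma> s))"
      using chart_overlap[OF c'(1) c sm'] chart_smooth_in[OF sm] by (auto elim: eventually_mono simp: \<tau>(2))
    then have "frechet_derivative (\<lambda>s. x (\<gamma> s)) (at t) = frechet_derivative (\<lambda>s. \<tau> (x' (\<gamma> s))) (at t)"
      by (rule frechet_derivative_cong_ev)
    also have "\<dots> = frechet_derivative \<tau> (at (x' (\<gamma> t))) \<circ> frechet_derivative (x' \<circ> \<gamma>) (at t)"
      using frechet_derivative_compose[of "x' \<circ> \<gamma>" t \<tau>] \<tau>(1)[of "\<gamma> t"] c'(2) chart_smooth_in[OF sm] sm'
      by (simp add: o_def chart_smooth_def smooth_at_differentiable)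
    finally have "inj (frechet_derivative \<tau> (at (x' (\<gamma> t))) \<circ> frechet_derivative (x' \<circ> \<gamma>) (at t))"
      using inj_if_minor[of t x \<gamma> e] U(3)[OF t] by (simp add: chart_smooth_def)
    then show ?thesis by (rule inj_on_imageI2)
  qed
  ultimately show ?thesis
    unfolding immersive_def immersion_on_def using U(1,2) by fast
qed

lemma minor_if_immersive:
  fixes \<gamma> :: "real ^ 'n::finite \<Rightarrow> 'x"
  assumes "(V, x) \<in> A" "immersive \<gamma>" "\<gamma> 0 \<in> V"
  obtains e :: "'n \<Rightarrow> 'N" where "inj e" "det (minor x e \<gamma> 0) \<noteq> 0"
proof -
  have sm: "smooth_at 0 (\<lambda>s. x (\<gamma> s))"
    using smooth_at_0_chart[OF immersive_smooth[OF assms(2)] assms(1,3)] by (simp add: chart_smooth_def)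
  have "inj (frechet_derivative (x \<circ> \<gamma>) (at 0))"
    using assms unfolding immersive_def immersion_on_def by fast
  then have "inj ((*v) (jacobian (\<lambda>s. x (\<gamma> s)) (at 0)))"
    using derivative_eq_jacobian[OF sm] by (simp add: o_def)
  then obtain e :: "'n \<Rightarrow> 'N" where "inj e" "det (\<chi> i. jacobian (\<lambda>s. x (\<gamma> s)) (at 0) $ e i) \<noteq> 0"
    using injective_matrix_minor by blast
  then show thesis using that[of e] minor_eq_jacobian[OF sm] by metis
qed

text \<open>Having a nonzero minor is a condition on first derivatives, hence on the jet as
  \<open>r \<ge> 1\<close>. Therefore the arbitrary \<open>rep\<close> of a regular velocity is
  again an immersion near 0.\<close>

lemma immersive_if_mem_jet:
  assumes "immersive \<gamma>" "\<delta> \<in> jet A r \<gamma>" "r \<ge> 1"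
  shows "immersive \<delta>"
proof -
  note sm = immersive_smooth[OF assms(1)]
  obtain V x where c: "(V, x) \<in> A" "\<gamma> 0 \<in> V" using smooth_at_0_obtain[OF sm] by blast
  obtain e where e: "inj e" "det (minor x e \<gamma> 0) \<noteq> 0"
    using minor_if_immersive[OF c(1) assms(1) c(2)] by blast
  have \<delta>: "smooth_at_0 A \<delta>" "\<delta> 0 = \<gamma> 0" "\<And>k. agree r 0 (\<lambda>t. x (\<delta> t) $ k) (\<lambda>t. x (\<gamma> t) $ k)"
    using assms(2) mem_jet_iff[OF c sm] by auto
  have "minor x e \<delta> 0 = minor x e \<gamma> 0"
    using agree_imp_partial_eq[OF \<delta>(3) assms(3)] by (simp add: minor_def vec_eq_iff)
  then show ?thesis
    using immersive_if_minor[OF c(1), of \<delta> e] smooth_at_0_chart[OF \<delta>(1) c(1)] \<delta>(2) c(2) e(2) by simp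
qed

lemma Imm_rep:
  assumes "p \<in> Imm A r" "r \<ge> 1"
  shows "immersive (rep p)" "jet A r (rep p) = p"
proof -
  obtain \<gamma> where \<gamma>: "immersive \<gamma>" "p = jet A r \<gamma>" using assms unfolding Imm_eq by blast
  note sm = immersive_smooth[OF \<gamma>(1)]
  have r: "rep p \<in> jet A r \<gamma>" using rep_in[OF jet_self[OF sm]] \<gamma>(2) by simp
  show "immersive (rep p)" by (rule immersive_if_mem_jet[OF \<gamma>(1) r assms(2)])
  show "jet A r (rep p) = p" using jet_eq_if_mem[OF sm r] \<gamma>(2) by simp
qed

lemma rep_jet:
  assumes "smooth_at_0 A \<gamma>"
  shows "smooth_at_0 A (rep (jet A r \<gamma>))" "rep (jet A r \<gamma>) 0 = \<gamma> 0"
    "(V, x) \<in> A \<Longrightarrow> \<gamma> 0 \<in> V \<Longrightarrow> agree r 0 (\<lambda>t. x (rep (jet A r \<gamma>) t) $ k) (\<lambda>t. x (\<gamma> t) $ k)"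
proof -
  have "rep (jet A r \<gamma>) \<in> jet A r \<gamma>" using rep_in[OF jet_self[OF assms]] .
  then show "smooth_at_0 A (rep (jet A r \<gamma>))" "rep (jet A r \<gamma>) 0 = \<gamma> 0"
    "(V, x) \<in> A \<Longrightarrow> \<gamma> 0 \<in> V \<Longrightarrow> agree r 0 (\<lambda>t. x (rep (jet A r \<gamma>) t) $ k) (\<lambda>t. x (\<gamma> t) $ k)"
    using mem_jet_iff[OF _ _ assms] unfolding jet_def by auto
qed

section \<open>The action of the differential group and its orbits\<close>

lemma smooth_at_0_compose:
  assumes "smooth_at_0 A \<gamma>" "local_diffeo_0 \<alpha>"
  shows "smooth_at_0 A (\<lambda>t. \<gamma> (\<alpha> t))"
proof -
  obtain V x where c: "(V, x) \<in> A" "\<gamma> 0 \<in> V" using smooth_at_0_obtain[OF assms(1)] by blast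
  have "chart_smooth V x (\<lambda>t. \<gamma> (\<alpha> t)) 0"
    using chart_smooth_compose[of V x \<gamma> \<alpha> 0] smooth_at_0_chart[OF assms(1) c] local_diffeo_0_smooth[OF assms(2)]
    by simp
  then show ?thesis
    using smooth_at_0_iff[OF c(1), of "\<lambda>t. \<gamma> (\<alpha> t)"] c(2) local_diffeo_0_smooth[OF assms(2)] by simp
qed

lemma minor_compose:
  assumes "chart_smooth V x \<gamma> 0" "local_diffeo_0 \<alpha>"
  shows "minor x e (\<lambda>t. \<gamma> (\<alpha> t)) 0 = minor x e \<gamma> 0 ** jacobian \<alpha> (at 0)"
proof -
  note \<alpha> = local_diffeo_0_smooth[OF assms(2)]
  have sm: "smooth_at (\<alpha> 0) (\<lambda>s. x (\<gamma> s))" using assms(1) \<alpha>(1) by (simp add: chart_smooth_def)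
  show ?thesis
    using partial_compose[OF \<alpha>(2) smooth_at_component[OF sm]] \<alpha>(1)
    by (simp add: minor_def matrix_matrix_mult_def jacobian_component[OF \<alpha>(2)])
qed

text \<open>\<open>jet_act\<close> composes arbitrarily chosen representatives; by
  \<open>agree_compose\<close> the jet of the composite does not depend on them, so any convenient
  pair of maps computes the action.\<close>

lemma jet_act_eq:
  assumes "smooth_at_0 A \<gamma>" "local_diffeo_0 \<alpha>"
  shows "jet_act A r (jet A r \<gamma>) (diffeo_jet r \<alpha>) = jet A r (\<lambda>t. \<gamma> (\<alpha> t))"
proof -
  obtain V x where c: "(V, x) \<in> A" "\<gamma> 0 \<in> V" using smooth_at_0_obtain[OF assms(1)] by blast
  define \<delta> where "\<delta> = rep (jet A r \<gamma>)"
  define \<beta> where "\<beta> = rep (diffeo_jet r \<alpha>)"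
  have \<delta>: "smooth_at_0 A \<delta>" "\<delta> 0 = \<gamma> 0" "\<And>k. agree r 0 (\<lambda>t. x (\<delta> t) $ k) (\<lambda>t. x (\<gamma> t) $ k)"
    using rep_jet[OF assms(1)] c by (auto simp: \<delta>_def)
  have a: "diffeo_jet r \<alpha> \<in> diff_group r" using assms(2) by (simp add: diff_group_def)
  have "local_diffeo_0 \<beta>" "diffeo_jet r \<beta> = diffeo_jet r \<alpha>"
    unfolding \<beta>_def by (rule diff_group_rep[OF a])+
  then have \<beta>: "local_diffeo_0 \<beta>" "\<And>k. agree r 0 (\<lambda>t. \<beta> t $ k) (\<lambda>t. \<alpha> t $ k)"
    using diffeo_jet_agree[of \<beta> r \<beta>] diffeo_jet_agree[of \<beta> r \<alpha>] agree_refl by auto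
  note \<alpha>0 = local_diffeo_0_smooth[OF assms(2)] and \<beta>0 = local_diffeo_0_smooth[OF \<beta>(1)]
  have sm: "smooth_at 0 (\<lambda>s. x (\<gamma> s))" "smooth_at 0 (\<lambda>s. x (\<delta> s))"
    using smooth_at_0_chart[OF assms(1) c] smooth_at_0_chart[OF \<delta>(1) c(1)] \<delta>(2) c(2)
    by (auto simp: chart_smooth_def)
  have "agree r 0 (\<lambda>t. x (\<delta> (\<beta> t)) $ k) (\<lambda>t. x (\<gamma> (\<alpha> t)) $ k)" for k
    using agree_compose[OF \<beta>0(2) \<alpha>0(2), of "\<lambda>s. x (\<delta> s) $ k" "\<lambda>s. x (\<gamma> s) $ k" r]
      \<beta>(2) \<beta>0(1) \<delta>(3) sm by (simp add: smooth_at_component)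
  then have "jet A r (\<lambda>t. \<delta> (\<beta> t)) = jet A r (\<lambda>t. \<gamma> (\<alpha> t))"
    using c \<alpha>0(1) \<beta>0(1) \<delta>(2) smooth_at_0_compose[OF assms] smooth_at_0_compose[OF \<delta>(1) \<beta>(1)]
    by (intro jet_eqI[OF c(1)]) auto
  then show ?thesis by (simp add: jet_act_def \<delta>_def \<beta>_def o_def)
qed

lemma orbit_proj_eq:
  assumes "smooth_at_0 A \<gamma>"
  shows "orbit_proj A r (jet A r \<gamma>) = {jet A r (\<lambda>t. \<gamma> (\<alpha> t)) |\<alpha>. local_diffeo_0 \<alpha>}"
  unfolding orbit_proj_def diff_group_def using jet_act_eq[OF assms] by auto

text \<open>One inclusion composes with \<alpha>, the other with its inverse germ. The latter
  cancels \<alpha> only near 0, which suffices for jets.\<close>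

lemma orbit_proj_compose:
  assumes "smooth_at_0 A \<gamma>" "local_diffeo_0 \<alpha>"
  shows "orbit_proj A r (jet A r (\<lambda>t. \<gamma> (\<alpha> t))) = orbit_proj A r (jet A r \<gamma>)" (is "?L = ?R")
proof
  note \<alpha>0 = local_diffeo_0_smooth[OF assms(2)]
  note sm = smooth_at_0_compose[OF assms]
  show "?L \<subseteq> ?R"
  proof
    fix p assume "p \<in> ?L"
    then obtain \<beta> where \<beta>: "local_diffeo_0 \<beta>" "p = jet A r (\<lambda>t. \<gamma> (\<alpha> (\<beta> t)))"
      unfolding orbit_proj_eq[OF sm] by blast
    show "p \<in> ?R" unfolding orbit_proj_eq[OF assms(1)]
      using local_diffeo_0_compose[OF assms(2) \<beta>(1)] \<beta>(2)
      by (intro CollectI exI[of _ "\<lambda>t. \<alpha> (\<beta> t)"]) simp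
  qed
  show "?R \<subseteq> ?L"
  proof
    fix p assume "p \<in> ?R"
    then obtain \<beta> where \<beta>: "local_diffeo_0 \<beta>" "p = jet A r (\<lambda>t. \<gamma> (\<beta> t))"
      unfolding orbit_proj_eq[OF assms(1)] by blast
    obtain \<alpha>' where \<alpha>': "local_diffeo_0 \<alpha>'" "\<forall>\<^sub>F w in nhds 0. \<alpha> (\<alpha>' w) = w"
      using local_diffeo_0_inverse[OF assms(2)] by blast
    note \<beta>0 = local_diffeo_0_smooth[OF \<beta>(1)] and \<alpha>'0 = local_diffeo_0_smooth[OF \<alpha>'(1)]
    have d: "local_diffeo_0 (\<lambda>t. \<alpha>' (\<beta> t))" by (rule local_diffeo_0_compose[OF \<alpha>'(1) \<beta>(1)])
    obtain V x where c: "(V, x) \<in> A" "\<gamma> 0 \<in> V" using smooth_at_0_obtain[OF assms(1)] by blast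
    have ev: "\<forall>\<^sub>F t in nhds 0. \<alpha> (\<alpha>' (\<beta> t)) = \<beta> t"
      using eventually_nhds_smooth_compose[OF \<beta>0(2), of "\<lambda>w. \<alpha> (\<alpha>' w) = w"] \<alpha>'(2) \<beta>0(1) by simp
    have "jet A r (\<lambda>t. \<gamma> (\<alpha> (\<alpha>' (\<beta> t)))) = jet A r (\<lambda>t. \<gamma> (\<beta> t))"
      using c \<beta>0(1) \<alpha>'0(1) \<alpha>0(1) smooth_at_0_compose[OF assms(1) \<beta>(1)] smooth_at_0_compose[OF sm d] ev
      by (intro jet_cong_ev[OF c(1)]) (auto elim: eventually_mono)
    then show "p \<in> ?L" unfolding orbit_proj_eq[OF sm]
      using \<beta>(2) d by (intro CollectI exI[of _ "\<lambda>t. \<alpha>' (\<beta> t)"]) simp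
  qed
qed

end

subsection \<open>The invariant coordinates\<close>

lemma finite_jet_index: "finite (jet_index r :: ('N::finite \<times> 'n::finite multiset) set)"
proof -
  have "{J :: 'n multiset. size J \<le> r} \<subseteq> (\<Union>k\<le>r. multisets_of_size UNIV k)"
    by (auto simp: multisets_of_size_def)
  then have "finite {J :: 'n multiset. size J \<le> r}"
    by (rule finite_subset) (simp add: finite_multisets_of_size)
  moreover have "jet_index r = (UNIV :: 'N set) \<times> {J :: 'n multiset. size J \<le> r}"
    by (auto simp: jet_index_def)
  ultimately show ?thesis by simp
qed

lemma jet_index_mono: "k \<le> l \<Longrightarrow> jet_index k \<subseteq> jet_index l"
  by (auto simp: jet_index_def)

lemma mset_SOME: "mset (SOME js. mset js = J) = J"
  using ex_mset[of J] by (rule someI_ex)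

lemma SOME_mset_empty [simp]: "(SOME js. mset js = {#}) = []"
  using mset_SOME[of "{#}"] by simp

lemma SOME_mset_single [simp]: "(SOME js. mset js = {#j#}) = [j]"
  using mset_SOME[of "{#j#}"] by (simp add: mset_single_iff)

text \<open>The polynomial expressions in the jet coordinates of order at most \<open>k\<close>, enlarged by the
  inverses of nowhere vanishing functions, contain the functions \<open>y\<^sup>\<sigma>\<^sub>I\<close> and are closed under the
  coordinate derivatives. For them the formal derivative can be compared with a genuine one.\<close>

inductive rational_fun ::
    "('n \<Rightarrow> 'N) \<Rightarrow> nat \<Rightarrow> (('N, 'n::finite) jet_tuple \<Rightarrow> real) \<Rightarrow> bool" for e k where
  const: "rational_fun e k (\<lambda>p. c)"
| coord: "i \<in> jet_index k \<Longrightarrow> rational_fun e k (\<lambda>p. p i)"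
| add: "rational_fun e k F \<Longrightarrow> rational_fun e k G \<Longrightarrow> rational_fun e k (\<lambda>p. F p + G p)"
| mult: "rational_fun e k F \<Longrightarrow> rational_fun e k G \<Longrightarrow> rational_fun e k (\<lambda>p. F p * G p)"
| inverse: "rational_fun e k F \<Longrightarrow> (\<And>p. det (base_matrix e p) \<noteq> 0 \<Longrightarrow> F p \<noteq> 0) \<Longrightarrow>
    rational_fun e k (\<lambda>p. inverse (F p))"

lemma rational_fun_mono: "rational_fun e k F \<Longrightarrow> k \<le> l \<Longrightarrow> rational_fun e l F"
  by (induction rule: rational_fun.induct)
    (use jet_index_mono in \<open>auto intro: rational_fun.intros\<close>)

lemma rational_fun_cong:
  "rational_fun e k F \<Longrightarrow> (\<And>i. i \<in> jet_index k \<Longrightarrow> p i = q i) \<Longrightarrow> F p = F q"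
  by (induction rule: rational_fun.induct) auto

lemma rational_fun_sum:
  "(\<And>i. i \<in> I \<Longrightarrow> rational_fun e k (F i)) \<Longrightarrow> rational_fun e k (\<lambda>p. \<Sum>i\<in>I. F i p)"
  by (induction I rule: infinite_finite_induct) (auto intro: rational_fun.intros)

lemma rational_fun_prod:
  "(\<And>i. i \<in> I \<Longrightarrow> rational_fun e k (F i)) \<Longrightarrow> rational_fun e k (\<lambda>p. \<Prod>i\<in>I. F i p)"
  by (induction I rule: infinite_finite_induct) (auto intro: rational_fun.intros)

lemma rational_fun_det:
  assumes "\<And>i j. rational_fun e k (\<lambda>p. M p $ i $ j)"
  shows "rational_fun e k (\<lambda>p. det (M p))"
  unfolding det_def
  by (intro rational_fun_sum rational_fun_prod rational_fun.mult rational_fun.const assms)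

lemma rational_fun_base_matrix: "k \<ge> 1 \<Longrightarrow> rational_fun e k (\<lambda>p. base_matrix e p $ i $ j)"
  unfolding base_matrix_def by (auto intro!: rational_fun.coord simp: jet_index_def)

text \<open>For a singular matrix \<open>matrix_inv\<close> is an arbitrary choice, so a rational
  function represents its entries only where the determinant is nonzero.\<close>

lemma rational_fun_matrix_inv:
  assumes "k \<ge> 1"
  obtains G where "rational_fun e k G"
    "\<And>p. det (base_matrix e p) \<noteq> 0 \<Longrightarrow> matrix_inv (base_matrix e p) $ i $ j = G p"
proof (rule that)
  have "rational_fun e k (\<lambda>p. (\<chi> a l. if l = i then axis j 1 $ a else base_matrix e p $ a $ l) $ a $ b)" for a b
    using rational_fun_base_matrix[OF assms] by (cases "b = i") (simp_all add: rational_fun.const)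
  then show "rational_fun e k (\<lambda>p. det (\<chi> a l. if l = i then axis j 1 $ a else base_matrix e p $ a $ l) *
      inverse (det (base_matrix e p)))"
    by (intro rational_fun.mult rational_fun.inverse rational_fun_det rational_fun_base_matrix assms)
qed (rule matrix_inv_cramer)

lemma smooth_at_inverse:
  fixes f :: "'a::real_normed_vector \<Rightarrow> real"
  assumes "smooth_at t f" "f t \<noteq> 0"
  shows "smooth_at t (\<lambda>s. inverse (f s))"
proof -
  obtain U where U: "open U" "t \<in> U" "smooth_on U f" using assms(1) smooth_at_def by blast
  have "continuous_on U f" using U(3) Ck_on.simps(1) unfolding smooth_on_def by blast
  then have op: "open (f -` (- {0}) \<inter> U)" using U(1) continuous_on_open_vimage by blast
  have "smooth_on (f -` (- {0}) \<inter> U) f" using U(3) smooth_on_subset by blast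
  then have "smooth_on (f -` (- {0}) \<inter> U) (\<lambda>s. inverse (f s))"
    unfolding smooth_on_def using Ck_on_inverse[OF op, of f] by simp
  then show ?thesis using op U(2) assms(2) smooth_at_def by blast
qed

lemma partial_inverse:
  assumes "smooth_at t f" "f t \<noteq> 0"
  shows "partial j (\<lambda>s. inverse (f s)) t = - (inverse (f t) * partial j f t * inverse (f t))"
  using partial_eqI[OF Deriv.has_derivative_inverse[OF assms(2) smooth_at_has_derivative[OF assms(1)]]]
  by (simp add: partial_def)

text \<open>\<open>G\<close> collects the coordinate derivatives of \<open>F\<close>. The tuples
  form an infinite product of lines and not a normed space, so the chain rule along a smooth family
  \<open>c\<close> is made part of the predicate and is proved together with the
  derivatives.\<close>

definition total_derivative ::
    "('n \<Rightarrow> 'N) \<Rightarrow> nat \<Rightarrow> (('N, 'n::finite) jet_tuple \<Rightarrow> real) \<Rightarrow>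
     ('N \<times> 'n multiset \<Rightarrow> ('N, 'n) jet_tuple \<Rightarrow> real) \<Rightarrow> bool" where
  "total_derivative e k F G \<longleftrightarrow> (\<forall>i. rational_fun e k (G i)) \<and>
    (\<forall>i p. det (base_matrix e p) \<noteq> 0 \<longrightarrow> ((\<lambda>s. F (p(i := s))) has_real_derivative G i p) (at (p i))) \<and>
    (\<forall>c t. (\<forall>i\<in>jet_index k. smooth_at t (\<lambda>s. c s i)) \<longrightarrow> det (base_matrix e (c t)) \<noteq> 0 \<longrightarrow>
      smooth_at (t :: real ^ 'n) (\<lambda>s. F (c s)) \<and>
      (\<forall>j. partial j (\<lambda>s. F (c s)) t = (\<Sum>i\<in>jet_index k. G i (c t) * partial j (\<lambda>s. c s i) t)))"

lemma total_derivativeD: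
  fixes t :: "real ^ 'n::finite" and e :: "'n \<Rightarrow> 'N"
  assumes "total_derivative e k F G"
  shows "rational_fun e k (G i)"
    "det (base_matrix e p) \<noteq> 0 \<Longrightarrow> ((\<lambda>s. F (p(i := s))) has_real_derivative G i p) (at (p i))"
    "\<forall>i\<in>jet_index k. smooth_at t (\<lambda>s. c s i) \<Longrightarrow> det (base_matrix e (c t)) \<noteq> 0 \<Longrightarrow>
      smooth_at t (\<lambda>s. F (c s)) \<and>
      (\<forall>j. partial j (\<lambda>s. F (c s)) t = (\<Sum>i\<in>jet_index k. G i (c t) * partial j (\<lambda>s. c s i) t))"
  using assms unfolding total_derivative_def by blast+

text \<open>Structural induction with the sum, product and reciprocal rules. The derivatives are
  again rational of order at most \<open>k\<close>, which is what allows the formal derivative to be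
  iterated.\<close>

lemma rational_fun_total_derivative:
  fixes F :: "('N::finite, 'n::finite) jet_tuple \<Rightarrow> real"
  assumes "rational_fun e k F"
  shows "\<exists>G. total_derivative e k F G"
  using assms
proof induction
  case (const c)
  then show ?case
    unfolding total_derivative_def
    by (intro exI[of _ "\<lambda>i p. 0"]) (auto intro: rational_fun.const smooth_at_const)
next
  case (coord i0)
  have "((\<lambda>s. (p(i := s)) i0) has_real_derivative (if i = i0 then 1 else 0)) (at (p i))"
    for p :: "('N, 'n) jet_tuple" and i
    by (cases "i = i0") auto
  moreover have "finite (jet_index k :: ('N \<times> 'n multiset) set)" by (rule finite_jet_index)
  ultimately show ?case
    using coord unfolding total_derivative_def
    by (intro exI[of _ "\<lambda>i p. if i = i0 then 1 else 0"])
      (auto intro: rational_fun.const simp: if_distrib[of "\<lambda>a. a * _"] cong: if_cong)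
next
  case (add F1 F2)
  then obtain G1 G2 where "total_derivative e k F1 G1" "total_derivative e k F2 G2" by blast
  note G1 = this(1)[THEN total_derivativeD(1)] this(1)[THEN total_derivativeD(2)] this(1)[THEN total_derivativeD(3)]
    and G2 = this(2)[THEN total_derivativeD(1)] this(2)[THEN total_derivativeD(2)] this(2)[THEN total_derivativeD(3)]
  show ?case
    unfolding total_derivative_def
  proof (intro exI[of _ "\<lambda>i p. G1 i p + G2 i p"] conjI allI impI)
    show "rational_fun e k (\<lambda>p. G1 i p + G2 i p)" for i by (intro rational_fun.add G1 G2)
    show "((\<lambda>s. F1 (p(i := s)) + F2 (p(i := s))) has_real_derivative G1 i p + G2 i p) (at (p i))"
      if "det (base_matrix e p) \<noteq> 0" for i p
      using that by (intro DERIV_add G1 G2)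
    fix c :: "real ^ 'n \<Rightarrow> _" and t
    assume c: "\<forall>i\<in>jet_index k. smooth_at t (\<lambda>s. c s i)" "det (base_matrix e (c t)) \<noteq> 0"
    show "smooth_at t (\<lambda>s. F1 (c s) + F2 (c s))"
      using G1(3)[OF c] G2(3)[OF c] by (intro smooth_at_add) auto
    show "partial j (\<lambda>s. F1 (c s) + F2 (c s)) t =
        (\<Sum>i\<in>jet_index k. (G1 i (c t) + G2 i (c t)) * partial j (\<lambda>s. c s i) t)" for j
      using G1(3)[OF c] G2(3)[OF c] by (simp add: partial_add sum.distrib ring_distribs)
  qed
next
  case (mult F1 F2)
  then obtain G1 G2 where "total_derivative e k F1 G1" "total_derivative e k F2 G2" by blast
  note G1 = this(1)[THEN total_derivativeD(1)] this(1)[THEN total_derivativeD(2)] this(1)[THEN total_derivativeD(3)]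
    and G2 = this(2)[THEN total_derivativeD(1)] this(2)[THEN total_derivativeD(2)] this(2)[THEN total_derivativeD(3)]
  show ?case
    unfolding total_derivative_def
  proof (intro exI[of _ "\<lambda>i p. G1 i p * F2 p + G2 i p * F1 p"] conjI allI impI)
    show "rational_fun e k (\<lambda>p. G1 i p * F2 p + G2 i p * F1 p)" for i
      by (intro rational_fun.add rational_fun.mult G1 G2 mult.hyps)
    show "((\<lambda>s. F1 (p(i := s)) * F2 (p(i := s))) has_real_derivative G1 i p * F2 p + G2 i p * F1 p) (at (p i))"
      if "det (base_matrix e p) \<noteq> 0" for i p
      using DERIV_mult[OF G1(2)[OF that, of i] G2(2)[OF that, of i]] by simp
    fix c :: "real ^ 'n \<Rightarrow> _" and t
    assume c: "\<forall>i\<in>jet_index k. smooth_at t (\<lambda>s. c s i)" "det (base_matrix e (c t)) \<noteq> 0"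
    show "smooth_at t (\<lambda>s. F1 (c s) * F2 (c s))"
      using G1(3)[OF c] G2(3)[OF c] by (intro smooth_at_mult) auto
    show "partial j (\<lambda>s. F1 (c s) * F2 (c s)) t =
        (\<Sum>i\<in>jet_index k. (G1 i (c t) * F2 (c t) + G2 i (c t) * F1 (c t)) * partial j (\<lambda>s. c s i) t)" for j
      using G1(3)[OF c] G2(3)[OF c]
      by (simp add: partial_mult sum.distrib sum_distrib_left ring_distribs mult_ac)
  qed
next
  case (inverse F)
  then obtain G where "total_derivative e k F G" by blast
  note G = this[THEN total_derivativeD(1)] this[THEN total_derivativeD(2)] this[THEN total_derivativeD(3)]
  show ?case
    unfolding total_derivative_def
  \<comment> \<open>The sign is written as a constant factor because the class is generated by
    constants, sums, products and reciprocals.\<close>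
  proof (intro exI[of _ "\<lambda>i p. (-1) * (inverse (F p) * G i p * inverse (F p))"] conjI allI impI)
    show "rational_fun e k (\<lambda>p. (-1) * (inverse (F p) * G i p * inverse (F p)))" for i
      by (intro rational_fun.mult rational_fun.const rational_fun.inverse G inverse.hyps)
    show "((\<lambda>s. inverse (F (p(i := s)))) has_real_derivative (-1) * (inverse (F p) * G i p * inverse (F p))) (at (p i))"
      if "det (base_matrix e p) \<noteq> 0" for i p
      using DERIV_inverse'[OF G(2)[OF that, of i]] inverse.hyps(2)[OF that] by simp
    fix c :: "real ^ 'n \<Rightarrow> _" and t
    assume c: "\<forall>i\<in>jet_index k. smooth_at t (\<lambda>s. c s i)" "det (base_matrix e (c t)) \<noteq> 0"
    show "smooth_at t (\<lambda>s. inverse (F (c s)))"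
      using G(3)[OF c] inverse.hyps(2)[OF c(2)] by (intro smooth_at_inverse) auto
    show "partial j (\<lambda>s. inverse (F (c s))) t =
        (\<Sum>i\<in>jet_index k. (-1) * (inverse (F (c t)) * G i (c t) * inverse (F (c t))) * partial j (\<lambda>s. c s i) t)" for j
      using G(3)[OF c] inverse.hyps(2)[OF c(2)]
      by (simp add: partial_inverse sum_distrib_left sum_negf mult_ac)
  qed
qed

lemma eventually_det_base_matrix:
  assumes "det (base_matrix e p) \<noteq> 0"
  shows "\<forall>\<^sub>F s in nhds (p i). det (base_matrix e (p(i := s))) \<noteq> 0"
proof -
  have "isCont (\<lambda>s. base_matrix e (p(i := s)) $ a $ b) (p i)" for a b
    unfolding base_matrix_def by (cases "i = (e a, {#b#})") auto
  then show ?thesis using assms by (intro eventually_det_nonzero) simp_all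
qed

text \<open>\<open>coord_partial\<close> sees \<open>H\<close> only near \<open>p\<close> along one
  coordinate line, and there the determinant stays nonzero. So \<open>H\<close> may be replaced by a
  representative \<open>F\<close> that agrees with it on the regular tuples only.\<close>

lemma coord_partial_eq:
  assumes "\<And>p. det (base_matrix e p) \<noteq> 0 \<Longrightarrow> H p = F p" "det (base_matrix e p) \<noteq> 0"
    and "((\<lambda>s. F (p(i := s))) has_real_derivative D) (at (p i))"
  shows "coord_partial i H p = D"
proof -
  have "\<forall>\<^sub>F s in nhds (p i). H (p(i := s)) = F (p(i := s))"
    using eventually_det_base_matrix[OF assms(2)] by eventually_elim (use assms(1) in simp)
  then have "((\<lambda>s. H (p(i := s))) has_real_derivative D) (at (p i))"
    using assms(3) by (subst DERIV_cong_ev[OF refl _ refl])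
  then show ?thesis unfolding coord_partial_def by (rule DERIV_imp_deriv)
qed

text \<open>Each formal derivative raises the order by one through the coordinates
  \<open>p (K, add_mset j J)\<close>. The inverse base matrix needs order one, which
  \<open>Suc (length is)\<close> always provides.\<close>

lemma y_fun_rational:
  fixes e :: "'n::finite \<Rightarrow> 'N::finite"
  shows "\<exists>F. rational_fun e (length is) F \<and> (\<forall>p. det (base_matrix e p) \<noteq> 0 \<longrightarrow> y_fun e \<sigma> is p = F p)"
proof (induction "is")
  case Nil
  then show ?case
    by (intro exI[of _ "\<lambda>p. p (\<sigma>, {#})"]) (auto intro: rational_fun.coord simp: jet_index_def)
next
  case (Cons i "is")
  let ?k = "length is"
  obtain F where F: "rational_fun e ?k F" "\<And>p. det (base_matrix e p) \<noteq> 0 \<Longrightarrow> y_fun e \<sigma> is p = F p"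
    using Cons by blast
  obtain G where "total_derivative e ?k F G"
    using rational_fun_total_derivative[OF F(1)] by blast
  note G = this[THEN total_derivativeD(1)] this[THEN total_derivativeD(2)]
  have cp: "coord_partial a (y_fun e \<sigma> is) p = G a p" if "det (base_matrix e p) \<noteq> 0" for a p
    by (rule coord_partial_eq[OF F(2) that G(2)[OF that]])
  have "\<exists>Z. rational_fun e (Suc ?k) Z \<and> (\<forall>p. det (base_matrix e p) \<noteq> 0 \<longrightarrow> matrix_inv (base_matrix e p) $ j $ i = Z p)" for j
    by (rule rational_fun_matrix_inv[of "Suc ?k" e j i]) auto
  then obtain Z where Z: "\<And>j. rational_fun e (Suc ?k) (Z j)"
    "\<And>j p. det (base_matrix e p) \<noteq> 0 \<Longrightarrow> matrix_inv (base_matrix e p) $ j $ i = Z j p" by metis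
  let ?H = "\<lambda>p. \<Sum>j\<in>UNIV. Z j p * (\<Sum>a\<in>jet_index ?k. G a p * p (fst a, add_mset j (snd a)))"
  have "rational_fun e (Suc ?k) ?H"
    by (intro rational_fun_sum rational_fun.mult Z rational_fun_mono[OF G(1)] rational_fun.coord)
      (auto simp: jet_index_def)
  moreover have "y_fun e \<sigma> (i # is) p = ?H p" if "det (base_matrix e p) \<noteq> 0" for p
    using that by (simp add: formal_deriv_def Z(2) cp case_prod_beta)
  ultimately show ?case by auto
qed

text \<open>Allows \<open>jet_coords\<close>, which is undefined beyond order \<open>r\<close>, to
  be exchanged for a full prolongation. The rational representative involves coordinates of order at
  most \<open>length is\<close>, and \<open>r \<ge> 1\<close> makes the two base matrices
  equal.\<close>

lemma y_fun_cong:
  fixes e :: "'n::finite \<Rightarrow> 'N::finite"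
  assumes "\<And>i. i \<in> jet_index r \<Longrightarrow> p i = q i" "length is \<le> r" "r \<ge> 1" "det (base_matrix e p) \<noteq> 0"
  shows "y_fun e \<sigma> is p = y_fun e \<sigma> is q"
proof -
  obtain F where F: "rational_fun e (length is) F" "\<And>p. det (base_matrix e p) \<noteq> 0 \<Longrightarrow> y_fun e \<sigma> is p = F p"
    using y_fun_rational by blast
  have "base_matrix e p = base_matrix e q"
    using assms(1,3) by (simp add: base_matrix_def vec_eq_iff jet_index_def)
  then show ?thesis
    using assms(4) F(2) rational_fun_cong[OF F(1)] assms(1) jet_index_mono[OF assms(2)]
    by (metis subsetD)
qed

section \<open>Prolongations of maps\<close>

text \<open>The jet of \<open>f\<close> of all orders as a family of tuples depending on the point
  \<open>t\<close>. Truncated at order \<open>r\<close> and taken at 0 it is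
  \<open>jet_coords\<close>; with \<open>t\<close> free it can be differentiated.\<close>

definition prolong :: "(real ^ 'n::finite \<Rightarrow> real ^ 'N::finite) \<Rightarrow> real ^ 'n \<Rightarrow> ('N, 'n) jet_tuple" where
  "prolong f t = (\<lambda>(K, J). partials (SOME js. mset js = J) (\<lambda>s. f s $ K) t)"

lemma jet_coords_eq_prolong:
  "jet_coords r x p = restrict (prolong (\<lambda>t. x (rep p t)) 0) (jet_index r)"
  by (simp add: jet_coords_def prolong_def)

lemma smooth_at_prolong: "smooth_at t f \<Longrightarrow> smooth_at t (\<lambda>s. prolong f s a)"
  by (cases a) (simp add: prolong_def smooth_at_partials smooth_at_component)

text \<open>The genuine counterpart of the rule d_j x^A_J = x^A_{jJ} for the formal derivative.
  Symmetry of partial derivatives reconciles the orderings chosen for \<open>J\<close> and for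
  \<open>add_mset j J\<close>.\<close>

lemma prolong_add_mset:
  assumes "smooth_at t f"
  shows "prolong f t (K, add_mset j J) = partial j (\<lambda>s. prolong f s (K, J)) t"
  using partials_mset_cong[OF smooth_at_component[OF assms], of "SOME js. mset js = add_mset j J" "j # (SOME js. mset js = J)" K]
  by (simp add: prolong_def mset_SOME)

lemma base_matrix_prolong: "base_matrix e (prolong f t) = (\<chi> i j. partial j (\<lambda>s. f s $ e i) t)"
  by (simp add: base_matrix_def prolong_def)

text \<open>If the components \<open>f\<^sup>\<sigma>\<close> are written as a function \<open>g\<close> of the components \<open>f\<^sup>i\<close>, then
  \<open>y\<^sup>\<sigma>\<^sub>I\<close> is the derivative \<open>\<partial>\<^sub>I g\<close>; this explains why \<open>y\<^sup>\<sigma>\<^sub>I\<close> is invariant under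
  reparametrization and symmetric in \<open>I\<close>.\<close>

lemma y_fun_prolong:
  fixes f :: "real ^ 'n::finite \<Rightarrow> real ^ 'N::finite"
  assumes "smooth_at t f" "smooth_at t h" "smooth_at (h t) g" "det (base_matrix e (prolong f t)) \<noteq> 0"
    and "\<forall>\<^sub>F s in nhds t. \<forall>i. f s $ e i = c $ i + h s $ i" "\<forall>\<^sub>F s in nhds t. f s $ \<sigma> = g (h s)"
  shows "y_fun e \<sigma> is (prolong f t) = partials is g (h t)"
  using assms
proof (induction "is" arbitrary: t)
  case Nil
  then show ?case using eventually_nhds_x_imp_x[OF Nil.prems(6)] by (simp add: prolong_def)
next
  case (Cons i "is")
  let ?p = "prolong f t" and ?k = "length is"
  let ?B = "base_matrix e ?p"
  obtain F where F: "rational_fun e ?k F" "\<And>p. det (base_matrix e p) \<noteq> 0 \<Longrightarrow> y_fun e \<sigma> is p = F p"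
    using y_fun_rational by blast
  obtain G where "total_derivative e ?k F G"
    using rational_fun_total_derivative[OF F(1)] by blast
  note G = this[THEN total_derivativeD(2)] this[THEN total_derivativeD(3)]
  have detev: "\<forall>\<^sub>F s in nhds t. det (base_matrix e (prolong f s)) \<noteq> 0"
  proof -
    have "isCont (\<lambda>s. base_matrix e (prolong f s) $ a $ b) t" for a b
      unfolding base_matrix_prolong using Cons.prems(1)
      by (auto intro!: smooth_at_continuous smooth_at_partial smooth_at_component)
    then show ?thesis using Cons.prems(4) by (rule eventually_det_nonzero)
  qed
  \<comment> \<open>The base matrix is the Jacobian of \<open>h\<close>, as the translation by
    \<open>c\<close> disappears under differentiation.\<close>
  have hB: "partial j (\<lambda>s. h s $ l) t = ?B $ l $ j" for j l
  proof -
    have "\<forall>\<^sub>F s in nhds t. f s $ e l = c $ l + h s $ l"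
      using Cons.prems(5) by eventually_elim simp
    then have "partial j (\<lambda>s. f s $ e l) t = partial j (\<lambda>s. c $ l + h s $ l) t"
      by (rule partial_cong_ev)
    then show ?thesis
      using partial_add[OF smooth_at_const smooth_at_component[OF Cons.prems(2)], of j "c $ l" l]
      by (simp add: base_matrix_prolong)
  qed
  \<comment> \<open>All assumptions persist near \<open>t\<close>, so the induction hypothesis holds
    there too and may be differentiated at \<open>t\<close>.\<close>
  have "\<forall>\<^sub>F s in nhds t. F (prolong f s) = partials is g (h s)"
    using detev eventually_smooth_at[OF Cons.prems(1)] eventually_smooth_at[OF Cons.prems(2)]
      eventually_nhds_smooth_compose[OF Cons.prems(2) eventually_smooth_at[OF Cons.prems(3)]]
      Cons.prems(5)[THEN eventually_eventually[THEN iffD2]] Cons.prems(6)[THEN eventually_eventually[THEN iffD2]]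
    by eventually_elim (simp add: F(2)[symmetric] Cons.IH)
  then have FP: "partial j (\<lambda>s. F (prolong f s)) t = (\<Sum>l\<in>UNIV. partial l (partials is g) (h t) * ?B $ l $ j)" for j
    using partial_compose[OF Cons.prems(2) smooth_at_partials[OF Cons.prems(3)], of j "is"]
    by (simp add: partial_cong_ev hB)
  \<comment> \<open>On a prolongation the formal derivative is a genuine one: the chain rule for
    \<open>F\<close> produces derivatives of jet coordinates, and these are the jet coordinates of
    the next order.\<close>
  have FD: "formal_deriv ?k j (y_fun e \<sigma> is) ?p = partial j (\<lambda>s. F (prolong f s)) t" for j
  proof -
    have "partial j (\<lambda>s. F (prolong f s)) t = (\<Sum>a\<in>jet_index ?k. G a ?p * partial j (\<lambda>s. prolong f s a) t)"
      using G(2)[of t "prolong f"] Cons.prems(1,4) smooth_at_prolong by blast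
    also have "\<dots> = (\<Sum>(K, J)\<in>jet_index ?k. coord_partial (K, J) (y_fun e \<sigma> is) ?p * ?p (K, add_mset j J))"
      using coord_partial_eq[OF F(2) Cons.prems(4) G(1)[OF Cons.prems(4)]]
      by (intro sum.cong refl) (auto simp: prolong_add_mset[OF Cons.prems(1)])
    finally show ?thesis by (simp add: formal_deriv_def)
  qed
  \<comment> \<open>The chain rule for \<open>g\<close> along \<open>h\<close> contributes the base
    matrix as a factor, and the inverse matrix in \<open>y_fun\<close> cancels it.\<close>
  have "y_fun e \<sigma> (i # is) ?p = (\<Sum>j\<in>UNIV. \<Sum>l\<in>UNIV. partial l (partials is g) (h t) * (?B $ l $ j * matrix_inv ?B $ j $ i))"
    by (simp add: FD FP sum_distrib_left mult_ac)
  also have "\<dots> = (\<Sum>l\<in>UNIV. \<Sum>j\<in>UNIV. partial l (partials is g) (h t) * (?B $ l $ j * matrix_inv ?B $ j $ i))"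
    by (rule sum.swap)
  also have "\<dots> = (\<Sum>l\<in>UNIV. partial l (partials is g) (h t) * (?B ** matrix_inv ?B) $ l $ i)"
    by (simp add: matrix_matrix_mult_def sum_distrib_left)
  also have "\<dots> = partials (i # is) g (h t)"
    by (simp add: matrix_inv_mult(1)[OF Cons.prems(4)] mat_def if_distrib[of "\<lambda>a. _ * a"] cong: if_cong)
  finally show ?case .
qed

subsection \<open>Monomials and smoothness in coordinates\<close>

lemma partial_eq_along_axis:
  assumes "smooth_at t f" "((\<lambda>u. f (t + u *\<^sub>R axis j 1)) has_real_derivative D) (at 0)"
  shows "partial j f t = D"
  using has_real_derivative_along_axis[of t 0 j f] assms DERIV_unique by fastforce

lemma partial_component: "partial j (\<lambda>s. s $ i) t = (if i = j then 1 else 0)"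
proof -
  have "((\<lambda>s. s $ i) has_derivative (\<lambda>s. s $ i)) (at t)"
    by (rule bounded_linear_imp_has_derivative[OF bounded_linear_vec_nth])
  then show ?thesis by (simp add: partial_eqI axis_def)
qed

lemma partials_const: "partials js (\<lambda>s. c) = (\<lambda>s. if js = [] then c else 0)"
  by (induction js) simp_all

lemma partials_affine:
  "partials js (\<lambda>s. c + s $ i) 0 = (if js = [] then c else if js = [i] then 1 else 0)"
proof (cases js rule: rev_cases)
  case (snoc ks j)
  have "partial j (\<lambda>s. c + s $ i) t = (if i = j then 1 else 0)" for t
    using partial_add[OF smooth_at_const smooth_at_component[OF smooth_at_ident], of j c i]
    by (simp add: partial_component)
  then have "partial j (\<lambda>s. c + s $ i) = (\<lambda>s. if i = j then 1 else 0)" by blast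
  then show ?thesis using snoc by (auto simp: partials_const)
qed simp

lemma partials_add_scaled:
  assumes "smooth_at t f" "smooth_at t g"
  shows "partials js (\<lambda>s. f s + c * g s) t = partials js f t + c * partials js g t"
  using assms
proof (induction js arbitrary: t)
  case (Cons j js)
  note sm = smooth_at_partials[OF Cons.prems(1), of js] smooth_at_partials[OF Cons.prems(2), of js]
  have "\<forall>\<^sub>F s in nhds t. partials js (\<lambda>s. f s + c * g s) s = partials js f s + c * partials js g s"
    using eventually_smooth_at[OF Cons.prems(1)] eventually_smooth_at[OF Cons.prems(2)]
    by eventually_elim (rule Cons.IH)
  from partial_cong_ev[OF this] show ?case
    using sm by (simp add: partial_add partial_mult smooth_at_mult smooth_at_const)
qed simp

text \<open>The normalized power t^J / J!, dual to the iterated derivatives at 0. Adding a multiple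
  of it to a component of a map shifts a single jet coordinate.\<close>

definition monomial :: "'n multiset \<Rightarrow> real ^ 'n::finite \<Rightarrow> real" where
  "monomial J t = (\<Prod>j\<in>UNIV. t $ j ^ count J j / fact (count J j))"

lemma smooth_at_monomial: "smooth_at t (monomial J)"
proof -
  have "smooth_at t (\<lambda>s. s $ j ^ n / fact n)" for j :: 'a and n
  proof -
    have "smooth_at t (\<lambda>s. s $ j ^ n)"
      by (induction n)
        (auto intro: smooth_at_const smooth_at_mult smooth_at_component[OF smooth_at_ident])
    then show ?thesis
      using smooth_at_mult[OF smooth_at_const[of t "inverse (fact n :: real)"]] by (simp add: field_simps)
  qed
  then show ?thesis unfolding monomial_def[abs_def] by (intro smooth_at_prod)
qed

text \<open>With the other variables collected in the constant \<open>?C\<close> this is the rule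
  for u^n / n!, whose factorials absorb the exponent.\<close>

lemma partial_monomial:
  "partial j (monomial J) = (if j \<in># J then monomial (J - {#j#}) else (\<lambda>t. 0))"
proof
  fix t :: "real ^ 'a"
  let ?C = "\<Prod>i\<in>UNIV - {j}. t $ i ^ count J i / fact (count J i)"
  have eq: "monomial J (t + u *\<^sub>R axis j 1) = (t $ j + u) ^ count J j / fact (count J j) * ?C" for u
  proof -
    have "(\<Prod>i\<in>UNIV - {j}. (t + u *\<^sub>R axis j 1) $ i ^ count J i / fact (count J i)) = ?C"
      by (intro prod.cong refl) (auto simp: axis_def)
    then show ?thesis
      unfolding monomial_def by (subst prod.remove[of _ j]) (simp_all add: axis_def)
  qed
  show "partial j (monomial J) t = (if j \<in># J then monomial (J - {#j#}) else (\<lambda>t. 0)) t"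
  proof (cases "j \<in># J")
    case True
    then obtain n where n: "count J j = Suc n" by (metis count_greater_zero_iff gr0_conv_Suc)
    have "(\<Prod>i\<in>UNIV - {j}. t $ i ^ count (J - {#j#}) i / fact (count (J - {#j#}) i)) = ?C"
      by (intro prod.cong refl) auto
    then have m: "monomial (J - {#j#}) t = t $ j ^ n / fact n * ?C"
      unfolding monomial_def by (subst prod.remove[of _ j]) (simp_all add: n)
    have "((\<lambda>u. t $ j + u) has_real_derivative 1) (at 0)"
      by (auto intro!: derivative_eq_intros)
    from DERIV_power_Suc[OF this, of n]
    have "((\<lambda>u. (t $ j + u) ^ Suc n / fact (Suc n) * ?C) has_real_derivative
        (1 + real n) * (1 * (t $ j + 0) ^ n) / fact (Suc n) * ?C) (at 0)"
      by (intro DERIV_cmult_right DERIV_cdivide)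
    moreover have "(1 + real n) * (1 * (t $ j + 0) ^ n) / fact (Suc n) = t $ j ^ n / fact n"
    proof -
      have "1 + real n \<noteq> 0" by linarith
      then show ?thesis unfolding fact_Suc of_nat_Suc by simp
    qed
    ultimately have "((\<lambda>u. monomial J (t + u *\<^sub>R axis j 1)) has_real_derivative monomial (J - {#j#}) t) (at 0)"
      unfolding eq n m by simp
    then show ?thesis
      using True by (simp add: partial_eq_along_axis[OF smooth_at_monomial])
  next
    case False
    then have "count J j = 0" by (simp add: count_eq_zero_iff)
    then show ?thesis
      using False by (intro partial_eq_along_axis smooth_at_monomial) (simp add: eq)
  qed
qed

text \<open>The induction is on the end of the list, where the derivative applied first sits; it
  removes one element from \<open>J\<close> or annihilates the monomial.\<close>

lemma partials_monomial:
  "partials js (monomial J) 0 = (if mset js = J then 1 else 0)"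
proof (induction js arbitrary: J rule: rev_induct)
  case Nil
  show ?case
  proof (cases "J = {#}")
    case False
    then obtain j where "j \<in># J" by blast
    then have "(\<Prod>j\<in>UNIV. (0 :: real ^ 'a) $ j ^ count J j / fact (count J j)) = 0"
      by (intro prod_zero) (auto intro!: bexI[of _ j])
    then show ?thesis using False by (simp add: monomial_def)
  qed (simp add: monomial_def)
next
  case (snoc j js)
  then show ?case by (auto simp: partial_monomial partials_const)
qed

text \<open>Smoothness in coordinates is inherited along an embedding \<open>\<iota>\<close> of coordinate spaces
  that only adjoins constant coordinates. Since \<open>H\<close> is only known on \<open>U\<close>, its
  partial derivatives require \<open>U\<close> to be open in each coordinate direction.\<close>

lemma coord_smooth_on_pullback:
  assumes F: "coord_smooth_on I U' F" and "I' \<subseteq> I"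
    and \<iota>: "\<And>q i s. i \<in> I' \<Longrightarrow> \<iota> (q(i := s)) = (\<iota> q)(i := s)" "\<And>q i. i \<in> I' \<Longrightarrow> \<iota> q i = q i"
    and U: "\<And>q. q \<in> U \<Longrightarrow> \<iota> q \<in> U'" "\<And>q. q \<in> U \<Longrightarrow> H q = F (\<iota> q)"
    and op: "\<And>q i. q \<in> U \<Longrightarrow> i \<in> I' \<Longrightarrow> \<forall>\<^sub>F s in nhds (q i). q(i := s) \<in> U"
    and cont: "continuous_on U \<iota>"
  shows "coord_smooth_on I' U H"
proof -
  have ev: "\<forall>\<^sub>F s in nhds (q i). foldr coord_partial is H (q(i := s)) = foldr coord_partial is F ((\<iota> q)(i := s))"
    if "\<forall>q\<in>U. foldr coord_partial is H q = foldr coord_partial is F (\<iota> q)" "q \<in> U" "i \<in> I'" for q i "is"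
    using op[OF that(2,3)] by eventually_elim (use that \<iota>(1) in auto)
  \<comment> \<open>The relation between \<open>H\<close> and \<open>F\<close> passes to every
    iterated partial derivative, since \<iota> commutes with moving one coordinate and a small move
    stays in \<open>U\<close>.\<close>
  have eq: "\<forall>q\<in>U. foldr coord_partial is H q = foldr coord_partial is F (\<iota> q)" if "is \<in> lists I'" for "is"
    using that
  proof (induction "is")
    case Nil
    then show ?case using U(2) by simp
  next
    case (Cons i "is")
    then have i: "i \<in> I'" and IH: "\<forall>q\<in>U. foldr coord_partial is H q = foldr coord_partial is F (\<iota> q)" by auto
    show ?case
      using deriv_cong_ev[OF ev[OF IH _ i] refl] \<iota>(2)[OF i] by (simp add: coord_partial_def[of i])
  qed
  show ?thesis
    unfolding coord_smooth_on_def
  proof (intro ballI conjI)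
    fix "is" assume "is": "is \<in> lists I'"
    then have "is'": "is \<in> lists I" using assms(2) by auto
    have "continuous_on U (\<lambda>q. foldr coord_partial is F (\<iota> q))"
      using F "is'" U(1) unfolding coord_smooth_on_def by (intro continuous_on_compose2[OF _ cont]) auto
    then show "continuous_on U (foldr coord_partial is H)"
      by (rule continuous_on_eq) (simp add: eq[OF "is"])
    fix i q assume i: "i \<in> I'" and q: "q \<in> U"
    have "(\<lambda>s. foldr coord_partial is F ((\<iota> q)(i := s))) differentiable (at (q i))"
      using F "is'" U(1)[OF q] i assms(2) \<iota>(2)[OF i, of q] unfolding coord_smooth_on_def by (metis subsetD)
    then obtain D where "((\<lambda>s. foldr coord_partial is F ((\<iota> q)(i := s))) has_derivative D) (at (q i))"
      unfolding differentiable_def by blast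
    moreover have "foldr coord_partial is H (q(i := q i)) = foldr coord_partial is F ((\<iota> q)(i := q i))"
      using eventually_nhds_x_imp_x[OF ev[OF eq[OF "is"] q i]] .
    moreover have "\<forall>\<^sub>F s in at (q i). foldr coord_partial is F ((\<iota> q)(i := s)) = foldr coord_partial is H (q(i := s))"
      using ev[OF eq[OF "is"] q i] unfolding eventually_at_filter by eventually_elim simp
    ultimately have "((\<lambda>s. foldr coord_partial is H (q(i := s))) has_derivative D) (at (q i))"
      using has_derivative_transform_eventually by fastforce
    then show "(\<lambda>s. foldr coord_partial is H (q(i := s))) differentiable (at (q i))"
      unfolding differentiable_def by blast
  qed
qed

subsection \<open>Normal forms\<close>

context smooth_structure begin

lemma jet_coords_jet:
  fixes \<gamma> :: "real ^ 'n::finite \<Rightarrow> 'x"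
  assumes "smooth_at_0 A \<gamma>" "(V, x) \<in> A" "\<gamma> 0 \<in> V"
  shows "jet_coords r x (jet A r \<gamma>) = restrict (prolong (\<lambda>t. x (\<gamma> t)) 0) (jet_index r)"
proof -
  have "length (SOME js. mset js = J) = size J" for J :: "'n multiset"
    by (metis mset_SOME size_mset)
  then show ?thesis
    using rep_jet(3)[OF assms, of r]
    unfolding jet_coords_eq_prolong by (auto simp: prolong_def jet_index_def agree_def fun_eq_iff restrict_def)
qed

text \<open>\<open>smooth_wrt\<close> reads a function through \<open>inv_into\<close>; injectivity
  ensures that this returns its value at the velocity with the given coordinates. Order 0 fixes the
  base point, as \<open>x\<close> is injective on \<open>V\<close>, and the higher orders fix the
  jet.\<close>

lemma jet_coords_inj:
  assumes c: "(V, x) \<in> A" and "r \<ge> 1"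
  shows "inj_on (jet_coords r x) {p \<in> Imm A r. rep (p :: ('x, 'n::finite) velocity) 0 \<in> V}"
proof (rule inj_onI)
  fix p q :: "('x, 'n) velocity"
  assume p: "p \<in> {p \<in> Imm A r. rep p 0 \<in> V}" and q: "q \<in> {p \<in> Imm A r. rep p 0 \<in> V}"
    and eq: "jet_coords r x p = jet_coords r x q"
  define \<gamma> \<delta> where "\<gamma> = rep p" and "\<delta> = rep q"
  have \<gamma>: "smooth_at_0 A \<gamma>" "\<gamma> 0 \<in> V" "p = jet A r \<gamma>" and \<delta>: "smooth_at_0 A \<delta>" "\<delta> 0 \<in> V" "q = jet A r \<delta>"
    using Imm_rep[OF _ assms(2)] p q immersive_smooth by (auto simp: \<gamma>_def \<delta>_def)
  note sm = smooth_at_0_chart[OF \<gamma>(1) c \<gamma>(2)] smooth_at_0_chart[OF \<delta>(1) c \<delta>(2)]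
  have eq': "prolong (\<lambda>t. x (\<gamma> t)) 0 a = prolong (\<lambda>t. x (\<delta> t)) 0 a" if "a \<in> jet_index r" for a
    using fun_cong[OF eq, of a] that by (simp add: jet_coords_eq_prolong \<gamma>_def \<delta>_def)
  have "agree r 0 (\<lambda>t. x (\<gamma> t) $ k) (\<lambda>t. x (\<delta> t) $ k)" for k
    unfolding agree_def
  proof (intro allI impI)
    fix js :: "'n list" assume "length js \<le> r"
    then have "prolong (\<lambda>t. x (\<gamma> t)) 0 (k, mset js) = prolong (\<lambda>t. x (\<delta> t)) 0 (k, mset js)"
      by (intro eq') (simp add: jet_index_def)
    moreover have "prolong f 0 (k, mset js) = partials js (\<lambda>t. f t $ k) 0"
      if "smooth_at 0 f" for f :: "real ^ 'n \<Rightarrow> real ^ 'N"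
      using partials_mset_cong[OF smooth_at_component[OF that] mset_SOME] by (simp add: prolong_def)
    ultimately show "partials js (\<lambda>t. x (\<gamma> t) $ k) 0 = partials js (\<lambda>t. x (\<delta> t) $ k) 0"
      using sm by (simp add: chart_smooth_def)
  qed
  moreover from this have "x (\<gamma> 0) = x (\<delta> 0)" using agree_imp_eq by (metis vec_eq_iff)
  then have "\<gamma> 0 = \<delta> 0" using chart(3)[OF c] \<gamma>(2) \<delta>(2) by (metis inj_onD)
  ultimately show "p = q"
    unfolding \<gamma>(3) \<delta>(3) by (intro jet_eqI[OF c \<delta>(2,1) \<gamma>(1)]) auto
qed

lemma base_matrix_jet:
  assumes "smooth_at_0 A \<gamma>" "(V, x) \<in> A" "\<gamma> 0 \<in> V" "r \<ge> 1"
  shows "base_matrix e (jet_coords r x (jet A r \<gamma>)) = minor x e \<gamma> 0"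
  using assms(4) by (simp add: jet_coords_jet[OF assms(1-3)] base_matrix_def minor_def prolong_def jet_index_def)

lemma jet_in_W_dom:
  assumes "smooth_at_0 A \<gamma>" "(V, x) \<in> A" "\<gamma> 0 \<in> V" "r \<ge> 1" "det (minor x e \<gamma> 0) \<noteq> 0"
  shows "jet A r \<gamma> \<in> W_dom A r V x e"
  using immersive_if_minor[OF assms(2) smooth_at_0_chart[OF assms(1-3)] assms(5)] rep_jet(2)[OF assms(1)]
    base_matrix_jet[OF assms(1-4)] assms(3,5)
  by (auto simp: W_dom_def Imm_eq)

lemma W_dom_rep:
  assumes "p \<in> W_dom A r V x e" "(V, x) \<in> A" "r \<ge> 1"
  shows "smooth_at_0 A (rep p)" "rep p 0 \<in> V" "jet A r (rep p) = p" "det (minor x e (rep p) 0) \<noteq> 0"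
proof -
  have p: "p \<in> Imm A r" "rep p 0 \<in> V" "det (base_matrix e (jet_coords r x p)) \<noteq> 0"
    using assms(1) by (auto simp: W_dom_def)
  show sm: "smooth_at_0 A (rep p)" and V: "rep p 0 \<in> V" and j: "jet A r (rep p) = p"
    using Imm_rep[OF p(1) assms(3)] immersive_smooth p(2) by auto
  show "det (minor x e (rep p) 0) \<noteq> 0"
    using base_matrix_jet[OF sm assms(2) V assms(3), of e] p(3) j by simp
qed

text \<open>The velocities of maps in normal form, i.e. of graphs over the coordinates \<open>x\<^sup>i\<close>, form a section
  of the quotient projection over \<open>W_dom\<close>.\<close>

definition normal_form :: "'x set \<Rightarrow> ('x \<Rightarrow> real ^ 'N) \<Rightarrow> ('n \<Rightarrow> 'N) \<Rightarrow> (real ^ 'n::finite \<Rightarrow> 'x) \<Rightarrow> bool" where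
  "normal_form V x e \<gamma> \<longleftrightarrow> smooth_at_0 A \<gamma> \<and> \<gamma> 0 \<in> V \<and>
    (\<forall>\<^sub>F s in nhds 0. \<forall>i. x (\<gamma> s) $ e i = x (\<gamma> 0) $ e i + s $ i)"

lemma normal_form_partials:
  assumes "normal_form V x e \<gamma>"
  shows "partials js (\<lambda>t. x (\<gamma> t) $ e i) 0 = (if js = [] then x (\<gamma> 0) $ e i else if js = [i] then 1 else 0)"
proof -
  have "\<forall>\<^sub>F s in nhds 0. x (\<gamma> s) $ e i = x (\<gamma> 0) $ e i + s $ i"
    using assms unfolding normal_form_def by (auto elim: eventually_mono)
  then have "partials js (\<lambda>t. x (\<gamma> t) $ e i) 0 = partials js (\<lambda>s. x (\<gamma> 0) $ e i + s $ i) 0"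
    by (rule partials_cong_ev)
  then show ?thesis by (simp add: partials_affine)
qed

lemma normal_form_minor:
  assumes "normal_form V x e \<gamma>"
  shows "minor x e \<gamma> 0 = mat 1"
  using normal_form_partials[OF assms, of "[_]"] by (auto simp: minor_def mat_def vec_eq_iff)

lemma W_dom_normal_form:
  assumes p: "p \<in> W_dom A r V x e" and c: "(V, x) \<in> A" and r: "r \<ge> 1"
  obtains \<gamma> \<alpha> where "normal_form V x e \<gamma>" "local_diffeo_0 \<alpha>" "p = jet A r (\<lambda>t. \<gamma> (\<alpha> t))"
proof -
  define \<delta> where "\<delta> = rep p"
  have \<delta>: "smooth_at_0 A \<delta>" "\<delta> 0 \<in> V" "jet A r \<delta> = p" "det (minor x e \<delta> 0) \<noteq> 0"
    using W_dom_rep[OF p c r] by (simp_all add: \<delta>_def)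
  have sm: "smooth_at 0 (\<lambda>t. x (\<delta> t))"
    using smooth_at_0_chart[OF \<delta>(1) c \<delta>(2)] by (simp add: chart_smooth_def)
  define h where "h t = (\<chi> i. x (\<delta> t) $ e i - x (\<delta> 0) $ e i)" for t
  have hs: "smooth_at 0 h"
    by (rule smooth_at_vec) (simp add: h_def smooth_at_diff smooth_at_const smooth_at_component[OF sm])
  have "partial j (\<lambda>t. h t $ i) 0 = partial j (\<lambda>t. x (\<delta> t) $ e i) 0" for i j
    using partial_add[OF smooth_at_component[OF sm] smooth_at_const, of j "e i" "- x (\<delta> 0) $ e i"]
    by (simp add: h_def)
  then have "jacobian h (at 0) = minor x e \<delta> 0"
    by (simp add: vec_eq_iff jacobian_component[OF hs] minor_def)
  moreover have h00: "h 0 = 0" by (simp add: h_def vec_eq_iff)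
  ultimately have h: "local_diffeo_0 h"
    using local_diffeo_0_if_det[OF h00 hs] \<delta>(4) by simp
  obtain \<beta> where \<beta>: "local_diffeo_0 \<beta>" "\<forall>\<^sub>F u in nhds 0. \<beta> (h u) = u" "\<forall>\<^sub>F w in nhds 0. h (\<beta> w) = w"
    using local_diffeo_0_inverse[OF h] by blast
  note \<beta>0 = local_diffeo_0_smooth[OF \<beta>(1)] and h0 = local_diffeo_0_smooth[OF h]
  have sm\<beta>: "smooth_at_0 A (\<lambda>t. \<delta> (\<beta> t))" by (rule smooth_at_0_compose[OF \<delta>(1) \<beta>(1)])
  have "\<forall>\<^sub>F s in nhds 0. \<forall>i. x (\<delta> (\<beta> s)) $ e i = x (\<delta> 0) $ e i + s $ i"
    using \<beta>(3)
  proof eventually_elim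
    case (elim s)
    have "x (\<delta> (\<beta> s)) $ e i - x (\<delta> 0) $ e i = h (\<beta> s) $ i" for i by (simp add: h_def)
    then show ?case using elim by (simp add: algebra_simps)
  qed
  then have "normal_form V x e (\<lambda>t. \<delta> (\<beta> t))"
    unfolding normal_form_def using sm\<beta> \<delta>(2) \<beta>0(1) by simp
  moreover have "jet A r (\<lambda>t. \<delta> (\<beta> (h t))) = jet A r \<delta>"
    using smooth_at_0_compose[OF sm\<beta> h] \<beta>(2) \<beta>0(1) h0(1)
    by (intro jet_cong_ev[OF c \<delta>(2,1)]) (auto elim: eventually_mono)
  ultimately show thesis using h \<delta>(3) by (intro that[of "\<lambda>t. \<delta> (\<beta> t)" h]) simp_all
qed

text \<open>\<open>y_fun_prolong\<close> applies with \<alpha> as \<open>h\<close> and a component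
  of \<open>x \<circ> \<gamma>\<close> as \<open>g\<close>; its value involves \<alpha> only through
  \<open>\<alpha> 0 = 0\<close>. The restriction to \<open>quot_index\<close> discards the
  derivatives of the base components, which do change with \<alpha>.\<close>

lemma W_coords_normal_form:
  assumes \<gamma>: "normal_form V x e \<gamma>" and \<alpha>: "local_diffeo_0 \<alpha>" and c: "(V, x) \<in> A" and r: "r \<ge> 1"
  shows "restrict (W_coords r x e (jet A r (\<lambda>t. \<gamma> (\<alpha> t)))) (quot_index r e) =
    restrict (jet_coords r x (jet A r \<gamma>)) (quot_index r e)"
proof (rule restrict_ext)
  fix a assume a: "a \<in> quot_index r e"
  obtain K J where KJ: "a = (K, J)" by (cases a)
  have aj: "(K, J) \<in> jet_index r" using a KJ by (auto simp: quot_index_def)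
  have sm: "smooth_at_0 A \<gamma>" and V: "\<gamma> 0 \<in> V"
    and n: "\<forall>\<^sub>F s in nhds 0. \<forall>i. x (\<gamma> s) $ e i = x (\<gamma> 0) $ e i + s $ i"
    using \<gamma> by (auto simp: normal_form_def)
  note \<alpha>0 = local_diffeo_0_smooth[OF \<alpha>]
  note smc = smooth_at_0_chart[OF sm c V]
  have x\<gamma>: "smooth_at (\<alpha> 0) (\<lambda>t. x (\<gamma> t))" using smc \<alpha>0(1) by (simp add: chart_smooth_def)
  have sm\<alpha>: "smooth_at_0 A (\<lambda>t. \<gamma> (\<alpha> t))" by (rule smooth_at_0_compose[OF sm \<alpha>])
  have V\<alpha>: "\<gamma> (\<alpha> 0) \<in> V" using V \<alpha>0(1) by simp
  let ?P = "prolong (\<lambda>t. x (\<gamma> (\<alpha> t))) 0"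
  have jc: "jet_coords r x (jet A r (\<lambda>t. \<gamma> (\<alpha> t))) = restrict ?P (jet_index r)"
    using jet_coords_jet[OF sm\<alpha> c] V\<alpha> by simp
  have jc\<gamma>: "jet_coords r x (jet A r \<gamma>) (K, J) = partials (SOME js. mset js = J) (\<lambda>t. x (\<gamma> t) $ K) 0"
    using aj by (simp add: jet_coords_jet[OF sm c V] prolong_def)
  have "W_coords r x e (jet A r (\<lambda>t. \<gamma> (\<alpha> t))) (K, J) = jet_coords r x (jet A r \<gamma>) (K, J)"
  proof (cases "K \<in> range e")
    case True
    then have "J = {#}" using a KJ by (auto simp: quot_index_def)
    then show ?thesis using True aj jc\<gamma> \<alpha>0(1) by (simp add: W_coords_def jc prolong_def)
  next
    case False
    let ?is = "SOME js. mset js = J"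
    have det: "det (base_matrix e ?P) \<noteq> 0"
      using minor_compose[OF smc \<alpha>, of e] normal_form_minor[OF \<gamma>] local_diffeo_0_det[OF \<alpha>]
      by (simp add: base_matrix_prolong minor_def)
    have "length ?is = size J" by (metis mset_SOME size_mset)
    then have len: "length ?is \<le> r" using aj by (simp add: jet_index_def)
    have "y_fun e K ?is (restrict ?P (jet_index r)) = y_fun e K ?is ?P"
      by (rule y_fun_cong[OF _ len r det, symmetric]) simp
    also have "\<dots> = partials ?is (\<lambda>t. x (\<gamma> t) $ K) (\<alpha> 0)"
    proof (rule y_fun_prolong[OF _ \<alpha>0(2) _ det])
      show "smooth_at 0 (\<lambda>t. x (\<gamma> (\<alpha> t)))" by (rule smooth_at_compose[OF \<alpha>0(2) x\<gamma>])
      show "smooth_at (\<alpha> 0) (\<lambda>t. x (\<gamma> t) $ K)" by (rule smooth_at_component[OF x\<gamma>])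
      show "\<forall>\<^sub>F s in nhds 0. \<forall>i. x (\<gamma> (\<alpha> s)) $ e i = (\<chi> i. x (\<gamma> 0) $ e i) $ i + \<alpha> s $ i"
        using eventually_nhds_smooth_compose[OF \<alpha>0(2), of "\<lambda>s. \<forall>i. x (\<gamma> s) $ e i = x (\<gamma> 0) $ e i + s $ i"] n \<alpha>0(1)
        by simp
    qed simp
    finally show ?thesis using False aj jc\<gamma> \<alpha>0(1) by (simp add: W_coords_def jc)
  qed
  then show "W_coords r x e (jet A r (\<lambda>t. \<gamma> (\<alpha> t))) a = jet_coords r x (jet A r \<gamma>) a"
    by (simp add: KJ)
qed

end

subsection \<open>Local form of homogeneous Lagrangians\<close>

text \<open>The jet coordinates of the velocity in normal form with given quotient coordinates.\<close>

definition quot_lift :: "nat \<Rightarrow> ('n \<Rightarrow> 'N) \<Rightarrow> ('N, 'n) jet_tuple \<Rightarrow> ('N, 'n) jet_tuple" where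
  "quot_lift r e q = restrict (\<lambda>(K, J). if (K, J) \<in> quot_index r e then q (K, J)
     else if \<exists>i. K = e i \<and> J = {#i#} then 1 else 0) (jet_index r)"

lemma quot_index_subset: "quot_index r e \<subseteq> jet_index r"
  by (auto simp: quot_index_def)

lemma quot_lift_upd: "i \<in> quot_index r e \<Longrightarrow> quot_lift r e (q(i := s)) = (quot_lift r e q)(i := s)"
  using quot_index_subset[of r e] by (fastforce simp: quot_lift_def fun_eq_iff)

lemma quot_lift_apply: "i \<in> quot_index r e \<Longrightarrow> quot_lift r e q i = q i"
  using quot_index_subset[of r e] by (cases i) (auto simp: quot_lift_def)

lemma continuous_on_quot_lift: "continuous_on U (quot_lift r e)"
proof (rule continuous_on_coordinatewise_then_product)
  fix a :: "'a \<times> 'b multiset"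
  have "continuous_on U (\<lambda>q. q a :: real)"
    by (rule continuous_on_subset[OF continuous_on_product_coordinates subset_UNIV])
  then show "continuous_on U (\<lambda>q. quot_lift r e q a)"
    by (cases "a \<in> jet_index r"; cases "a \<in> quot_index r e"; cases a) (simp_all add: quot_lift_def)
qed

section \<open>Quotient coordinates on the section\<close>

context smooth_structure begin

text \<open>The constants 1 and 0 inserted by \<open>quot_lift\<close> are the derivatives of the
  base components, which are a constant plus \<open>s $ i\<close>. Injectivity of \<open>e\<close>
  makes the \<open>i\<close> belonging to \<open>K = e i\<close> unique.\<close>

lemma jet_coords_normal_form:
  fixes e :: "'n::finite \<Rightarrow> 'N"
  assumes "normal_form V x e \<gamma>" "(V, x) \<in> A" "inj e"
  shows "quot_lift r e (restrict (jet_coords r x (jet A r \<gamma>)) (quot_index r e)) = jet_coords r x (jet A r \<gamma>)"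
proof
  fix a :: "'N \<times> 'n multiset"
  have jc: "jet_coords r x (jet A r \<gamma>) = restrict (prolong (\<lambda>t. x (\<gamma> t)) 0) (jet_index r)"
    using assms(1,2) jet_coords_jet unfolding normal_form_def by blast
  obtain K J where a: "a = (K, J)" by (cases a)
  show "quot_lift r e (restrict (jet_coords r x (jet A r \<gamma>)) (quot_index r e)) a = jet_coords r x (jet A r \<gamma>) a"
  proof (cases "(K, J) \<in> jet_index r \<and> (K, J) \<notin> quot_index r e")
    case True
    then obtain i where i: "K = e i" and J: "J \<noteq> {#}" by (auto simp: quot_index_def)
    have "(SOME js. mset js = J) \<noteq> []" using J mset_SOME[of J] by auto
    moreover have "(SOME js. mset js = J) = [i] \<longleftrightarrow> J = {#i#}"
      using mset_SOME[of J] SOME_mset_single by (metis mset_single_iff)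
    moreover have "(\<exists>i'. K = e i' \<and> J = {#i'#}) \<longleftrightarrow> J = {#i#}"
      using i assms(3) by (auto dest: injD)
    ultimately show ?thesis
      using True normal_form_partials[OF assms(1)] by (simp add: a i jc prolong_def quot_lift_def)
  next
    case False
    then show ?thesis by (auto simp: a quot_lift_def jc)
  qed
qed

lemma normal_form_in_W_dom:
  assumes "normal_form V x e \<gamma>" "(V, x) \<in> A" "r \<ge> 1"
  shows "jet A r \<gamma> \<in> W_dom A r V x e"
  using assms normal_form_minor[OF assms(1)] by (intro jet_in_W_dom) (auto simp: normal_form_def)

lemma orbit_proj_W_dom:
  assumes "(V, x) \<in> A" "r \<ge> 1"
  shows "orbit_proj A r ` W_dom A r V x e = {orbit_proj A r (jet A r \<gamma>) |\<gamma>. normal_form V x e \<gamma>}"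
proof -
  have "\<exists>\<gamma>. orbit_proj A r p = orbit_proj A r (jet A r \<gamma>) \<and> normal_form V x e \<gamma>"
    if p: "p \<in> W_dom A r V x e" for p
  proof -
    obtain \<gamma> \<alpha> where \<gamma>: "normal_form V x e \<gamma>" "local_diffeo_0 \<alpha>" "p = jet A r (\<lambda>t. \<gamma> (\<alpha> t))"
      using W_dom_normal_form[OF p assms] by blast
    then have "orbit_proj A r p = orbit_proj A r (jet A r \<gamma>)"
      using orbit_proj_compose[OF _ \<gamma>(2)] by (simp add: normal_form_def)
    then show ?thesis using \<gamma>(1) by blast
  qed
  then show ?thesis using normal_form_in_W_dom[OF _ assms] by blast
qed

lemma rep_orbit:
  assumes "smooth_at_0 A \<gamma>"
  obtains \<alpha> where "local_diffeo_0 \<alpha>" "rep (orbit_proj A r (jet A r \<gamma>)) = jet A r (\<lambda>t. \<gamma> (\<alpha> t))"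
proof -
  have "jet A r \<gamma> \<in> orbit_proj A r (jet A r \<gamma>)"
    unfolding orbit_proj_eq[OF assms] using local_diffeo_0_ident by (intro CollectI exI[of _ "\<lambda>t. t"]) simp
  then have "rep (orbit_proj A r (jet A r \<gamma>)) \<in> orbit_proj A r (jet A r \<gamma>)" by (rule rep_in)
  then show thesis using that unfolding orbit_proj_eq[OF assms] by blast
qed

text \<open>The \<open>rep\<close> of the orbit is some reparametrization of \<gamma>, and on all of
  these the invariant coordinates take the same values.\<close>

lemma quot_coords_normal_form:
  assumes "normal_form V x e \<gamma>" "(V, x) \<in> A" "r \<ge> 1"
  shows "quot_coords r x e (orbit_proj A r (jet A r \<gamma>)) = restrict (jet_coords r x (jet A r \<gamma>)) (quot_index r e)"
proof -
  obtain \<alpha> where "local_diffeo_0 \<alpha>" "rep (orbit_proj A r (jet A r \<gamma>)) = jet A r (\<lambda>t. \<gamma> (\<alpha> t))"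
    using rep_orbit assms(1) unfolding normal_form_def by blast
  then show ?thesis
    using W_coords_normal_form[OF assms(1) _ assms(2,3)] by (simp add: quot_coords_def)
qed

text \<open>Adding \<open>s\<close> times a monomial to the component \<open>K\<close> moves one jet
  coordinate and keeps the map a graph. This shows that the image of \<open>quot_coords\<close> is
  open in each coordinate direction. As \<open>monomial J 0\<close> vanishes for nonempty
  \<open>J\<close>, the condition on \<open>s\<close> restricts only translations of the base
  point.\<close>

lemma normal_form_perturb:
  assumes \<gamma>: "normal_form V x e \<gamma>" and c: "(V, x) \<in> A" and KJ: "(K, J) \<in> quot_index r e"
    and s: "x (\<gamma> 0) + (s * monomial J 0) *\<^sub>R axis K 1 \<in> x ` V"
  obtains \<delta> where "normal_form V x e \<delta>"
    "jet_coords r x (jet A r \<delta>) = (jet_coords r x (jet A r \<gamma>))((K, J) := jet_coords r x (jet A r \<gamma>) (K, J) + s)"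
proof -
  have sm: "smooth_at_0 A \<gamma>" and V: "\<gamma> 0 \<in> V"
    and n: "\<forall>\<^sub>F s in nhds 0. \<forall>i. x (\<gamma> s) $ e i = x (\<gamma> 0) $ e i + s $ i"
    using \<gamma> by (auto simp: normal_form_def)
  have x\<gamma>: "smooth_at 0 (\<lambda>t. x (\<gamma> t))"
    using smooth_at_0_chart[OF sm c V] by (simp add: chart_smooth_def)
  define f where "f t = x (\<gamma> t) + (s * monomial J t) *\<^sub>R axis K 1" for t
  have f: "smooth_at 0 f"
    unfolding f_def[abs_def]
    by (intro smooth_at_add x\<gamma> smooth_at_bilinear[OF bounded_bilinear_scaleR] smooth_at_mult
        smooth_at_const smooth_at_monomial)
  define \<delta> where "\<delta> t = inv_into V x (f t)" for t
  have "\<forall>\<^sub>F t in nhds 0. f t \<in> x ` V"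
    using eventually_nhds_smooth_compose[OF f, of "\<lambda>y. y \<in> x ` V"] s chart(2)[OF c]
    by (simp add: f_def eventually_nhds_in_open)
  then have ev: "\<forall>\<^sub>F t in nhds 0. \<delta> t \<in> V \<and> x (\<delta> t) = f t"
    by eventually_elim (simp add: \<delta>_def inv_into_into f_inv_into_f)
  then have "\<delta> 0 \<in> V" and x\<delta>0: "x (\<delta> 0) = f 0" using eventually_nhds_x_imp_x[OF ev] by auto
  moreover have ev': "\<forall>\<^sub>F t in nhds 0. f t = x (\<delta> t)" using ev by eventually_elim simp
  moreover have "chart_smooth V x \<delta> 0"
    unfolding chart_smooth_def using smooth_at_cong_ev[OF f ev'] ev by (auto elim: eventually_mono)
  ultimately have sm\<delta>: "smooth_at_0 A \<delta>" using smooth_at_0_iff[OF c] by blast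
  \<comment> \<open>For \<open>K\<close> in the range of \<open>e\<close> the index set forces
    \<open>J = {#}\<close>, so a base component is only translated and its form is
    preserved.\<close>
  have const: "monomial J t = monomial J 0" if "K \<in> range e" for t
    using KJ that by (simp add: quot_index_def monomial_def)
  have "\<forall>\<^sub>F t in nhds 0. \<forall>i. x (\<delta> t) $ e i = x (\<delta> 0) $ e i + t $ i"
    using n ev
  proof eventually_elim
    case (elim t)
    have "(s * monomial J t) *\<^sub>R axis K (1::real) $ e i = (s * monomial J 0) *\<^sub>R axis K 1 $ e i" for i
      using const[of t] by (cases "K = e i") (auto simp: axis_def)
    then show ?case using elim x\<delta>0 by (simp add: f_def)
  qed
  then have nf: "normal_form V x e \<delta>"
    using sm\<delta> \<open>\<delta> 0 \<in> V\<close> by (simp add: normal_form_def)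
  have p: "partials js (\<lambda>t. x (\<delta> t) $ k) 0 = partials js (\<lambda>t. x (\<gamma> t) $ k) 0 + (if k = K \<and> mset js = J then s else 0)" for js k
  proof -
    have "\<forall>\<^sub>F t in nhds 0. x (\<delta> t) $ k = x (\<gamma> t) $ k + (s * axis K 1 $ k) * monomial J t"
      using ev by eventually_elim (simp add: f_def)
    then have "partials js (\<lambda>t. x (\<delta> t) $ k) 0 =
        partials js (\<lambda>t. x (\<gamma> t) $ k + (s * axis K 1 $ k) * monomial J t) 0"
      by (rule partials_cong_ev)
    then show ?thesis
      using partials_add_scaled[OF smooth_at_component[OF x\<gamma>] smooth_at_monomial]
      by (simp add: partials_monomial axis_def)
  qed
  have "jet_coords r x (jet A r \<delta>) = (jet_coords r x (jet A r \<gamma>))((K, J) := jet_coords r x (jet A r \<gamma>) (K, J) + s)"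
  proof
    fix a
    show "jet_coords r x (jet A r \<delta>) a = ((jet_coords r x (jet A r \<gamma>))((K, J) := jet_coords r x (jet A r \<gamma>) (K, J) + s)) a"
      using KJ quot_index_subset[of r e]
      unfolding jet_coords_jet[OF sm\<delta> c \<open>\<delta> 0 \<in> V\<close>] jet_coords_jet[OF sm c V]
      by (cases a) (auto simp: prolong_def p mset_SOME restrict_def)
  qed
  with nf show thesis using that by blast
qed

section \<open>The homogeneity relation\<close>

lemma jet_det_diffeo_jet:
  assumes "local_diffeo_0 \<alpha>" "r \<ge> 1"
  shows "jet_det (diffeo_jet r \<alpha>) = det (jacobian \<alpha> (at 0))"
proof -
  have a: "diffeo_jet r \<alpha> \<in> diff_group r" using assms(1) by (simp add: diff_group_def)
  define \<beta> where "\<beta> = rep (diffeo_jet r \<alpha>)"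
  have \<beta>: "local_diffeo_0 \<beta>" "\<beta> \<in> diffeo_jet r \<alpha>"
    unfolding \<beta>_def by (rule diff_group_rep[OF a])+
  have "partial j (\<lambda>t. \<beta> t $ k) 0 = partial j (\<lambda>t. \<alpha> t $ k) 0" for j k
    using \<beta>(2) agree_imp_partial_eq[OF _ assms(2)] unfolding diffeo_jet_agree by blast
  then have "jacobian \<beta> (at 0) = jacobian \<alpha> (at 0)"
    using local_diffeo_0_smooth(2)[OF \<beta>(1)] local_diffeo_0_smooth(2)[OF assms(1)]
    by (simp add: vec_eq_iff jacobian_component)
  then show ?thesis by (simp add: jet_det_def \<beta>_def)
qed

text \<open>In normal form the base matrix is the identity, so after reparametrization by \<alpha>
  it equals the Jacobian of \<alpha>; the factor \<open>jet_det\<close> of homogeneity thereby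
  becomes the determinant of the base matrix.\<close>

lemma homogeneous_compose:
  assumes "homogeneous A r F" "normal_form V x e \<gamma>" "(V, x) \<in> A" "r \<ge> 1" "local_diffeo_0 \<alpha>"
  shows "F (jet A r (\<lambda>t. \<gamma> (\<alpha> t))) =
    det (base_matrix e (jet_coords r x (jet A r (\<lambda>t. \<gamma> (\<alpha> t))))) * F (jet A r \<gamma>)"
proof -
  have \<gamma>: "smooth_at_0 A \<gamma>" "\<gamma> 0 \<in> V" using assms(2) by (auto simp: normal_form_def)
  have "jet A r \<gamma> \<in> Imm A r"
    using normal_form_in_W_dom[OF assms(2-4)] by (simp add: W_dom_def)
  moreover have "diffeo_jet r \<alpha> \<in> diff_group r" using assms(5) by (simp add: diff_group_def)
  ultimately have "F (jet A r (\<lambda>t. \<gamma> (\<alpha> t))) = det (jacobian \<alpha> (at 0)) * F (jet A r \<gamma>)"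
    using assms(1) unfolding homogeneous_def
    by (metis jet_act_eq[OF \<gamma>(1) assms(5)] jet_det_diffeo_jet[OF assms(5,4)])
  moreover have "base_matrix e (jet_coords r x (jet A r (\<lambda>t. \<gamma> (\<alpha> t)))) = jacobian \<alpha> (at 0)"
    using base_matrix_jet[OF smooth_at_0_compose[OF \<gamma>(1) assms(5)] assms(3) _ assms(4), of e] \<gamma>(2)
      local_diffeo_0_smooth(1)[OF assms(5)] minor_compose[OF smooth_at_0_chart[OF \<gamma>(1) assms(3) \<gamma>(2)] assms(5), of e]
      normal_form_minor[OF assms(2)] by simp
  ultimately show ?thesis by simp
qed

lemma homogeneous_Lagrangian_imp_local:
  fixes e :: "'n::finite \<Rightarrow> 'N"
  assumes F: "homogeneous_Lagrangian A r F" and c: "(V, x) \<in> A" and "inj e" and r: "r \<ge> 1"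
  shows "\<exists>L. smooth_on_quot A r V x e L \<and>
    (\<forall>p\<in>W_dom A r V x e. F p = det (base_matrix e (jet_coords r x p)) * L (orbit_proj A r p))"
proof -
  have hom: "homogeneous A r F" using F by (simp add: homogeneous_Lagrangian_def)
  \<comment> \<open>Both numerator and denominator scale by the Jacobian determinant along an orbit,
    so the quotient has the same value for every representative; at a normal form the denominator is
    1.\<close>
  define L where "L c = F (rep c) / det (base_matrix e (jet_coords r x (rep c)))" for c
  have L: "L (orbit_proj A r (jet A r \<gamma>)) = F (jet A r \<gamma>)" if \<gamma>: "normal_form V x e \<gamma>" for \<gamma>
  proof -
    have sm: "smooth_at_0 A \<gamma>" "\<gamma> 0 \<in> V" using \<gamma> by (auto simp: normal_form_def)
    obtain \<alpha> where \<alpha>: "local_diffeo_0 \<alpha>" "rep (orbit_proj A r (jet A r \<gamma>)) = jet A r (\<lambda>t. \<gamma> (\<alpha> t))"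
      using rep_orbit[OF sm(1)] by blast
    have "base_matrix e (jet_coords r x (jet A r (\<lambda>t. \<gamma> (\<alpha> t)))) = minor x e (\<lambda>t. \<gamma> (\<alpha> t)) 0"
      using base_matrix_jet[OF smooth_at_0_compose[OF sm(1) \<alpha>(1)] c _ r] sm(2)
        local_diffeo_0_smooth(1)[OF \<alpha>(1)] by simp
    also have "\<dots> = jacobian \<alpha> (at 0)"
      using minor_compose[OF smooth_at_0_chart[OF sm(1) c sm(2)] \<alpha>(1), of e] normal_form_minor[OF \<gamma>] by simp
    finally have "det (base_matrix e (jet_coords r x (jet A r (\<lambda>t. \<gamma> (\<alpha> t))))) \<noteq> 0"
      using local_diffeo_0_det[OF \<alpha>(1)] by simp
    then show ?thesis
      using homogeneous_compose[OF hom \<gamma> c r \<alpha>(1)] by (simp add: L_def \<alpha>(2))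
  qed
  have "F p = det (base_matrix e (jet_coords r x p)) * L (orbit_proj A r p)" if p: "p \<in> W_dom A r V x e" for p
  proof -
    obtain \<gamma> \<alpha> where \<gamma>: "normal_form V x e \<gamma>" "local_diffeo_0 \<alpha>" "p = jet A r (\<lambda>t. \<gamma> (\<alpha> t))"
      using W_dom_normal_form[OF p c r] by blast
    then have "orbit_proj A r p = orbit_proj A r (jet A r \<gamma>)"
      using orbit_proj_compose[OF _ \<gamma>(2)] by (simp add: normal_form_def)
    then show ?thesis using homogeneous_compose[OF hom \<gamma>(1) c r \<gamma>(2)] L[OF \<gamma>(1)] \<gamma>(3) by simp
  qed
  moreover have "smooth_on_quot A r V x e L"
  proof -
    let ?\<Omega> = "{p \<in> Imm A r. rep p 0 \<in> V}" and ?Q = "orbit_proj A r ` W_dom A r V x e"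
    let ?U = "quot_coords r x e ` ?Q"
    \<comment> \<open>\<open>?G\<close> is the Lagrangian in jet coordinates. In quotient
      coordinates \<open>L\<close> turns out to be \<open>?G\<close> composed with
      \<open>?\<iota>\<close> on \<open>?U\<close>, which reduces its smoothness to that of
      \<open>?G\<close>.\<close>
    let ?G = "F \<circ> inv_into ?\<Omega> (jet_coords r x)" and ?\<iota> = "quot_lift r e"
    have U: "\<exists>\<gamma>. normal_form V x e \<gamma> \<and> q = restrict (jet_coords r x (jet A r \<gamma>)) (quot_index r e)"
      if "q \<in> ?U" for q
      using that quot_coords_normal_form[OF _ c r] unfolding orbit_proj_W_dom[OF c r] by auto
    have U': "restrict (jet_coords r x (jet A r \<gamma>)) (quot_index r e) \<in> ?U" if "normal_form V x e \<gamma>" for \<gamma>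
      using that quot_coords_normal_form[OF that c r] unfolding orbit_proj_W_dom[OF c r] by force
    have \<Omega>: "jet A r \<gamma> \<in> ?\<Omega>" if "normal_form V x e \<gamma>" for \<gamma>
      using normal_form_in_W_dom[OF that c r] by (simp add: W_dom_def)
    have "coord_smooth_on (jet_index r) (jet_coords r x ` ?\<Omega>) ?G"
      using F c unfolding homogeneous_Lagrangian_def smooth_on_Imm_def smooth_wrt_def by fast
    then have "coord_smooth_on (quot_index r e) ?U (L \<circ> inv_into ?Q (quot_coords r x e))"
    proof (rule coord_smooth_on_pullback[where \<iota> = ?\<iota>])
      show "quot_index r e \<subseteq> jet_index r" by (rule quot_index_subset)
      show "?\<iota> (q(i := s)) = (?\<iota> q)(i := s)" if "i \<in> quot_index r e" for q i s
        by (rule quot_lift_upd[OF that])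
      show "?\<iota> q i = q i" if "i \<in> quot_index r e" for q i
        by (rule quot_lift_apply[OF that])
      show "continuous_on ?U ?\<iota>" by (rule continuous_on_quot_lift)
    next
      fix q assume q: "q \<in> ?U"
      obtain \<gamma> where \<gamma>: "normal_form V x e \<gamma>" "q = restrict (jet_coords r x (jet A r \<gamma>)) (quot_index r e)"
        using U[OF q] by blast
      show "?\<iota> q \<in> jet_coords r x ` ?\<Omega>"
        unfolding \<gamma>(2) jet_coords_normal_form[OF \<gamma>(1) c \<open>inj e\<close>] using \<Omega>[OF \<gamma>(1)] by blast
    next
      fix q assume q: "q \<in> ?U"
      \<comment> \<open>Any orbit with the quotient coordinates \<open>q\<close> serves:
        \<open>q\<close> determines the jet coordinates of its normal form by
        \<open>quot_lift\<close>, and these determine the value of \<open>F\<close>.\<close>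
      have "inv_into ?Q (quot_coords r x e) q \<in> ?Q" using q by (rule inv_into_into)
      then obtain \<gamma> where \<gamma>: "normal_form V x e \<gamma>" "inv_into ?Q (quot_coords r x e) q = orbit_proj A r (jet A r \<gamma>)"
        unfolding orbit_proj_W_dom[OF c r] by blast
      have "q = quot_coords r x e (inv_into ?Q (quot_coords r x e) q)" using q by (simp add: f_inv_into_f)
      then have "q = restrict (jet_coords r x (jet A r \<gamma>)) (quot_index r e)"
        using quot_coords_normal_form[OF \<gamma>(1) c r] \<gamma>(2) by simp
      then have "?G (?\<iota> q) = F (jet A r \<gamma>)"
        using jet_coords_normal_form[OF \<gamma>(1) c \<open>inj e\<close>] inv_into_f_f[OF jet_coords_inj[OF c r] \<Omega>[OF \<gamma>(1)]]
        by simp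
      then show "(L \<circ> inv_into ?Q (quot_coords r x e)) q = ?G (?\<iota> q)"
        using L[OF \<gamma>(1)] \<gamma>(2) by simp
    next
      fix q and i :: "'N \<times> 'n multiset" assume q: "q \<in> ?U" and i: "i \<in> quot_index r e"
      obtain K J where KJ: "i = (K, J)" by (cases i)
      obtain \<gamma> where \<gamma>: "normal_form V x e \<gamma>" "q = restrict (jet_coords r x (jet A r \<gamma>)) (quot_index r e)"
        using U[OF q] by blast
      have "((\<lambda>s. x (\<gamma> 0) + ((s - q i) * monomial J 0) *\<^sub>R axis K (1::real)) \<longlongrightarrow>
          x (\<gamma> 0) + ((q i - q i) * monomial J 0) *\<^sub>R axis K 1) (nhds (q i))"
        by (intro tendsto_intros) (simp add: filterlim_ident)
      then have "((\<lambda>s. x (\<gamma> 0) + ((s - q i) * monomial J 0) *\<^sub>R axis K (1::real)) \<longlongrightarrow> x (\<gamma> 0)) (nhds (q i))"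
        by simp
      moreover have "x (\<gamma> 0) \<in> x ` V" using \<gamma>(1) by (simp add: normal_form_def)
      ultimately have "\<forall>\<^sub>F s in nhds (q i). x (\<gamma> 0) + ((s - q i) * monomial J 0) *\<^sub>R axis K 1 \<in> x ` V"
        using chart(2)[OF c] topological_tendstoD by blast
      then show "\<forall>\<^sub>F s in nhds (q i). q(i := s) \<in> ?U"
      proof eventually_elim
        case (elim s)
        obtain \<delta> where \<delta>: "normal_form V x e \<delta>" "jet_coords r x (jet A r \<delta>) =
            (jet_coords r x (jet A r \<gamma>))((K, J) := jet_coords r x (jet A r \<gamma>) (K, J) + (s - q i))"
          using normal_form_perturb[OF \<gamma>(1) c i[unfolded KJ] elim] by blast
        have "q(i := s) = restrict (jet_coords r x (jet A r \<delta>)) (quot_index r e)"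
          unfolding \<delta>(2) using i KJ by (auto simp: \<gamma>(2) fun_eq_iff restrict_def)
        then show ?case using U'[OF \<delta>(1)] by simp
      qed
    qed
    then show ?thesis by (simp add: smooth_on_quot_def smooth_wrt_def)
  qed
  ultimately show ?thesis by blast
qed

text \<open>Reparametrization multiplies the minor by the nonzero Jacobian determinant of \<alpha>,
  so the velocity and its image under the group element lie in the same \<open>W_dom\<close>, and
  the same \<open>L\<close> is evaluated at the same orbit.\<close>

lemma local_imp_homogeneous:
  fixes F :: "('x, 'n::finite) velocity \<Rightarrow> real"
  assumes r: "r \<ge> 1" and L: "\<And>V x e. (V, x) \<in> A \<Longrightarrow> inj (e :: 'n \<Rightarrow> 'N) \<Longrightarrow>
    \<exists>L. \<forall>p\<in>W_dom A r V x e. F p = det (base_matrix e (jet_coords r x p)) * L (orbit_proj A r p)"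
  shows "homogeneous A r F"
  unfolding homogeneous_def
proof (intro ballI)
  fix p :: "('x, 'n) velocity" and a :: "(real ^ 'n \<Rightarrow> real ^ 'n) set"
  assume p: "p \<in> Imm A r" and a: "a \<in> diff_group r"
  define \<gamma> \<alpha> where "\<gamma> = rep p" and "\<alpha> = rep a"
  have \<gamma>: "immersive \<gamma>" "p = jet A r \<gamma>" using Imm_rep[OF p r] by (auto simp: \<gamma>_def)
  have \<alpha>: "local_diffeo_0 \<alpha>" "a = diffeo_jet r \<alpha>" using diff_group_rep[OF a] by (auto simp: \<alpha>_def)
  note sm = immersive_smooth[OF \<gamma>(1)]
  note sm\<alpha> = smooth_at_0_compose[OF sm \<alpha>(1)]
  obtain V x where c: "(V, x) \<in> A" "\<gamma> 0 \<in> V" using smooth_at_0_obtain[OF sm] by blast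
  have V\<alpha>: "\<gamma> (\<alpha> 0) \<in> V" using c(2) local_diffeo_0_smooth(1)[OF \<alpha>(1)] by simp
  obtain e :: "'n \<Rightarrow> 'N" where e: "inj e" "det (minor x e \<gamma> 0) \<noteq> 0"
    using minor_if_immersive[OF c(1) \<gamma>(1) c(2)] by blast
  have det: "det (minor x e (\<lambda>t. \<gamma> (\<alpha> t)) 0) = det (minor x e \<gamma> 0) * det (jacobian \<alpha> (at 0))"
    using minor_compose[OF smooth_at_0_chart[OF sm c] \<alpha>(1)] by (simp add: det_mul)
  then have W: "p \<in> W_dom A r V x e" "jet A r (\<lambda>t. \<gamma> (\<alpha> t)) \<in> W_dom A r V x e"
    using jet_in_W_dom[OF sm c r] jet_in_W_dom[OF sm\<alpha> c(1) V\<alpha> r] e(2) local_diffeo_0_det[OF \<alpha>(1)] \<gamma>(2) by auto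
  obtain L where L: "\<And>p. p \<in> W_dom A r V x e \<Longrightarrow>
      F p = det (base_matrix e (jet_coords r x p)) * L (orbit_proj A r p)"
    using L[OF c(1) e(1)] by blast
  have "F (jet_act A r p a) = F (jet A r (\<lambda>t. \<gamma> (\<alpha> t)))"
    using jet_act_eq[OF sm \<alpha>(1)] \<gamma>(2) \<alpha>(2) by simp
  also have "\<dots> = det (minor x e (\<lambda>t. \<gamma> (\<alpha> t)) 0) * L (orbit_proj A r (jet A r (\<lambda>t. \<gamma> (\<alpha> t))))"
    using L[OF W(2)] base_matrix_jet[OF sm\<alpha> c(1) V\<alpha> r] by simp
  also have "\<dots> = det (jacobian \<alpha> (at 0)) * (det (minor x e \<gamma> 0) * L (orbit_proj A r p))"
    using orbit_proj_compose[OF sm \<alpha>(1)] det \<gamma>(2) by simp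
  also have "\<dots> = jet_det a * F p"
    using L[OF W(1)] base_matrix_jet[OF sm c r] \<gamma>(2) by (simp add: jet_det_def \<alpha>_def)
  finally show "F (jet_act A r p a) = jet_det a * F p" .
qed

end

theorem proposition3p5:
  fixes X :: "'x topology"
    and A :: "('x, 'N::finite) chart set"
    and Lag :: "('x, 'n::finite) velocity \<Rightarrow> real"
    and r m :: nat
  assumes "smooth_manifold X A"
    and "CARD('N) = CARD('n) + m"
    and "r \<ge> 1"
  shows "(homogeneous_Lagrangian A r Lag \<longrightarrow>
      (\<forall>(V, x)\<in>A. \<forall>e :: 'n \<Rightarrow> 'N. inj e \<longrightarrow>
        (\<exists>L. smooth_on_quot A r V x e L \<and>
          (\<forall>p\<in>W_dom A r V x e.
             Lag p = det (base_matrix e (jet_coords r x p)) * L (orbit_proj A r p)))))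
    \<and> ((\<forall>(V, x)\<in>A. \<forall>e :: 'n \<Rightarrow> 'N. inj e \<longrightarrow>
        (\<exists>L. smooth_on_quot A r V x e L \<and>
          (\<forall>p\<in>W_dom A r V x e.
             Lag p = det (base_matrix e (jet_coords r x p)) * L (orbit_proj A r p))))
      \<longrightarrow> homogeneous A r Lag)"
proof -
  interpret smooth_structure X A by unfold_locales (rule assms(1))
  show ?thesis
  proof (intro conjI impI)
    assume "homogeneous_Lagrangian A r Lag"
    then show "\<forall>(V, x)\<in>A. \<forall>e :: 'n \<Rightarrow> 'N. inj e \<longrightarrow>
        (\<exists>L. smooth_on_quot A r V x e L \<and>
          (\<forall>p\<in>W_dom A r V x e.
             Lag p = det (base_matrix e (jet_coords r x p)) * L (orbit_proj A r p)))"
      using homogeneous_Lagrangian_imp_local[OF _ _ _ assms(3)] by blast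
  next
    assume "\<forall>(V, x)\<in>A. \<forall>e :: 'n \<Rightarrow> 'N. inj e \<longrightarrow>
        (\<exists>L. smooth_on_quot A r V x e L \<and>
          (\<forall>p\<in>W_dom A r V x e.
             Lag p = det (base_matrix e (jet_coords r x p)) * L (orbit_proj A r p)))"
    then show "homogeneous A r Lag"
      by (intro local_imp_homogeneous[OF assms(3)]) fast
  qed
qed

end
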